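(* The unitary automorphism group $\mathcal{U}(\Sigma_{FP})$ of the Fourier-Plancherel sphere $\Sigma_{FP}$ is generated by $$\{M_{\phi_s},\,M_\lambda,\,F,\,e^{i\psi}I:s,\lambda,\psi\in\mathbb{R}\}.$$
   Context: $H^2(\mathbb{R})\subseteq L^2(\mathbb{R})$ is the Hardy space of the upper half plane; $[K]$ is the orthogonal projection onto a closed subspace $K$. The Fourier-Plancherel sphere $\Sigma_{FP}$ is the closure, in the strong operator topology, of $\mathcal{M}\cup\mathcal{M}^\perp$, where $\mathcal{M}=\{[e^{i(\lambda_1x+\lambda_2x^2)}H^2(\mathbb{R})]:(\lambda_1,\lambda_2)\in\mathbb{R}^2\}$ and $\mathcal{M}^\perp=\{I-P:P\in\mathcal{M}\}$. For a set $\mathcal{P}$ of projections on a Hilbert space $\mathcal{H}$, the unitary automorphism group is $\mathcal{U}(\mathcal{P})=\{U\text{ unitary on }\mathcal{H}:(\operatorname{Ad}U)\mathcal{P}=\mathcal{P}\}$, where $(\operatorname{Ad}U)T=UTU^*$. On $L^2(\mathbb{R})$: $M_{\phi_s}$ is multiplication by $\phi_s(x)=e^{-isx^2/2}$; $M_\lambda$ is multiplication by $e^{i\lambda x}$; $F$ is the unitary Fourier-Plancherel transform $Ff(x)=\frac{1}{\sqrt{2\pi}}\int_{-\infty}^\infty f(y)e^{-ixy}\,dy$. *)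

theory Defs
  imports "HOL-Complex_Analysis.Complex_Analysis" "HOL-Algebra.Generated_Groups"
begin

section \<open>The Hilbert space of square-integrable functions on the line\<close>

definition square_integrable :: "(real \<Rightarrow> complex) \<Rightarrow> bool" where
  "square_integrable f \<longleftrightarrow>
     f \<in> borel_measurable lborel \<and> integrable lborel (\<lambda>x. (norm (f x))\<^sup>2)"

lemma square_integrable_zero: "square_integrable (\<lambda>x. 0)"
  by (simp add: square_integrable_def)

lemma square_integrable_add:
  assumes "square_integrable f" "square_integrable g"
  shows "square_integrable (\<lambda>x. f x + g x)"
proof -
  have "integrable lborel (\<lambda>x. 2 * (norm (f x))\<^sup>2 + 2 * (norm (g x))\<^sup>2)"
    using assms by (auto simp: square_integrable_def)
  then have "integrable lborel (\<lambda>x. (norm (f x + g x))\<^sup>2)"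
  proof (rule Bochner_Integration.integrable_bound)
    show "(\<lambda>x. (norm (f x + g x))\<^sup>2) \<in> borel_measurable lborel"
      using assms by (auto simp: square_integrable_def)
    have "(norm (f x + g x))\<^sup>2 \<le> 2 * (norm (f x))\<^sup>2 + 2 * (norm (g x))\<^sup>2" for x
    proof -
      have "(norm (f x + g x))\<^sup>2 \<le> (norm (f x) + norm (g x))\<^sup>2"
        by (intro power_mono norm_triangle_ineq) simp
      also have "\<dots> \<le> 2 * (norm (f x))\<^sup>2 + 2 * (norm (g x))\<^sup>2"
        using sum_squares_bound[of "norm (f x)" "norm (g x)"] by (simp add: power2_sum)
      finally show ?thesis .
    qed
    then show "AE x in lborel. norm ((norm (f x + g x))\<^sup>2)
        \<le> norm (2 * (norm (f x))\<^sup>2 + 2 * (norm (g x))\<^sup>2)"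
      by simp
  qed
  then show ?thesis
    using assms by (auto simp: square_integrable_def)
qed

lemma square_integrable_mult:
  assumes \<phi>: "\<phi> \<in> borel_measurable lborel" "\<And>x. norm (\<phi> x) \<le> B" and f: "square_integrable f"
  shows "square_integrable (\<lambda>x. \<phi> x * f x)"
proof -
  have "integrable lborel (\<lambda>x. B\<^sup>2 * (norm (f x))\<^sup>2)"
    using f by (auto simp: square_integrable_def)
  then have "integrable lborel (\<lambda>x. (norm (\<phi> x * f x))\<^sup>2)"
  proof (rule Bochner_Integration.integrable_bound)
    show "(\<lambda>x. (norm (\<phi> x * f x))\<^sup>2) \<in> borel_measurable lborel"
      using \<phi> f by (auto simp: square_integrable_def)
    show "AE x in lborel. norm ((norm (\<phi> x * f x))\<^sup>2) \<le> norm (B\<^sup>2 * (norm (f x))\<^sup>2)"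
      using \<phi>(2) by (auto simp: norm_mult power_mult_distrib intro!: mult_right_mono power_mono)
  qed
  then show ?thesis
    using \<phi> f by (auto simp: square_integrable_def)
qed

lemma square_integrable_cmult:
  "square_integrable f \<Longrightarrow> square_integrable (\<lambda>x. c * f x)"
  by (rule square_integrable_mult[where B = "norm c"]) auto

lemma borel_measurable_cnj [measurable]:
  "f \<in> borel_measurable M \<Longrightarrow> (\<lambda>x. cnj (f x)) \<in> borel_measurable M"
  by (rule borel_measurable_continuous_on[where f = cnj, unfolded o_def])
    (auto intro!: continuous_intros)

lemma integrable_cinner:
  assumes "square_integrable f" "square_integrable g"
  shows "integrable lborel (\<lambda>x. f x * cnj (g x))"
proof -
  have "integrable lborel (\<lambda>x. (norm (f x))\<^sup>2 + (norm (g x))\<^sup>2)"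
    using assms by (auto simp: square_integrable_def)
  then show ?thesis
  proof (rule Bochner_Integration.integrable_bound)
    show "(\<lambda>x. f x * cnj (g x)) \<in> borel_measurable lborel"
      using assms by (auto simp: square_integrable_def)
    have "norm (f x) * norm (g x) \<le> (norm (f x))\<^sup>2 + (norm (g x))\<^sup>2" for x
      using sum_squares_bound[of "norm (f x)" "norm (g x)"]
        mult_nonneg_nonneg[OF norm_ge_zero[of "f x"] norm_ge_zero[of "g x"]]
      unfolding mult.assoc by linarith
    then show "AE x in lborel. norm (f x * cnj (g x)) \<le> norm ((norm (f x))\<^sup>2 + (norm (g x))\<^sup>2)"
      by (simp add: norm_mult)
  qed
qed

definition L2_rel :: "(real \<Rightarrow> complex) \<Rightarrow> (real \<Rightarrow> complex) \<Rightarrow> bool" where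
  "L2_rel f g \<longleftrightarrow> square_integrable f \<and> square_integrable g \<and> (AE x in lborel. f x = g x)"

lemma L2_rel_eq:
  assumes "\<And>x. f x = g x" "square_integrable f"
  shows "L2_rel f g"
proof -
  have "f = g" using assms(1) by (rule ext)
  then show ?thesis using assms(2) by (simp add: L2_rel_def)
qed

text \<open>\<open>L2_of f\<close> is the class of \<open>f\<close>; it is meaningful only for square-integrable \<open>f\<close>.\<close>

quotient_type L2 = "real \<Rightarrow> complex" / partial: L2_rel
  morphisms L2_rep L2_of
proof (rule part_equivpI)
  show "\<exists>f. L2_rel f f"
    using square_integrable_zero by (auto simp: L2_rel_def)
  show "symp L2_rel"
    by (auto simp: symp_def L2_rel_def)
  show "transp L2_rel"
    unfolding transp_def L2_rel_def by (auto elim: eventually_elim2)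
qed

lemma L2_of_eq_iff:
  assumes "square_integrable f" "square_integrable g"
  shows "L2_of f = L2_of g \<longleftrightarrow> (AE x in lborel. f x = g x)"
  using assms Quotient3_rel[OF Quotient3_L2, of f g] by (auto simp: L2_rel_def)

lift_definition cinner :: "L2 \<Rightarrow> L2 \<Rightarrow> complex" is
  "\<lambda>f g. \<integral>x. f x * cnj (g x) \<partial>lborel"
  unfolding L2_rel_def square_integrable_def
  by (intro integral_cong_AE) auto

lift_definition scaleC :: "complex \<Rightarrow> L2 \<Rightarrow> L2" is "\<lambda>c f x. c * f x"
  unfolding L2_rel_def by (auto intro: square_integrable_cmult)

instantiation L2 :: real_vector
begin

lift_definition zero_L2 :: L2 is "\<lambda>x. 0"
  by (simp add: L2_rel_def square_integrable_zero)

lift_definition plus_L2 :: "L2 \<Rightarrow> L2 \<Rightarrow> L2" is "\<lambda>f g x. f x + g x"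
  unfolding L2_rel_def by (auto intro: square_integrable_add)

lift_definition uminus_L2 :: "L2 \<Rightarrow> L2" is "\<lambda>f x. - f x"
  unfolding L2_rel_def square_integrable_def by auto

definition minus_L2 :: "L2 \<Rightarrow> L2 \<Rightarrow> L2" where "minus_L2 f g = f + - g"

definition scaleR_L2 :: "real \<Rightarrow> L2 \<Rightarrow> L2" where "scaleR_L2 r f = scaleC (complex_of_real r) f"

instance
proof
  fix f g h :: L2 and a b :: real
  show "f + g + h = f + (g + h)"
    by transfer (auto intro!: L2_rel_eq square_integrable_add simp: L2_rel_def)
  show "f + g = g + f"
    by transfer (auto intro!: L2_rel_eq square_integrable_add simp: L2_rel_def)
  show "0 + f = f"
    by transfer simp
  show "- f + f = 0"
    by transfer (auto intro!: L2_rel_eq square_integrable_zero)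
  show "f - g = f + - g"
    by (simp add: minus_L2_def)
  show "a *\<^sub>R (f + g) = a *\<^sub>R f + a *\<^sub>R g"
    unfolding scaleR_L2_def by transfer
      (auto intro!: L2_rel_eq square_integrable_add square_integrable_cmult
        simp: L2_rel_def distrib_left)
  show "(a + b) *\<^sub>R f = a *\<^sub>R f + b *\<^sub>R f"
    unfolding scaleR_L2_def by transfer
      (rule L2_rel_eq, simp add: distrib_right,
       metis L2_rel_def square_integrable_cmult)
  show "a *\<^sub>R b *\<^sub>R f = (a * b) *\<^sub>R f"
    unfolding scaleR_L2_def by transfer
      (auto intro!: L2_rel_eq square_integrable_cmult simp: L2_rel_def mult.assoc)
  show "1 *\<^sub>R f = f"
    unfolding scaleR_L2_def by transfer simp
qed

end

lemma cinner_add_left: "cinner (f + g) h = cinner f h + cinner g h"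
proof transfer
  fix f g h assume "L2_rel f f" "L2_rel g g" "L2_rel h h"
  then show "(\<integral>x. (f x + g x) * cnj (h x) \<partial>lborel) =
      (\<integral>x. f x * cnj (h x) \<partial>lborel) + (\<integral>x. g x * cnj (h x) \<partial>lborel)"
    by (subst Bochner_Integration.integral_add[symmetric])
      (auto simp: L2_rel_def integrable_cinner distrib_right)
qed

lemma cinner_scaleC_left: "cinner (scaleC c f) g = c * cinner f g"
  by transfer (simp add: mult.assoc)

lemma cinner_cnj: "cinner g f = cnj (cinner f g)"
  by transfer (simp flip: Bochner_Integration.integral_cnj add: mult.commute)

lemma cinner_self:
  "cinner (L2_of f) (L2_of f) = complex_of_real (\<integral>x. (norm (f x))\<^sup>2 \<partial>lborel)"
  if "square_integrable f" for f
proof -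
  have "L2_rel f f" using that by (simp add: L2_rel_def)
  then have "cinner (L2_of f) (L2_of f) = (\<integral>x. f x * cnj (f x) \<partial>lborel)"
    by (simp add: cinner.abs_eq)
  also have "\<dots> = (\<integral>x. complex_of_real ((norm (f x))\<^sup>2) \<partial>lborel)"
    by (simp only: complex_norm_square)
  also have "\<dots> = complex_of_real (\<integral>x. (norm (f x))\<^sup>2 \<partial>lborel)"
    by (rule integral_complex_of_real)
  finally show ?thesis .
qed

lemma L2_cases: obtains f where "square_integrable f" "u = L2_of f"
proof -
  have "\<exists>f. square_integrable f \<and> u = L2_of f"
    by (rule L2.abs_induct[of _ u]) (unfold L2_rel_def, blast)
  then show thesis using that by blast
qed

instantiation L2 :: real_inner
begin

definition inner_L2 :: "L2 \<Rightarrow> L2 \<Rightarrow> real" where "inner_L2 f g = Re (cinner f g)"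
definition norm_L2 :: "L2 \<Rightarrow> real" where "norm_L2 f = sqrt (inner f f)"
definition sgn_L2 :: "L2 \<Rightarrow> L2" where "sgn_L2 f = f /\<^sub>R norm f"
definition dist_L2 :: "L2 \<Rightarrow> L2 \<Rightarrow> real" where "dist_L2 f g = norm (f - g)"
definition uniformity_L2 :: "(L2 \<times> L2) filter" where
  "uniformity_L2 = (INF e\<in>{0 <..}. principal {(f, g). dist f g < e})"
definition open_L2 :: "L2 set \<Rightarrow> bool" where
  "open_L2 S = (\<forall>f\<in>S. \<forall>\<^sub>F (f', g) in uniformity. f' = f \<longrightarrow> g \<in> S)"

instance
proof
  fix f g h :: L2 and r :: real and S :: "L2 set"
  show "inner f g = inner g f"
    unfolding inner_L2_def by (subst cinner_cnj) simp
  show "inner (f + g) h = inner f h + inner g h"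
    by (simp add: inner_L2_def cinner_add_left)
  show "inner (r *\<^sub>R f) g = r * inner f g"
    by (simp add: inner_L2_def scaleR_L2_def cinner_scaleC_left)
  obtain u where u: "square_integrable u" "f = L2_of u" by (rule L2_cases)
  have I: "inner f f = (\<integral>x. (norm (u x))\<^sup>2 \<partial>lborel)"
    using u by (simp add: inner_L2_def cinner_self)
  show "0 \<le> inner f f"
    unfolding I by simp
  have "(\<integral>x. (norm (u x))\<^sup>2 \<partial>lborel) = 0 \<longleftrightarrow> (AE x in lborel. (norm (u x))\<^sup>2 = 0)"
    using u by (intro integral_nonneg_eq_0_iff_AE) (auto simp: square_integrable_def)
  moreover have "f = 0 \<longleftrightarrow> (AE x in lborel. u x = 0)"
    unfolding u(2) zero_L2_def using u(1) square_integrable_zero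
    by (subst L2_of_eq_iff) (auto simp: L2_rel_def)
  ultimately show "inner f f = 0 \<longleftrightarrow> f = 0"
    unfolding I by simp
qed (simp_all add: norm_L2_def sgn_L2_def dist_L2_def uniformity_L2_def open_L2_def)

end

lemma bounded_linear_scaleC: "bounded_linear (scaleC c)"
proof (rule bounded_linear_intro)
  fix u v :: L2 and r :: real
  show "scaleC c (u + v) = scaleC c u + scaleC c v"
    by transfer (auto intro!: L2_rel_eq square_integrable_add square_integrable_cmult
        simp: L2_rel_def algebra_simps)
  show "scaleC c (r *\<^sub>R u) = r *\<^sub>R scaleC c u"
    unfolding scaleR_L2_def
    by transfer (auto intro!: L2_rel_eq square_integrable_cmult simp: L2_rel_def)
  have "cinner (scaleC c u) (scaleC c u) = complex_of_real ((norm c)\<^sup>2) * cinner u u"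
    using cinner_scaleC_left[of c u "scaleC c u"] cinner_cnj[of u "scaleC c u"]
      cinner_scaleC_left[of c u u] cinner_cnj[of u u]
    by (simp add: complex_norm_square[symmetric] mult.assoc[symmetric] del: of_real_power)
  then have "(norm (scaleC c u))\<^sup>2 = (norm u * norm c)\<^sup>2"
    by (simp add: power2_norm_eq_inner inner_L2_def power_mult_distrib flip: of_real_power)
  then show "norm (scaleC c u) \<le> norm u * norm c"
    by (simp add: power2_eq_iff_nonneg)
qed

text \<open>Operators have type \<^typ>\<open>L2 \<Rightarrow>\<^sub>L L2\<close>, which is only real-linear: complex linearity has to be
  required explicitly.\<close>

definition clinear :: "(L2 \<Rightarrow>\<^sub>L L2) \<Rightarrow> bool" where
  "clinear T \<longleftrightarrow> (\<forall>c f. T (scaleC c f) = scaleC c (T f))"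

definition unitary :: "(L2 \<Rightarrow>\<^sub>L L2) \<Rightarrow> bool" where
  "unitary U \<longleftrightarrow> clinear U \<and> surj U \<and> (\<forall>f g. cinner (U f) (U g) = cinner f g)"

definition adj :: "(L2 \<Rightarrow>\<^sub>L L2) \<Rightarrow> (L2 \<Rightarrow>\<^sub>L L2)" where
  "adj T = (THE S :: L2 \<Rightarrow>\<^sub>L L2. \<forall>f g. cinner (T f) g = cinner f (S g))"

definition Ad :: "(L2 \<Rightarrow>\<^sub>L L2) \<Rightarrow> (L2 \<Rightarrow>\<^sub>L L2) \<Rightarrow> (L2 \<Rightarrow>\<^sub>L L2)" where
  "Ad U T = U o\<^sub>L T o\<^sub>L adj U"

definition unitary_automorphism_group :: "(L2 \<Rightarrow>\<^sub>L L2) set \<Rightarrow> (L2 \<Rightarrow>\<^sub>L L2) set" where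
  "unitary_automorphism_group \<P> = {U. unitary U \<and> Ad U ` \<P> = \<P>}"

definition unitary_group :: "(L2 \<Rightarrow>\<^sub>L L2) monoid" where
  "unitary_group = \<lparr>carrier = {U. unitary U}, monoid.mult = (o\<^sub>L), one = id_blinfun\<rparr>"

definition proj :: "L2 set \<Rightarrow> (L2 \<Rightarrow>\<^sub>L L2)" where
  "proj K = (THE P :: L2 \<Rightarrow>\<^sub>L L2. \<forall>f. P f \<in> K \<and> (\<forall>g\<in>K. cinner (f - P f) g = 0))"

section \<open>Multiplication operators and the Fourier--Plancherel transform\<close>

definition mult_op :: "(real \<Rightarrow> complex) \<Rightarrow> (L2 \<Rightarrow>\<^sub>L L2)" where
  "mult_op \<phi> = (THE T :: L2 \<Rightarrow>\<^sub>L L2. \<forall>f. square_integrable f \<longrightarrow> T (L2_of f) = L2_of (\<lambda>x. \<phi> x * f x))"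

lemma mult_op_apply:
  assumes \<phi>: "\<phi> \<in> borel_measurable lborel" "\<And>x. norm (\<phi> x) \<le> B" and f: "square_integrable f"
  shows "mult_op \<phi> (L2_of f) = L2_of (\<lambda>x. \<phi> x * f x)"
proof -
  define m where "m u = L2_of (\<lambda>x. \<phi> x * L2_rep u x)" for u
  have rep: "L2_rel (L2_rep (L2_of g)) g" if "square_integrable g" for g
    using that Quotient3_rep_abs[OF Quotient3_L2, of g] by (simp add: L2_rel_def)
  have m: "m (L2_of g) = L2_of (\<lambda>x. \<phi> x * g x)" if "square_integrable g" for g
    unfolding m_def using rep[OF that] square_integrable_mult[OF \<phi>]
    by (subst L2_of_eq_iff) (auto simp: L2_rel_def)
  have plus: "L2_of g + L2_of h = L2_of (\<lambda>x. g x + h x)"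
    if "square_integrable g" "square_integrable h" for g h
    using that by (simp add: plus_L2.abs_eq L2_rel_def)
  have scale: "r *\<^sub>R L2_of g = L2_of (\<lambda>x. complex_of_real r * g x)"
    if "square_integrable g" for g r
    using that by (simp add: scaleR_L2_def scaleC.abs_eq L2_rel_def)
  have "bounded_linear m"
  proof (rule bounded_linear_intro)
    fix u v :: L2 and r :: real
    obtain g where g: "square_integrable g" "u = L2_of g" by (rule L2_cases)
    obtain h where h: "square_integrable h" "v = L2_of h" by (rule L2_cases)
    show "m (u + v) = m u + m v"
      using g h square_integrable_mult[OF \<phi>]
      by (simp add: m plus square_integrable_add distrib_left)
    show "m (r *\<^sub>R u) = r *\<^sub>R m u"
      using g square_integrable_mult[OF \<phi>]
      by (simp add: m scale square_integrable_cmult mult.left_commute)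
    have B: "0 \<le> B" using \<phi>(2)[of 0] norm_ge_zero[of "\<phi> 0"] by linarith
    have "(\<integral>x. (norm (\<phi> x * g x))\<^sup>2 \<partial>lborel) \<le> (\<integral>x. B\<^sup>2 * (norm (g x))\<^sup>2 \<partial>lborel)"
      using g square_integrable_mult[OF \<phi> g(1)] \<phi>(2)
      by (intro integral_mono)
        (auto simp: square_integrable_def norm_mult power_mult_distrib
          intro!: mult_right_mono power_mono)
    also have "\<dots> = B\<^sup>2 * (\<integral>x. (norm (g x))\<^sup>2 \<partial>lborel)"
      by simp
    finally have "sqrt (\<integral>x. (norm (\<phi> x * g x))\<^sup>2 \<partial>lborel)
        \<le> sqrt (B\<^sup>2 * (\<integral>x. (norm (g x))\<^sup>2 \<partial>lborel))"
      by (rule real_sqrt_le_mono)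
    then show "norm (m u) \<le> norm u * B"
      using g square_integrable_mult[OF \<phi> g(1)] B
      by (simp add: m norm_L2_def inner_L2_def cinner_self real_sqrt_mult mult.commute)
  qed
  then have "\<forall>g. square_integrable g \<longrightarrow>
      blinfun_apply (Blinfun m) (L2_of g) = L2_of (\<lambda>x. \<phi> x * g x)"
    by (simp add: bounded_linear_Blinfun_apply m)
  moreover have "S = T"
    if "\<forall>g. square_integrable g \<longrightarrow> blinfun_apply S (L2_of g) = L2_of (\<lambda>x. \<phi> x * g x)"
      "\<forall>g. square_integrable g \<longrightarrow> blinfun_apply T (L2_of g) = L2_of (\<lambda>x. \<phi> x * g x)" for S T
  proof (rule blinfun_eqI)
    fix u
    obtain g where "square_integrable g" "u = L2_of g" by (rule L2_cases)
    then show "blinfun_apply S u = blinfun_apply T u" using that by simp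
  qed
  ultimately have "\<forall>g. square_integrable g \<longrightarrow> mult_op \<phi> (L2_of g) = L2_of (\<lambda>x. \<phi> x * g x)"
    unfolding mult_op_def using theI'[of "\<lambda>T. \<forall>g. square_integrable g \<longrightarrow> blinfun_apply T (L2_of g) = L2_of (\<lambda>x. \<phi> x * g x)"]
    by blast
  then show ?thesis using f by blast
qed

definition modulation :: "real \<Rightarrow> (L2 \<Rightarrow>\<^sub>L L2)" where
  "modulation l = mult_op (\<lambda>x. exp (\<i> * complex_of_real (l * x)))"

definition chirp :: "real \<Rightarrow> (L2 \<Rightarrow>\<^sub>L L2)" where
  "chirp s = mult_op (\<lambda>x. exp (- \<i> * complex_of_real (s * x\<^sup>2 / 2)))"

definition phase :: "real \<Rightarrow> (L2 \<Rightarrow>\<^sub>L L2)" where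
  "phase \<psi> = Blinfun (scaleC (exp (\<i> * complex_of_real \<psi>)))"

text \<open>By Plancherel's theorem and the density of integrable functions, the integral formula has
  exactly one bounded extension to the whole space.\<close>

definition fourier :: "L2 \<Rightarrow>\<^sub>L L2" where
  "fourier = (THE F :: L2 \<Rightarrow>\<^sub>L L2. \<forall>f. square_integrable f \<and> integrable lborel f \<longrightarrow>
     F (L2_of f) =
       L2_of (\<lambda>x. complex_of_real (1 / sqrt (2 * pi)) *
         (\<integral>y. f y * exp (- \<i> * complex_of_real (x * y)) \<partial>lborel)))"

section \<open>The Hardy space and the Fourier--Plancherel sphere\<close>

text \<open>A function in the Hardy space of the upper half plane is identified with its boundary
  value, the limit in mean square of its restrictions to horizontal lines.\<close>

definition hardy_space :: "L2 set" where
  "hardy_space = {f. \<exists>G. G holomorphic_on {z. Im z > 0} \<and>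
     (\<forall>y>0. square_integrable (\<lambda>x. G (Complex x y))) \<and>
     (\<exists>C. \<forall>y>0. (\<integral>x. (norm (G (Complex x y)))\<^sup>2 \<partial>lborel) \<le> C) \<and>
     ((\<lambda>y. L2_of (\<lambda>x. G (Complex x y))) \<longlongrightarrow> f) (at_right 0)}"

definition FP_manifold :: "(L2 \<Rightarrow>\<^sub>L L2) set" where
  "FP_manifold =
     {proj (mult_op (\<lambda>x. exp (\<i> * complex_of_real (l1 * x + l2 * x\<^sup>2))) ` hardy_space) | l1 l2. True}"

definition FP_sphere :: "(L2 \<Rightarrow>\<^sub>L L2) set" where
  "FP_sphere =
     Abstract_Topology.closure_of strong_operator_topology
       (FP_manifold \<union> {id_blinfun - P | P. P \<in> FP_manifold})"

text \<open>The strong operator closure is formed among real-linear operators; by the next lemma it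
  agrees with the closure among complex-linear ones.\<close>

lemma clinear_sot_closure:
  assumes "\<And>T. T \<in> S \<Longrightarrow> clinear T" "T \<in> Abstract_Topology.closure_of strong_operator_topology S"
  shows "clinear T"
proof -
  have "T (scaleC c f) = scaleC c (T f)" for c f
  proof -
    have sc: "continuous_map euclidean euclidean (scaleC c)"
      using linear_continuous_on[OF bounded_linear_scaleC] by auto
    have "closedin strong_operator_topology
        {A \<in> topspace strong_operator_topology. blinfun_apply A (scaleC c f) = scaleC c (blinfun_apply A f)}"
      by (rule closedin_continuous_maps_eq[where Y = euclidean])
        (auto intro!: strong_operator_topology_continuous_evaluation
          continuous_map_compose[OF strong_operator_topology_continuous_evaluation sc, unfolded o_def])
    moreover have "S \<subseteq> {A \<in> topspace strong_operator_topology.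
        blinfun_apply A (scaleC c f) = scaleC c (blinfun_apply A f)}"
      using assms(1) by (auto simp: clinear_def strong_operator_topology_topspace)
    ultimately show ?thesis
      using assms(2) closure_of_minimal by blast
  qed
  then show ?thesis by (simp add: clinear_def)
qed

end

theory Submission
  imports Defs "HOL-Probability.Probability"
begin

text \<open>The Weyl operators \<open>W(l, m) f x = exp (\<i> (l x - l m / 2)) f (x - m)\<close> are permuted by the
  generators: a chirp maps \<open>(l, m)\<close> to \<open>(l - s m, m)\<close> and the Fourier transform maps it to
  \<open>(- m, l)\<close>. By the Paley--Wiener theorem the projections in \<open>FP_manifold\<close> are the spectral
  projections of half-planes of the phase plane with non-vertical boundary line that lie on a fixed
  side of it. The strong closure of these and their complements consists of the projections of all
  half-planes together with \<open>0\<close> and the identity: it is a union of continuous images of a compact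
  square. An operator that carries the modulations to the Weyl operators of another direction
  carries half-planes to half-planes, so all generators are automorphisms.

  Conversely, let \<open>U\<close> be an automorphism. The generated group is transitive on half-planes, and
  \<open>Ad U\<close> preserves the order of projections, under which only parallel half-planes are comparable.
  So we may assume that \<open>U\<close> permutes the projections onto \<open>L\<^sup>2[t, \<infinity>)\<close> increasingly and maps
  \<open>H\<^sup>2\<close> to itself or to its complement. Then \<open>U\<close> carries multiplication by \<open>exp (\<i> l x)\<close> to
  multiplication by \<open>exp (\<i> l \<gamma>(x))\<close> with \<open>\<gamma>\<close> increasing, and maps \<open>exp (\<i> x) H\<^sup>2\<close> to
  \<open>exp (\<i> \<beta> x) H\<^sup>2\<close> or to its complement. Hence the unimodular function
  \<open>exp (\<i> (\<gamma>(x) - \<beta> x))\<close> preserves \<open>H\<^sup>2\<close> and is constant, so \<open>\<gamma>(x) = \<beta> x\<close>. Here \<open>\<beta> > 0\<close>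
  as \<open>\<gamma>\<close> increases, whereas \<open>\<beta> \<le> 0\<close> if \<open>H\<^sup>2\<close> were mapped to its complement. After composition
  with the dilation by \<open>\<beta>\<close>, which lies in the generated group, \<open>U\<close> commutes with the modulations
  and with the projection onto \<open>H\<^sup>2\<close>, hence with all Weyl operators, and is a scalar.\<close>

section \<open>The Hilbert space\<close>

text \<open>\<open>adj\<close>, \<open>proj\<close>, \<open>mult_op\<close> and
  \<open>fourier\<close> are definite descriptions, so nothing can be computed with them before
  existence and uniqueness are known; for \<open>fourier\<close> this is Plancherel's theorem.
  Gaussians with complex parameter carry that part: the Fourier transform and the Weyl operators act
  on them by closed formulas, and they are total. No spectral theorem for position and momentum is
  invoked: uniqueness of Fourier transforms of integrable functions leads from modulations to all
  bounded multipliers, and step functions lead from rays back to modulations. In the strong topology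
  it is not evident that sequences describe closures, so closedness of the expected answer comes
  from compactness: slope and position of a line are confined to a square, the Fourier transform
  exchanging steep and flat slopes, and continuous images of a compact set are closed in a Hausdorff
  space. Incomparability of non-parallel half-planes is reduced, after moving one of them to a ray,
  to nowhere vanishing functions, which no ray projection fixes or kills.\<close>

lemma L2_rel_refl [simp]: "L2_rel f f \<longleftrightarrow> square_integrable f"
  by (simp add: L2_rel_def)

lemma square_integrable_diff:
  "square_integrable f \<Longrightarrow> square_integrable g \<Longrightarrow> square_integrable (\<lambda>x. f x - g x)"
  using square_integrable_add[of f "\<lambda>x. (-1) * g x"] square_integrable_cmult[of g "-1"] by simp

lemma square_integrable_measurable [measurable_dest]:
  "square_integrable f \<Longrightarrow> f \<in> borel_measurable lborel"
  by (simp add: square_integrable_def)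

lemma L2_of_add:
  "square_integrable f \<Longrightarrow> square_integrable g \<Longrightarrow> L2_of f + L2_of g = L2_of (\<lambda>x. f x + g x)"
  by (simp add: plus_L2.abs_eq)

lemma L2_of_diff:
  "square_integrable f \<Longrightarrow> square_integrable g \<Longrightarrow> L2_of f - L2_of g = L2_of (\<lambda>x. f x - g x)"
  using square_integrable_cmult[of g "-1"]
  by (simp add: minus_L2_def uminus_L2.abs_eq L2_of_add)

lemma scaleC_L2_of: "square_integrable f \<Longrightarrow> scaleC c (L2_of f) = L2_of (\<lambda>x. c * f x)"
  by (simp add: scaleC.abs_eq)

lemma cinner_L2_of:
  "square_integrable f \<Longrightarrow> square_integrable g \<Longrightarrow>
    cinner (L2_of f) (L2_of g) = (\<integral>x. f x * cnj (g x) \<partial>lborel)"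
  by (simp add: cinner.abs_eq)

lemma L2_of_eqI:
  assumes "square_integrable f" "g \<in> borel_measurable lborel" "AE x in lborel. f x = g x"
  shows "L2_of f = L2_of g" "square_integrable g"
proof -
  show "square_integrable g"
    unfolding square_integrable_def
  proof
    have "integrable lborel (\<lambda>x. (norm (f x))\<^sup>2)"
      using assms(1) by (simp add: square_integrable_def)
    moreover have "AE x in lborel. (norm (g x))\<^sup>2 = (norm (f x))\<^sup>2"
      using assms(3) by auto
    ultimately show "integrable lborel (\<lambda>x. (norm (g x))\<^sup>2)"
      using assms by (subst integrable_cong_AE[where g = "\<lambda>x. (norm (f x))\<^sup>2"]) auto
  qed (rule assms)
  then show "L2_of f = L2_of g" using assms by (simp add: L2_of_eq_iff)
qed

lemma cinner_self_norm: "cinner f f = complex_of_real ((norm f)\<^sup>2)"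
proof -
  obtain u where "square_integrable u" "f = L2_of u" by (rule L2_cases)
  then show ?thesis by (simp add: power2_norm_eq_inner inner_L2_def cinner_self)
qed

lemma norm_L2_of:
  assumes "square_integrable f"
  shows "(norm (L2_of f))\<^sup>2 = (\<integral>x. (norm (f x))\<^sup>2 \<partial>lborel)"
  using cinner_self[OF assms] unfolding cinner_self_norm of_real_eq_iff .

lemma scaleC_zero_right [simp]: "scaleC c 0 = 0"
  by (rule linear_simps(3)[OF bounded_linear_scaleC])

lemma scaleC_scaleC [simp]: "scaleC c (scaleC d f) = scaleC (c * d) f"
  by (rule L2_cases[of f]) (simp add: scaleC_L2_of square_integrable_cmult mult.assoc)

lemma scaleC_one [simp]: "scaleC 1 f = f"
  by (rule L2_cases[of f]) (simp add: scaleC_L2_of)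

lemma cinner_zero_left [simp]: "cinner 0 g = 0"
  using cinner_add_left[of 0 0 g] by simp

lemma cinner_zero_right [simp]: "cinner g 0 = 0"
  using cinner_cnj[of g 0] by simp

lemma cinner_add_right: "cinner f (g + h) = cinner f g + cinner f h"
  by (subst (1 2 3) cinner_cnj) (simp add: cinner_add_left)

lemma cinner_scaleC_right: "cinner f (scaleC c g) = cnj c * cinner f g"
  by (subst (1 2) cinner_cnj) (simp add: cinner_scaleC_left)

lemma cinner_diff_left: "cinner (f - g) h = cinner f h - cinner g h"
  using cinner_add_left[of "f - g" g h] by simp

lemma cinner_diff_right: "cinner f (g - h) = cinner f g - cinner f h"
  using cinner_add_right[of f "g - h" h] by simp

lemma norm_scaleC [simp]: "norm (scaleC c f) = norm c * norm f"
proof -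
  have "complex_of_real ((norm (scaleC c f))\<^sup>2) = complex_of_real ((norm c * norm f)\<^sup>2)"
    unfolding cinner_self_norm[symmetric] cinner_scaleC_left cinner_scaleC_right
    by (simp add: cinner_self_norm power_mult_distrib complex_norm_square mult.commute[of "cnj c"]
        del: of_real_power)
  then have "(norm (scaleC c f))\<^sup>2 = (norm c * norm f)\<^sup>2" unfolding of_real_eq_iff .
  then show ?thesis by (simp add: power2_eq_iff_nonneg)
qed

lemma scaleC_zero_left [simp]: "scaleC 0 f = 0"
  by (simp flip: norm_eq_zero)

lemma norm_cinner_le: "norm (cinner f g) \<le> norm f * norm g"
proof -
  let ?c = "cinner f g"
  \<comment> \<open>Rotating f by the phase of the inner product makes it real and nonnegative, so
    the real Cauchy-Schwarz inequality applies.\<close>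
  have "complex_of_real (norm ?c) = cnj (sgn ?c) * ?c"
    by (cases "?c = 0") (auto simp: sgn_eq complex_norm_square[symmetric] power2_eq_square
        mult.commute)
  then have "norm ?c = Re (cinner (scaleC (cnj (sgn ?c)) f) g)"
    unfolding cinner_scaleC_left by (metis Re_complex_of_real)
  also have "\<dots> = inner (scaleC (cnj (sgn ?c)) f) g" by (simp add: inner_L2_def)
  also have "\<dots> \<le> norm (scaleC (cnj (sgn ?c)) f) * norm g" by (rule norm_cauchy_schwarz)
  also have "\<dots> \<le> 1 * norm f * norm g"
    by (intro mult_right_mono) (auto simp: norm_sgn)
  finally show ?thesis by simp
qed

lemma bounded_bilinear_cinner: "bounded_bilinear cinner"
proof
  show "\<exists>K. \<forall>a b. norm (cinner a b) \<le> norm a * norm b * K"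
    using norm_cinner_le by (intro exI[of _ 1]) simp
qed (auto simp: cinner_add_left cinner_add_right scaleR_L2_def cinner_scaleC_left
    cinner_scaleC_right scaleR_conv_of_real)

lemmas tendsto_cinner = bounded_bilinear.tendsto[OF bounded_bilinear_cinner]

lemma cinner_eqI: "(\<And>g. cinner f g = cinner f' g) \<Longrightarrow> f = f'"
proof -
  assume "\<And>g. cinner f g = cinner f' g"
  then have "cinner (f - f') (f - f') = 0" by (simp add: cinner_diff_left)
  then show ?thesis by (simp add: cinner_self_norm)
qed

lemma cinner_eqI_right: "(\<And>f. cinner f g = cinner f g') \<Longrightarrow> g = g'"
  by (rule cinner_eqI) (metis cinner_cnj)

lemma square_integrable_mult_integrable:
  assumes "square_integrable f" "square_integrable g"
  shows "integrable lborel (\<lambda>x. f x * g x)"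
proof -
  have "square_integrable (\<lambda>x. cnj (g x))" using assms(2) by (auto simp: square_integrable_def)
  from integrable_cinner[OF assms(1) this] show ?thesis by simp
qed

text \<open>Dominated convergence for |f n - g|^2, with majorant 4 w^2. Strong convergence of
  multipliers and the boundary limit of Hardy functions are both obtained in this form.\<close>

lemma L2_tendsto_dominated:
  fixes f :: "nat \<Rightarrow> real \<Rightarrow> complex" and w :: "real \<Rightarrow> real"
  assumes f: "\<And>n. f n \<in> borel_measurable lborel" and g: "g \<in> borel_measurable lborel"
    and w: "integrable lborel (\<lambda>x. (w x)\<^sup>2)"
    and bnd: "\<And>n. AE x in lborel. norm (f n x) \<le> w x"
    and lim: "AE x in lborel. (\<lambda>n. f n x) \<longlonglongrightarrow> g x"
  shows "\<And>n. square_integrable (f n)" "square_integrable g" "(\<lambda>n. L2_of (f n)) \<longlonglongrightarrow> L2_of g"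
proof -
  show sf: "square_integrable (f n)" for n
    unfolding square_integrable_def
  proof (intro conjI f Bochner_Integration.integrable_bound[OF w])
    show "AE x in lborel. norm ((norm (f n x))\<^sup>2) \<le> norm ((w x)\<^sup>2)"
      using bnd[of n] by eventually_elim (auto intro: power_mono)
  qed (use f in simp)
  have bg: "AE x in lborel. norm (g x) \<le> w x"
  proof -
    have "AE x in lborel. \<forall>n. norm (f n x) \<le> w x" using bnd by (simp add: AE_all_countable)
    then show ?thesis using lim
      by eventually_elim (rule LIMSEQ_le_const2[OF tendsto_norm], auto)
  qed
  show sg: "square_integrable g"
    unfolding square_integrable_def
  proof (intro conjI g Bochner_Integration.integrable_bound[OF w])
    show "AE x in lborel. norm ((norm (g x))\<^sup>2) \<le> norm ((w x)\<^sup>2)"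
      using bg by eventually_elim (auto intro: power_mono)
  qed (use g in simp)
  have "(\<lambda>n. \<integral>x. (norm (f n x - g x))\<^sup>2 \<partial>lborel) \<longlonglongrightarrow> (\<integral>x. 0 \<partial>(lborel::real measure))"
  proof (rule integral_dominated_convergence[where w = "\<lambda>x. 4 * (w x)\<^sup>2"])
    show "integrable lborel (\<lambda>x. 4 * (w x)\<^sup>2)" using w by simp
    show "AE x in lborel. (\<lambda>n. (norm (f n x - g x))\<^sup>2) \<longlonglongrightarrow> 0"
      using lim by eventually_elim (auto intro!: tendsto_eq_intros)
    fix n
    show "AE x in lborel. norm ((norm (f n x - g x))\<^sup>2) \<le> 4 * (w x)\<^sup>2"
      using bnd[of n] bg
    proof eventually_elim
      fix x assume "norm (f n x) \<le> w x" "norm (g x) \<le> w x"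
      then have "norm (f n x - g x) \<le> 2 * w x"
        using norm_triangle_ineq4[of "f n x" "g x"] by linarith
      then have "(norm (f n x - g x))\<^sup>2 \<le> (2 * w x)\<^sup>2" by (intro power_mono) auto
      then show "norm ((norm (f n x - g x))\<^sup>2) \<le> 4 * (w x)\<^sup>2" by (simp add: power_mult_distrib)
    qed
  qed (use f g in measurable)
  then have "(\<lambda>n. (norm (L2_of (f n) - L2_of g))\<^sup>2) \<longlonglongrightarrow> 0"
    using sf sg by (simp add: L2_of_diff norm_L2_of square_integrable_diff)
  then have "(\<lambda>n. sqrt ((norm (L2_of (f n) - L2_of g))\<^sup>2)) \<longlonglongrightarrow> sqrt 0"
    by (rule tendsto_real_sqrt)
  then show "(\<lambda>n. L2_of (f n)) \<longlonglongrightarrow> L2_of g"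
    by (simp add: LIM_zero_iff tendsto_norm_zero_iff)
qed

text \<open>Along a subsequence with \<open>\<parallel>f (n + 1) - f n\<parallel> < 2 ^ (- n)\<close> the series
  \<open>\<Sum>n. 2 ^ n * \<bar>f (n + 1) - f n\<bar>\<^sup>2\<close> is integrable, which yields pointwise convergence almost
  everywhere; Fatou's lemma identifies the limit.\<close>

instance L2 :: complete_space
proof
  fix X :: "nat \<Rightarrow> L2" assume X: "Cauchy X"
  have "\<forall>n. \<exists>N. \<forall>i\<ge>N. \<forall>j\<ge>N. norm (X i - X j) < (1/2)^n"
    using X by (auto simp: Cauchy_def dist_norm)
  then obtain N where N: "\<And>n i j. i \<ge> N n \<Longrightarrow> j \<ge> N n \<Longrightarrow> norm (X i - X j) < (1/2)^n"
    by metis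
  \<comment> \<open>The sum puts r m above N n for every n \<le> m, and the added n makes r strictly
    increasing.\<close>
  define r where "r n = (\<Sum>i\<le>n. N i) + n" for n
  have r: "strict_mono r" by (auto simp: r_def strict_mono_Suc_iff)
  have rN: "r m \<ge> N n" if "m \<ge> n" for m n
  proof -
    have "N n \<le> (\<Sum>i\<le>m. N i)" using that by (intro member_le_sum) auto
    then show ?thesis by (simp add: r_def)
  qed
  have "\<forall>n. \<exists>f. square_integrable f \<and> X (r n) = L2_of f" using L2_cases by metis
  then obtain f where f: "\<And>n. square_integrable (f n)" "\<And>n. X (r n) = L2_of (f n)" by metis
  have fm [measurable]: "\<And>n. f n \<in> borel_measurable lborel"
    using f by (simp add: square_integrable_def)
  have bnd: "(\<integral>\<^sup>+x. ennreal ((norm (f m x - f n x))\<^sup>2) \<partial>lborel) \<le> ennreal (((1/2)^n)\<^sup>2)"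
    if "m \<ge> n" for m n
  proof -
    have sq: "square_integrable (\<lambda>x. f m x - f n x)" using f by (simp add: square_integrable_diff)
    have "(\<integral>\<^sup>+x. ennreal ((norm (f m x - f n x))\<^sup>2) \<partial>lborel)
        = ennreal (\<integral>x. (norm (f m x - f n x))\<^sup>2 \<partial>lborel)"
      using sq by (intro nn_integral_eq_integral) (auto simp: square_integrable_def)
    also have "\<dots> = ennreal ((norm (X (r m) - X (r n)))\<^sup>2)"
      using sq f by (simp add: L2_of_diff norm_L2_of)
    also have "\<dots> \<le> ennreal (((1/2)^n)\<^sup>2)"
      using N[of n "r m" "r n"] rN that by (intro ennreal_leI power_mono) (auto intro: less_imp_le)
    finally show ?thesis .
  qed
  let ?d = "\<lambda>n x. f (Suc n) x - f n x"
  have "(\<integral>\<^sup>+x. (\<Sum>n. ennreal (2^n * (norm (?d n x))\<^sup>2)) \<partial>lborel)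
      = (\<Sum>n. \<integral>\<^sup>+x. ennreal (2^n * (norm (?d n x))\<^sup>2) \<partial>lborel)"
    by (intro nn_integral_suminf) measurable
  also have "\<dots> \<le> (\<Sum>n. ennreal ((1/2)^n))"
  proof (intro suminf_le)
    fix n
    have "(\<integral>\<^sup>+x. ennreal (2^n * (norm (?d n x))\<^sup>2) \<partial>lborel)
        = ennreal (2^n) * (\<integral>\<^sup>+x. ennreal ((norm (?d n x))\<^sup>2) \<partial>lborel)"
      by (simp add: ennreal_mult nn_integral_cmult)
    also have "\<dots> \<le> ennreal (2^n) * ennreal (((1/2)^n)\<^sup>2)"
      by (intro mult_left_mono bnd) auto
    also have "\<dots> = ennreal ((1/2)^n)"
      by (simp add: ennreal_mult[symmetric] power2_eq_square power_mult_distrib[symmetric] flip: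
        mult.assoc)
    finally show "(\<integral>\<^sup>+x. ennreal (2^n * (norm (?d n x))\<^sup>2) \<partial>lborel) \<le> ennreal ((1/2)^n)" .
  qed auto
  also have "\<dots> < \<infinity>"
    by (subst suminf_ennreal2) (auto intro!: summable_geometric)
  finally have "AE x in lborel. (\<Sum>n. ennreal (2^n * (norm (?d n x))\<^sup>2)) \<noteq> \<infinity>"
    by (intro nn_integral_PInf_AE) auto
  then have conv: "AE x in lborel. convergent (\<lambda>n. f n x)"
  proof eventually_elim
    fix x assume "(\<Sum>n. ennreal (2^n * (norm (?d n x))\<^sup>2)) \<noteq> \<infinity>"
    then have "summable (\<lambda>n. 2^n * (norm (?d n x))\<^sup>2)"
      by (intro summable_suminf_not_top) auto
    then have s: "summable (\<lambda>n. 2^n * (norm (?d n x))\<^sup>2 + (1/2)^n)"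
      by (intro summable_add summable_geometric) auto
    \<comment> \<open>With the weight 2^n, expanding 2^n (|d| - 2^(-n))^2 bounds |d| by the weighted
      square plus a summable geometric term.\<close>
    have "norm (?d n x) \<le> 2^n * (norm (?d n x))\<^sup>2 + (1/2)^n" for n
    proof -
      have "0 \<le> 2^n * (norm (?d n x) - (1/2)^n)\<^sup>2" by simp
      also have "\<dots> = 2^n * (norm (?d n x))\<^sup>2 - 2 * norm (?d n x) + (1/2)^n"
        by (simp add: power2_eq_square field_simps)
      finally show ?thesis using norm_ge_zero[of "?d n x"] by linarith
    qed
    then have "summable (\<lambda>n. ?d n x)" by (intro summable_comparison_test'[OF s]) auto
    then have "convergent (\<lambda>n. \<Sum>i<n. ?d i x)" by (simp add: summable_iff_convergent)
    then have "convergent (\<lambda>n. f n x - f 0 x)" by (subst (asm) sum_lessThan_telescope)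
    then show "convergent (\<lambda>n. f n x)" by (simp add: convergent_diff_const_right_iff)
  qed
  define F where "F x = lim (\<lambda>n. f n x)" for x
  have Fm [measurable]: "F \<in> borel_measurable lborel" unfolding F_def by measurable
  have lim: "AE x in lborel. (\<lambda>n. f n x) \<longlonglongrightarrow> F x"
    using conv by eventually_elim (simp add: F_def convergent_LIMSEQ_iff)
  have Fbnd: "(\<integral>\<^sup>+x. ennreal ((norm (F x - f n x))\<^sup>2) \<partial>lborel) \<le> ennreal (((1/2)^n)\<^sup>2)" for n
  proof -
    have "(\<integral>\<^sup>+x. ennreal ((norm (F x - f n x))\<^sup>2) \<partial>lborel)
        = (\<integral>\<^sup>+x. liminf (\<lambda>m. ennreal ((norm (f m x - f n x))\<^sup>2)) \<partial>lborel)"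
    proof (intro nn_integral_cong_AE)
      show "AE x in lborel. ennreal ((norm (F x - f n x))\<^sup>2)
          = liminf (\<lambda>m. ennreal ((norm (f m x - f n x))\<^sup>2))"
        using lim
        by eventually_elim (rule lim_imp_Liminf[symmetric], auto intro!: tendsto_intros)
    qed
    also have "\<dots> \<le> liminf (\<lambda>m. \<integral>\<^sup>+x. ennreal ((norm (f m x - f n x))\<^sup>2) \<partial>lborel)"
      by (intro nn_integral_liminf) measurable
    also have "\<dots> \<le> ennreal (((1/2)^n)\<^sup>2)"
      by (intro Liminf_le) (auto intro!: eventually_sequentiallyI[of n] bnd)
    finally show ?thesis .
  qed
  have sq: "square_integrable (\<lambda>x. F x - f n x)" for n
    unfolding square_integrable_def using Fbnd[of n]
    by (auto intro!: integrableI_nonneg elim: le_less_trans)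
  have sF: "square_integrable F"
    using square_integrable_add[OF sq f(1), of 0 0] by simp
  have le: "norm (X (r n) - L2_of F) \<le> (1/2)^n" for n
  proof -
    have "ennreal ((norm (L2_of F - X (r n)))\<^sup>2) = ennreal (\<integral>x. (norm (F x - f n x))\<^sup>2 \<partial>lborel)"
      using sq[of n] f sF by (simp add: L2_of_diff norm_L2_of)
    also have "\<dots> = (\<integral>\<^sup>+x. ennreal ((norm (F x - f n x))\<^sup>2) \<partial>lborel)"
      using sq[of n] by (intro nn_integral_eq_integral[symmetric])
        (auto simp: square_integrable_def)
    also have "\<dots> \<le> ennreal (((1/2)^n)\<^sup>2)" by (rule Fbnd)
    finally have "(norm (L2_of F - X (r n)))\<^sup>2 \<le> ((1/2)^n)\<^sup>2"
      by (subst (asm) ennreal_le_iff) auto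
    then have "norm (L2_of F - X (r n)) \<le> (1/2)^n" by (rule power2_le_imp_le) simp
    then show ?thesis by (simp add: norm_minus_commute)
  qed
  have "(\<lambda>n. X (r n) - L2_of F) \<longlonglongrightarrow> 0"
    by (rule Lim_null_comparison[of _ "\<lambda>n. (1/2)^n"]) (use le in \<open>auto intro: LIMSEQ_realpow_zero\<close>)
  then have "(X \<circ> r) \<longlonglongrightarrow> L2_of F" by (simp add: LIM_zero_iff o_def)
  then have "X \<longlonglongrightarrow> L2_of F" using X r Cauchy_converges_subseq by blast
  then show "convergent X" by (auto simp: convergent_def)
qed

text \<open>The projection theorem of Hilbert space: a minimising sequence is Cauchy by the
  parallelogram law, and minimality along every line through the limit forces orthogonality. Only
  the real inner product occurs; complex orthogonality is recovered where needed by testing also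
  with multiples by the imaginary unit.\<close>

lemma closest_point_orthogonal:
  fixes S :: "'a :: {real_inner, complete_space} set"
  assumes S: "subspace S" "closed S"
  shows "\<exists>y\<in>S. \<forall>s\<in>S. inner (x - y) s = 0"
proof -
  define d where "d = infdist x S"
  have S0: "S \<noteq> {}" using S(1) subspace_0 by blast
  have dle: "d \<le> norm (x - s)" if "s \<in> S" for s
    using infdist_le[OF that, of x] by (simp add: d_def dist_norm)
  have d0: "0 \<le> d" by (simp add: d_def infdist_nonneg)
  have "\<exists>s\<in>S. norm (x - s) < d + 1 / Suc n" for n
  proof (rule ccontr)
    assume "\<not> ?thesis"
    then have "d + 1 / Suc n \<le> infdist x S"
      unfolding infdist_notempty[OF S0]
      by (intro cINF_greatest) (auto simp: dist_norm S0 not_less)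
    then show False by (simp add: d_def)
  qed
  then obtain t where t: "\<And>n. t n \<in> S" "\<And>n. norm (x - t n) < d + 1 / Suc n" by metis
  \<comment> \<open>The midpoint of t n and t m lies in S, hence at distance at least d from x; the
    parallelogram law turns this into a bound for t n - t m.\<close>
  have par: "(norm (t n - t m))\<^sup>2 \<le> 2 * (norm (x - t n))\<^sup>2 + 2 * (norm (x - t m))\<^sup>2 - 4 * d\<^sup>2"
    for m n
  proof -
    have "(1/2) *\<^sub>R (t n + t m) \<in> S"
      using S(1) t by (intro subspace_scale subspace_add) auto
    from dle[OF this] have "d\<^sup>2 \<le> (norm (x - (1/2) *\<^sub>R (t n + t m)))\<^sup>2"
      using d0 by (intro power_mono) auto
    moreover have "(norm (t n - t m))\<^sup>2 + 4 * (norm (x - (1/2) *\<^sub>R (t n + t m)))\<^sup>2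
        = 2 * (norm (x - t n))\<^sup>2 + 2 * (norm (x - t m))\<^sup>2"
      by (simp add: power2_norm_eq_inner inner_diff_left inner_diff_right inner_add_left
          inner_add_right inner_commute field_simps)
    ultimately show ?thesis by linarith
  qed
  have lim: "(\<lambda>n. 4 * (d + 1 / Suc n)\<^sup>2 - 4 * d\<^sup>2) \<longlonglongrightarrow> 4 * (d + 0)\<^sup>2 - 4 * d\<^sup>2"
    by (intro tendsto_intros LIMSEQ_Suc lim_1_over_n)
  have "Cauchy t"
  proof (rule CauchyI')
    fix e :: real assume e: "0 < e"
    from lim have "eventually (\<lambda>n. 4 * (d + 1 / Suc n)\<^sup>2 - 4 * d\<^sup>2 < e\<^sup>2) sequentially"
      using e by (intro order_tendstoD) auto
    then obtain M where M: "\<And>n. n \<ge> M \<Longrightarrow> 4 * (d + 1 / Suc n)\<^sup>2 - 4 * d\<^sup>2 < e\<^sup>2"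
      by (auto simp: eventually_sequentially)
    have "norm (t m - t n) < e" if "m \<ge> M" "n > m" for m n
    proof -
      have a: "(norm (x - t k))\<^sup>2 \<le> (d + 1 / Suc M)\<^sup>2" if "k \<ge> M" for k
      proof -
        have "1 / real (Suc k) \<le> 1 / real (Suc M)" using that by (intro divide_left_mono) auto
        then have "norm (x - t k) \<le> d + 1 / Suc M" using t(2)[of k] by linarith
        then show ?thesis by (intro power_mono) auto
      qed
      have "(norm (t m - t n))\<^sup>2 < e\<^sup>2"
        using par[of m n] a[of m] a[of n] M[of M] that by simp
      then show ?thesis using e by (auto intro: power2_less_imp_less)
    qed
    then show "\<exists>M. \<forall>m\<ge>M. \<forall>n>m. dist (t m) (t n) < e" by (auto simp: dist_norm)
  qed
  then obtain y where y: "t \<longlonglongrightarrow> y" using Cauchy_convergent convergent_def by blast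
  have yS: "y \<in> S" using closed_sequentially[OF S(2) _ y] t by blast
  have ny: "norm (x - y) \<le> d"
  proof (rule LIMSEQ_le)
    show "(\<lambda>n. norm (x - t n)) \<longlonglongrightarrow> norm (x - y)" by (intro tendsto_intros y)
    show "(\<lambda>n. d + 1 / Suc n) \<longlonglongrightarrow> d"
      using tendsto_add[OF tendsto_const LIMSEQ_Suc[OF lim_1_over_n], of d] by simp
    show "\<exists>N. \<forall>n\<ge>N. norm (x - t n) \<le> d + 1 / Suc n" using t by (auto intro: less_imp_le)
  qed
  have "inner (x - y) s = 0" if s: "s \<in> S" for s
  proof (cases "s = 0")
    case False
    \<comment> \<open>The minimiser of |x - y - c s|^2 in c: moving y by c s would lower the squared
      distance by (inner (x - y) s)^2 / |s|^2.\<close>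
    define c where "c = inner (x - y) s / (norm s)\<^sup>2"
    have "y + c *\<^sub>R s \<in> S" using S(1) yS s by (intro subspace_add subspace_scale)
    from dle[OF this] ny have "(norm (x - y))\<^sup>2 \<le> (norm (x - (y + c *\<^sub>R s)))\<^sup>2"
      by (intro power_mono) auto
    also have "\<dots> = (norm (x - y))\<^sup>2 - 2 * c * inner (x - y) s + c\<^sup>2 * (norm s)\<^sup>2"
      unfolding power2_norm_eq_inner
      by (simp add: inner_diff_left inner_diff_right inner_add_left inner_add_right inner_commute
          power2_eq_square[of c] algebra_simps)
    also have "\<dots> = (norm (x - y))\<^sup>2 - (inner (x - y) s)\<^sup>2 / (norm s)\<^sup>2"
      using False by (simp add: c_def power2_eq_square field_simps)
    finally have "(inner (x - y) s)\<^sup>2 / (norm s)\<^sup>2 \<le> 0" by simp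
    then have "(inner (x - y) s)\<^sup>2 \<le> 0"
      using False by (simp add: divide_le_0_iff not_le)
    then show ?thesis by simp
  qed simp
  then show ?thesis using yS by blast
qed

lemma subspace_closure:
  fixes S :: "'a :: real_normed_vector set"
  assumes "subspace S"
  shows "subspace (closure S)"
proof (rule subspaceI)
  show "0 \<in> closure S" using assms closure_subset subspace_0 by blast
next
  fix x y assume "x \<in> closure S" "y \<in> closure S"
  then obtain u v where "\<forall>n. u n \<in> S" "u \<longlonglongrightarrow> x" "\<forall>n. v n \<in> S" "v \<longlonglongrightarrow> y"
    unfolding closure_sequential by blast
  then show "x + y \<in> closure S"
    unfolding closure_sequential using assms
    by (intro exI[of _ "\<lambda>n. u n + v n"] conjI tendsto_add allI subspace_add) auto
next
  fix c x assume "x \<in> closure S"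
  then obtain u where "\<forall>n. u n \<in> S" "u \<longlonglongrightarrow> x"
    unfolding closure_sequential by blast
  then show "c *\<^sub>R x \<in> closure S"
    unfolding closure_sequential using assms
    by (intro exI[of _ "\<lambda>n. c *\<^sub>R u n"] conjI tendsto_scaleR tendsto_const allI subspace_scale) auto
qed

lemma dense_if_orthogonal_trivial:
  fixes S :: "'a :: {real_inner, complete_space} set"
  assumes S: "subspace S" and 0: "\<And>f. (\<And>s. s \<in> S \<Longrightarrow> inner f s = 0) \<Longrightarrow> f = 0"
  shows "closure S = UNIV"
proof -
  have "x \<in> closure S" for x
  proof -
    obtain y where y: "y \<in> closure S" "\<And>s. s \<in> closure S \<Longrightarrow> inner (x - y) s = 0"
      using closest_point_orthogonal[OF subspace_closure[OF S] closed_closure] by metis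
    have "x - y = 0" using y closure_subset by (intro 0) blast
    then show ?thesis using y by simp
  qed
  then show ?thesis by blast
qed

section \<open>Uniqueness for the Fourier transform of integrable functions\<close>

text \<open>Divided by their common mass c, which is the transform at t = 0, both functions become
  probability densities with the same characteristic function, and Levy's uniqueness theorem
  applies. Mass 0 is treated apart.\<close>

lemma fourier_uniqueness_nonneg:
  fixes p q :: "real \<Rightarrow> real"
  assumes p: "integrable lborel p" "\<And>x. 0 \<le> p x" and q: "integrable lborel q" "\<And>x. 0 \<le> q x"
    and eq: "\<And>t. (\<integral>x. p x *\<^sub>R iexp (t * x) \<partial>lborel) = (\<integral>x. q x *\<^sub>R iexp (t * x) \<partial>lborel)"
  shows "AE x in lborel. p x = q x"
proof -
  define c where "c = (\<integral>x. p x \<partial>lborel)"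
  have cq: "c = (\<integral>x. q x \<partial>lborel)"
    using eq[of 0] by (simp add: c_def scaleR_conv_of_real)
  have [measurable]: "p \<in> borel_measurable lborel" "q \<in> borel_measurable lborel"
    using p q by auto
  show ?thesis
  proof (cases "c = 0")
    case True
    then have "AE x in lborel. p x = 0" "AE x in lborel. q x = 0"
      using integral_nonneg_eq_0_iff_AE[of lborel p] integral_nonneg_eq_0_iff_AE[of lborel q] p q cq
      by (auto simp: c_def)
    then show ?thesis by eventually_elim simp
  next
    case False
    then have c: "c > 0"
      using p(2) Bochner_Integration.integral_nonneg[of lborel p] unfolding c_def by fastforce
    define M where "M r = density lborel (\<lambda>x. ennreal (r x / c))" for r :: "real \<Rightarrow> real"
    have rd: "real_distribution (M r)"
      if r: "integrable lborel r" "\<And>x. 0 \<le> r x" "(\<integral>x. r x \<partial>lborel) = c" for r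
    proof -
      have [measurable]: "r \<in> borel_measurable lborel" using r by auto
      have "emeasure (M r) (space (M r)) = (\<integral>\<^sup>+x. ennreal (r x / c) \<partial>lborel)"
        unfolding M_def by (subst emeasure_density) (auto intro!: nn_integral_cong)
      also have "\<dots> = ennreal (\<integral>x. r x / c \<partial>lborel)"
        using r c by (intro nn_integral_eq_integral) auto
      also have "\<dots> = 1" using r c by simp
      finally have "prob_space (M r)" by (rule prob_spaceI)
      then show ?thesis
        unfolding real_distribution_def real_distribution_axioms_def by (simp add: M_def)
    qed
    have ch: "char (M r) t = (\<integral>x. r x *\<^sub>R iexp (t * x) \<partial>lborel) /\<^sub>R c"
      if r: "integrable lborel r" "\<And>x. 0 \<le> r x" for r t
    proof -
      have [measurable]: "r \<in> borel_measurable lborel" using r by auto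
      have "char (M r) t = (\<integral>x. (r x / c) *\<^sub>R iexp (t * x) \<partial>lborel)"
        unfolding char_def M_def using r c by (subst integral_density) auto
      also have "\<dots> = (\<integral>x. (1 / c) *\<^sub>R (r x *\<^sub>R iexp (t * x)) \<partial>lborel)"
        by (simp add: mult.commute)
      also have "\<dots> = (1 / c) *\<^sub>R (\<integral>x. r x *\<^sub>R iexp (t * x) \<partial>lborel)"
        by (rule integral_scaleR_right)
      finally show ?thesis by (simp add: divide_inverse)
    qed
    have "M p = M q"
    proof (rule Levy_uniqueness)
      show "real_distribution (M p)" using p by (intro rd) (auto simp: c_def)
      show "real_distribution (M q)" using q by (intro rd) (auto simp: cq)
      show "char (M p) = char (M q)" by (intro ext) (simp only: ch[OF p] ch[OF q] eq)
    qed
    then have "AE x in lborel. ennreal (p x / c) = ennreal (q x / c)"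
      unfolding M_def by (intro
        sigma_finite_measure.density_unique[OF lborel.sigma_finite_measure_axioms]) auto
    then show ?thesis by eventually_elim (use p q c in auto)
  qed
qed

text \<open>Reduction to nonnegative functions. The transform of the conjugate at t is the conjugate
  of the transform at -t, so real and imaginary part have vanishing transforms as well; the positive
  and negative part of each then have equal transforms, hence agree, which forces both to
  vanish.\<close>

lemma fourier_uniqueness:
  fixes k :: "real \<Rightarrow> complex"
  assumes k: "integrable lborel k" and 0: "\<And>t. (\<integral>x. k x * iexp (t * x) \<partial>lborel) = 0"
  shows "AE x in lborel. k x = 0"
proof -
  have real: "AE x in lborel. r x = 0"
    if r: "integrable lborel r" and r0: "\<And>t. (\<integral>x. r x *\<^sub>R iexp (t * x) \<partial>lborel) = 0"
    for r :: "real \<Rightarrow> real"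
  proof -
    have b: "integrable lborel (\<lambda>x. g x *\<^sub>R iexp (t * x))" if "integrable lborel g" for g t
      by (rule Bochner_Integration.integrable_bound[OF that]) (use that in auto)
    have i: "integrable lborel (\<lambda>x. max (r x) 0)" "integrable lborel (\<lambda>x. max (- r x) 0)"
      using r by (auto intro!: Bochner_Integration.integrable_max)
    have "AE x in lborel. max (r x) 0 = max (- r x) 0"
    proof (rule fourier_uniqueness_nonneg)
      fix t
      have "(\<integral>x. max (r x) 0 *\<^sub>R iexp (t * x) \<partial>lborel)
          - (\<integral>x. max (- r x) 0 *\<^sub>R iexp (t * x) \<partial>lborel)
          = (\<integral>x. max (r x) 0 *\<^sub>R iexp (t * x) - max (- r x) 0 *\<^sub>R iexp (t * x) \<partial>lborel)"
        by (rule Bochner_Integration.integral_diff[symmetric]) (rule b i)+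
      also have "\<dots> = (\<integral>x. r x *\<^sub>R iexp (t * x) \<partial>lborel)"
        by (rule Bochner_Integration.integral_cong)
          (auto simp: max_def scaleR_left_diff_distrib[symmetric])
      finally show "(\<integral>x. max (r x) 0 *\<^sub>R iexp (t * x) \<partial>lborel)
          = (\<integral>x. max (- r x) 0 *\<^sub>R iexp (t * x) \<partial>lborel)"
        using r0 by simp
    qed (use i in auto)
    then show ?thesis by eventually_elim (auto simp: max_def split: if_splits)
  qed
  have cn: "(\<integral>x. cnj (k x) * iexp (t * x) \<partial>lborel) = 0" for t
  proof -
    have "(\<integral>x. cnj (k x) * iexp (t * x) \<partial>lborel) = (\<integral>x. cnj (k x * iexp ((-t) * x)) \<partial>lborel)"
      by (intro Bochner_Integration.integral_cong) (auto simp: exp_cnj)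
    also have "\<dots> = cnj (\<integral>x. k x * iexp ((-t) * x) \<partial>lborel)"
      by (rule Bochner_Integration.integral_cnj)
    finally show ?thesis using 0[of "-t"] by simp
  qed
  have b: "integrable lborel (\<lambda>x. g x * iexp (t * x))" if "integrable lborel g"
    for g :: "real \<Rightarrow> complex" and t
    by (rule Bochner_Integration.integrable_bound[OF that]) (use that in \<open>auto simp: norm_mult\<close>)
  have kc: "integrable lborel (\<lambda>x. cnj (k x))" using k by simp
  have "AE x in lborel. Re (k x) = 0"
  proof (rule real)
    fix t
    have "(\<integral>x. Re (k x) *\<^sub>R iexp (t * x) \<partial>lborel)
        = (\<integral>x. (1/2) * (k x * iexp (t * x) + cnj (k x) * iexp (t * x)) \<partial>lborel)"
      by (intro Bochner_Integration.integral_cong)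
        (auto simp: scaleR_conv_of_real complex_eq_iff distrib_right[symmetric])
    also have "\<dots> = (1/2)
        * ((\<integral>x. k x * iexp (t * x) \<partial>lborel) + (\<integral>x. cnj (k x) * iexp (t * x) \<partial>lborel))"
      unfolding integral_mult_right_zero
      by (subst Bochner_Integration.integral_add[OF b[OF k] b[OF kc]]) simp
    finally show "(\<integral>x. Re (k x) *\<^sub>R iexp (t * x) \<partial>lborel) = 0" using 0 cn by simp
  qed (use k in simp)
  moreover have "AE x in lborel. Im (k x) = 0"
  proof (rule real)
    fix t
    have "(\<integral>x. Im (k x) *\<^sub>R iexp (t * x) \<partial>lborel)
        = (\<integral>x. (1/(2*\<i>)) * (k x * iexp (t * x) - cnj (k x) * iexp (t * x)) \<partial>lborel)"
    proof (intro Bochner_Integration.integral_cong refl)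
      fix x
      have "of_real (Im (k x)) = (1/(2*\<i>)) * (k x - cnj (k x))" by (simp add: complex_eq_iff)
      then show "Im (k x) *\<^sub>R iexp (t * x)
          = (1/(2*\<i>)) * (k x * iexp (t * x) - cnj (k x) * iexp (t * x))"
        by (simp only: scaleR_conv_of_real left_diff_distrib mult.assoc)
    qed
    also have "\<dots> = (1/(2*\<i>))
        * ((\<integral>x. k x * iexp (t * x) \<partial>lborel) - (\<integral>x. cnj (k x) * iexp (t * x) \<partial>lborel))"
      unfolding integral_mult_right_zero
      by (subst Bochner_Integration.integral_diff[OF b[OF k] b[OF kc]]) simp
    finally show "(\<integral>x. Im (k x) *\<^sub>R iexp (t * x) \<partial>lborel) = 0" using 0 cn by simp
  qed (use k in simp)
  ultimately show ?thesis by eventually_elim (simp add: complex_eq_iff)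
qed

section \<open>Gaussians\<close>

text \<open>Complex b makes the family stable, up to scalars, under translations, modulations and
  the Fourier transform.\<close>

definition gauss :: "complex \<Rightarrow> real \<Rightarrow> complex" where
  "gauss b x = exp (- ((of_real x)\<^sup>2 / 2) + b * of_real x)"

lemma gauss_measurable [measurable]: "gauss b \<in> borel_measurable borel"
  unfolding gauss_def by (intro borel_measurable_continuous_onI continuous_intros) auto

text \<open>The characteristic function of the standard normal distribution covers imaginary b. For
  b = p + i q, completing the square reduces to it by a real translation by p, so no contour has to
  be shifted.\<close>

lemma has_integral_gauss:
  "has_bochner_integral lborel (gauss b) (of_real (sqrt (2 * pi)) * exp (b\<^sup>2 / 2))"
proof -
  obtain p q where b: "b = Complex p q" by (cases b)
  have I0: "integrable lborel (gauss (\<i> * of_real q))"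
  proof (rule Bochner_Integration.integrable_bound)
    show "integrable lborel (\<lambda>x. sqrt (2 * pi) * std_normal_density x)"
      by (intro integrable_mult_right integrable_normal_density) simp
    show "AE x in lborel. norm (gauss (\<i> * of_real q) x)
        \<le> norm (sqrt (2 * pi) * std_normal_density x)"
      by (auto simp: gauss_def std_normal_density_def power2_eq_square)
  qed simp
  have "char std_normal_distribution q = (\<integral>x. std_normal_density x *\<^sub>R iexp (q * x) \<partial>lborel)"
    unfolding char_def by (subst integral_density) auto
  also have "\<dots> = (\<integral>x. of_real (1 / sqrt (2 * pi)) * gauss (\<i> * of_real q) x \<partial>lborel)"
  proof (intro Bochner_Integration.integral_cong refl)
    fix x
    have "gauss (\<i> * of_real q) x = of_real (exp (- x\<^sup>2 / 2)) * iexp (q * x)"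
      unfolding gauss_def exp_of_real[symmetric] exp_add[symmetric] by (simp add: mult.assoc)
    then show "std_normal_density x *\<^sub>R iexp (q * x)
        = of_real (1 / sqrt (2 * pi)) * gauss (\<i> * of_real q) x"
      by (simp add: std_normal_density_def scaleR_conv_of_real)
  qed
  also have "\<dots> = of_real (1 / sqrt (2 * pi)) * (\<integral>x. gauss (\<i> * of_real q) x \<partial>lborel)"
    by (rule integral_mult_right_zero)
  finally have "(\<integral>x. gauss (\<i> * of_real q) x \<partial>lborel)
      = of_real (sqrt (2 * pi)) * of_real (exp (- (q\<^sup>2) / 2))"
    by (simp add: char_std_normal_distribution field_simps)
  with I0 have "has_bochner_integral lborel (gauss (\<i> * of_real q))
      (of_real (sqrt (2 * pi)) * of_real (exp (- (q\<^sup>2) / 2)))"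
    by (simp add: has_bochner_integral_iff)
  then have "has_bochner_integral lborel (\<lambda>x. gauss (\<i> * of_real q) (- p + 1 * x))
      ((of_real (sqrt (2 * pi)) * of_real (exp (- (q\<^sup>2) / 2))) /\<^sub>R \<bar>1\<bar>)"
    by (subst (asm) lborel_has_bochner_integral_real_affine_iff[where c = 1 and t = "-p"]) auto
  then have "has_bochner_integral lborel
      (\<lambda>x. exp (of_real (p\<^sup>2 / 2) + \<i> * of_real (p * q)) * gauss (\<i> * of_real q) (- p + 1 * x))
      (exp (of_real (p\<^sup>2 / 2) + \<i> * of_real (p * q)) *
        ((of_real (sqrt (2 * pi)) * of_real (exp (- (q\<^sup>2) / 2))) /\<^sub>R \<bar>1\<bar>))"
    by (intro has_bochner_integral_mult_right) auto
  moreover have "exp (of_real (p\<^sup>2 / 2) + \<i> * of_real (p * q)) * gauss (\<i> * of_real q) (- p + 1 * x)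
      = gauss b x" for x
    unfolding gauss_def b exp_add[symmetric]
    by (intro arg_cong[where f = exp]) (simp add: complex_eq_iff power2_eq_square field_simps)
  moreover have "exp (of_real (p\<^sup>2 / 2) + \<i> * of_real (p * q)) *
        ((of_real (sqrt (2 * pi)) * of_real (exp (- (q\<^sup>2) / 2))) /\<^sub>R \<bar>1\<bar>) = of_real
          (sqrt (2 * pi)) * exp (b\<^sup>2 / 2)"
  proof -
    have "exp (of_real (p\<^sup>2 / 2) + \<i> * of_real (p * q)) * exp (of_real (- (q\<^sup>2) / 2))
        = exp (b\<^sup>2 / 2)"
      unfolding b exp_add[symmetric]
      by (intro arg_cong[where f = exp]) (simp add: complex_eq_iff power2_eq_square field_simps)
    then show ?thesis by (simp add: exp_of_real[symmetric] mult_ac)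
  qed
  ultimately show ?thesis by (simp only:)
qed

lemma integrable_gauss: "integrable lborel (gauss b)"
  and integral_gauss: "(\<integral>x. gauss b x \<partial>lborel) = of_real (sqrt (2 * pi)) * exp (b\<^sup>2 / 2)"
  using has_integral_gauss[of b] by (auto simp: has_bochner_integral_iff)

text \<open>The product of two Gaussians is again one, compressed by the factor sqrt 2; rescaling
  leads back to \<open>has_integral_gauss\<close>.\<close>

lemma gauss_mult_cnj:
  "has_bochner_integral lborel (\<lambda>x. gauss b x * cnj (gauss c x)) (of_real (sqrt pi)
      * exp ((b + cnj c)\<^sup>2 / 4))"
proof -
  have "has_bochner_integral lborel (\<lambda>x. gauss ((b + cnj c) / of_real (sqrt 2)) (0 + sqrt 2 * x))
      ((of_real (sqrt (2 * pi)) * exp (((b + cnj c) / of_real (sqrt 2))\<^sup>2 / 2)) /\<^sub>R \<bar>sqrt 2\<bar>)"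
    using has_integral_gauss[of "(b + cnj c) / of_real (sqrt 2)"]
    by (subst (asm) lborel_has_bochner_integral_real_affine_iff[where c = "sqrt 2" and t = 0]) auto
  moreover have "gauss ((b + cnj c) / of_real (sqrt 2)) (0 + sqrt 2 * x)
      = gauss b x * cnj (gauss c x)" for x
    unfolding gauss_def exp_cnj exp_add[symmetric]
    by (intro arg_cong[where f = exp])
      (simp add: power_mult_distrib field_simps flip: of_real_power)
  moreover have "((of_real (sqrt (2 * pi))
      * exp (((b + cnj c) / of_real (sqrt 2))\<^sup>2 / 2)) /\<^sub>R \<bar>sqrt 2\<bar>)
      = of_real (sqrt pi) * exp ((b + cnj c)\<^sup>2 / 4)"
    by (simp add: power_divide scaleR_conv_of_real real_sqrt_mult flip: of_real_power)
  ultimately show ?thesis by simp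
qed

lemma square_integrable_gauss [simp]: "square_integrable (gauss b)"
proof -
  have "integrable lborel (\<lambda>x. norm (gauss b x * cnj (gauss b x)))"
    using gauss_mult_cnj[of b b] by (intro integrable_norm) (auto simp: has_bochner_integral_iff)
  then show ?thesis by (simp add: square_integrable_def norm_mult power2_eq_square)
qed

definition gaussian :: "complex \<Rightarrow> L2" where "gaussian b = L2_of (gauss b)"

lemma cinner_gaussian: "cinner (gaussian b) (gaussian c)
    = of_real (sqrt pi) * exp ((b + cnj c)\<^sup>2 / 4)"
  using gauss_mult_cnj[of b c] by (simp add: gaussian_def cinner_L2_of has_bochner_integral_iff)

text \<open>\<open>gauss\<close> at i t is \<open>gauss 0\<close> times a character, so the
  hypothesis says that the Fourier transform of w times \<open>gauss 0\<close> vanishes. The weight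
  admits functions w that are merely bounded or square integrable.\<close>

lemma gauss_uniqueness:
  fixes w :: "real \<Rightarrow> complex"
  assumes "integrable lborel (\<lambda>x. w x * gauss 0 x)"
    and "\<And>t. (\<integral>x. w x * gauss (\<i> * of_real t) x \<partial>lborel) = 0"
  shows "AE x in lborel. w x = 0"
proof -
  have "AE x in lborel. w x * gauss 0 x = 0"
  proof (rule fourier_uniqueness)
    fix t
    have "w x * gauss 0 x * iexp (t * x) = w x * gauss (\<i> * of_real t) x" for x
      unfolding gauss_def mult.assoc exp_add[symmetric] by simp
    then show "(\<integral>x. w x * gauss 0 x * iexp (t * x) \<partial>lborel) = 0" using assms(2) by (simp only:)
  qed (rule assms)
  then show ?thesis by eventually_elim (simp add: gauss_def)
qed

lemma gaussians_total:
  assumes "\<And>b. cinner f (gaussian b) = 0"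
  shows "f = 0"
proof -
  obtain u where u: "square_integrable u" "f = L2_of u" by (rule L2_cases)
  have "AE x in lborel. u x = 0"
  proof (rule gauss_uniqueness)
    show "integrable lborel (\<lambda>x. u x * gauss 0 x)"
      by (rule square_integrable_mult_integrable) (use u in auto)
    fix t
    have "cnj (gauss (- \<i> * of_real t) x) = gauss (\<i> * of_real t) x" for x
      by (simp add: gauss_def exp_cnj)
    then show "(\<integral>x. u x * gauss (\<i> * of_real t) x \<partial>lborel) = 0"
      using assms[of "- \<i> * of_real t"] u by (simp add: gaussian_def cinner_L2_of)
  qed
  then show ?thesis
    using u square_integrable_zero by (simp add: zero_L2_def L2_of_eq_iff)
qed

text \<open>\<open>span\<close> is the real span; as the generators include all complex multiples,
  the result is a complex subspace.\<close>

definition gauss_span :: "L2 set" where "gauss_span = span {scaleC a (gaussian b) | a b. True}"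

lemma gauss_span_dense: "closure gauss_span = UNIV"
proof (rule dense_if_orthogonal_trivial)
  fix f assume f: "\<And>s. s \<in> gauss_span \<Longrightarrow> inner f s = 0"
  have re: "Re (cnj a * cinner f (gaussian b)) = 0" for a b
    using f[of "scaleC a (gaussian b)"]
    by (auto simp: gauss_span_def inner_L2_def cinner_scaleC_right intro: span_base)
  have "cinner f (gaussian b) = 0" for b
    using re[of 1 b] re[of "\<i>" b] by (simp add: complex_eq_iff)
  then show "f = 0" by (rule gaussians_total)
qed (simp add: gauss_span_def)

text \<open>The operators are only known to be real-linear, hence the complex coefficient in the
  hypothesis. Most operator identities involving \<open>fourier\<close> are verified through this
  lemma.\<close>

lemma blinfun_eq_on_gaussians:
  fixes S T :: "L2 \<Rightarrow>\<^sub>L L2"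
  assumes "\<And>a b. S (scaleC a (gaussian b)) = T (scaleC a (gaussian b))"
  shows "S = T"
proof (rule blinfun_eqI)
  fix f
  have "subspace {u. S u = T u}"
    by (auto simp: subspace_def blinfun.add_right blinfun.scaleR_right blinfun.zero_right)
  then have "gauss_span \<subseteq> {u. S u = T u}"
    unfolding gauss_span_def using assms by (intro span_minimal) auto
  moreover have "closed {u. S u = T u}" by (intro closed_Collect_eq continuous_intros)
  ultimately have "closure gauss_span \<subseteq> {u. S u = T u}" by (rule closure_minimal)
  then show "S f = T f" by (auto simp: gauss_span_dense)
qed

section \<open>The Fourier--Plancherel transform\<close>

lemma cinner_scaleR_left: "cinner (r *\<^sub>R f) g = of_real r * cinner f g"
  by (simp add: scaleR_L2_def cinner_scaleC_left)

lemma cinner_scaleR_right: "cinner f (r *\<^sub>R g) = of_real r * cinner f g"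
  by (simp add: scaleR_L2_def cinner_scaleC_right)

text \<open>Gaussians paired with their Fourier transforms in closed form. Extending a relation
  rather than a function avoids showing first that a map prescribed on Gaussians is well defined on
  their span: isometry will make the closed relation single-valued.\<close>

definition gauss_pairs :: "(L2 \<times> L2) set" where
  "gauss_pairs = {(scaleC a (gaussian b), scaleC (a
      * exp (b\<^sup>2 / 2)) (gaussian (- \<i> * b))) | a b. True}"

definition fourier_graph :: "(L2 \<times> L2) set" where
  "fourier_graph = closure (span gauss_pairs)"

text \<open>On generators this is the identity b^2/2 + c^2/2 - (b - c)^2/4 = (b + c)^2/4 between
  exponents, with c the conjugate of b'. Additivity and continuity extend it to the closed span in
  one argument and then in the other.\<close>

lemma fourier_graph_cinner:
  assumes "p \<in> fourier_graph" "q \<in> fourier_graph"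
  shows "cinner (fst p) (fst q) = cinner (snd p) (snd q)"
proof -
  have cont: "continuous_on UNIV (\<lambda>p. cinner (f p) (g p))"
    if "continuous_on UNIV f" "continuous_on UNIV g" for f g :: "L2 \<times> L2 \<Rightarrow> L2"
    using bounded_bilinear.continuous_on[OF bounded_bilinear_cinner that] .
  have gen: "cinner (fst p) (fst q) = cinner (snd p) (snd q)"
    if pq: "p \<in> gauss_pairs" "q \<in> gauss_pairs" for p q
  proof -
    obtain a b a' b' where p:
      "p = (scaleC a (gaussian b), scaleC (a * exp (b\<^sup>2 / 2)) (gaussian (- \<i> * b)))"
      and q: "q = (scaleC a' (gaussian b'), scaleC (a' * exp (b'\<^sup>2 / 2)) (gaussian (- \<i> * b')))"
      using pq unfolding gauss_pairs_def by blast
    have "exp (b\<^sup>2 / 2) * (exp ((cnj b')\<^sup>2 / 2) * exp ((- \<i> * b + \<i> * cnj b')\<^sup>2 / 4))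
        = exp ((b + cnj b')\<^sup>2 / 4)"
      unfolding exp_add[symmetric]
      by (intro arg_cong[where f = exp]) (simp add: power2_eq_square field_simps)
    then show ?thesis
      unfolding p q
      by (simp add: cinner_scaleC_left cinner_scaleC_right cinner_gaussian exp_cnj mult_ac)
  qed
  have cl: "closure (span S) \<subseteq> T" if "S \<subseteq> T" "subspace T" "closed T" for S T :: "(L2 \<times> L2) set"
    using that by (meson closure_minimal span_minimal)
  have 1: "fourier_graph \<subseteq> {p. cinner (fst p) (fst q) = cinner (snd p) (snd q)}"
    if "q \<in> gauss_pairs" for q
    unfolding fourier_graph_def
  proof (rule cl)
    show "closed {p. cinner (fst p) (fst q) = cinner (snd p) (snd q)}"
      by (intro closed_Collect_eq cont continuous_intros)
  qed (use gen that in \<open>auto simp: subspace_def cinner_add_left cinner_scaleR_left\<close>)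
  have "fourier_graph \<subseteq> {q. cinner (fst p) (fst q) = cinner (snd p) (snd q)}"
    if "p \<in> fourier_graph" for p
    unfolding fourier_graph_def
  proof (rule cl)
    show "closed {q. cinner (fst p) (fst q) = cinner (snd p) (snd q)}"
      by (intro closed_Collect_eq cont continuous_intros)
  qed (use 1 that in \<open>auto simp: subspace_def cinner_add_right cinner_scaleR_right\<close>)
  then show ?thesis using assms by blast
qed

lemma subspace_fourier_graph: "subspace fourier_graph"
  unfolding fourier_graph_def by (intro subspace_closure subspace_span)

lemma fourier_graph_norm: "p \<in> fourier_graph \<Longrightarrow> norm (fst p) = norm (snd p)"
  using fourier_graph_cinner[of p p]
  by (simp add: cinner_self_norm power2_eq_iff_nonneg flip: of_real_power)

text \<open>If combinations u n of Gaussians approximate f, their partners form a Cauchy sequence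
  because the relation is isometric, and completeness of \<open>L2\<close> provides the
  limit.\<close>

lemma fourier_graph_total: "\<exists>h. (f, h) \<in> fourier_graph"
proof -
  have sub: "gauss_span \<subseteq> fst ` span gauss_pairs"
    unfolding gauss_span_def
  proof (rule span_minimal)
    show "subspace (fst ` span gauss_pairs)"
      by (intro linear_subspace_image subspace_span linear_fst)
    show "{scaleC a (gaussian b) |a b. True} \<subseteq> fst ` span gauss_pairs"
      by (force simp: gauss_pairs_def intro: span_base)
  qed
  have "f \<in> closure (fst ` span gauss_pairs)"
    using closure_mono[OF sub] gauss_span_dense by auto
  then obtain u where u: "\<And>n. u n \<in> fst ` span gauss_pairs" "u \<longlonglongrightarrow> f"
    unfolding closure_sequential by auto
  then have "\<forall>n. \<exists>v. (u n, v) \<in> span gauss_pairs" by force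
  then obtain v where v: "\<And>n. (u n, v n) \<in> span gauss_pairs" by metis
  have "norm (v m - v n) = norm (u m - u n)" for m n
    using fourier_graph_norm[of "(u m, v m) - (u n, v n)"]
      subspace_diff[OF subspace_span v[of m] v[of n]] closure_subset[of "span gauss_pairs"]
    by (auto simp: fourier_graph_def)
  then have "Cauchy v"
    using LIMSEQ_imp_Cauchy[OF u(2)] by (simp add: Cauchy_def dist_norm)
  then obtain h where h: "v \<longlonglongrightarrow> h" using Cauchy_convergent convergent_def by blast
  have "(\<lambda>n. (u n, v n)) \<longlonglongrightarrow> (f, h)" by (intro tendsto_Pair u h)
  then show ?thesis
    unfolding fourier_graph_def closure_sequential using v
    by (intro exI[of _ h] exI[of _ "\<lambda>n. (u n, v n)"]) auto
qed

definition plancherel :: "L2 \<Rightarrow> L2" where "plancherel f = (THE h. (f, h) \<in> fourier_graph)"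

lemma plancherel_unique: "(f, h) \<in> fourier_graph \<Longrightarrow> (f, h') \<in> fourier_graph \<Longrightarrow> h = h'"
  using fourier_graph_norm[of "(f, h) - (f, h')"]
    subspace_diff[OF subspace_fourier_graph, of "(f, h)" "(f, h')"] by simp

lemma plancherel_graph: "(f, plancherel f) \<in> fourier_graph"
proof -
  obtain h where h: "(f, h) \<in> fourier_graph" using fourier_graph_total by blast
  then have "plancherel f = h"
    unfolding plancherel_def by (rule the_equality) (rule plancherel_unique[OF _ h])
  then show ?thesis using h by simp
qed

lemma plancherel_eqI: "(f, h) \<in> fourier_graph \<Longrightarrow> plancherel f = h"
  using plancherel_unique plancherel_graph by blast

lemma cinner_plancherel: "cinner (plancherel f) (plancherel g) = cinner f g"
  using fourier_graph_cinner[OF plancherel_graph plancherel_graph, of f g] by simp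

lemma bounded_linear_plancherel: "bounded_linear plancherel"
proof (rule bounded_linear_intro)
  show "plancherel (f + g) = plancherel f + plancherel g" for f g
    using subspace_add[OF subspace_fourier_graph plancherel_graph[of f] plancherel_graph[of g]]
    by (intro plancherel_eqI) simp
  show "plancherel (r *\<^sub>R f) = r *\<^sub>R plancherel f" for r f
    using subspace_scale[OF subspace_fourier_graph plancherel_graph[of f], of r]
    by (intro plancherel_eqI) simp
  show "norm (plancherel f) \<le> norm f * 1" for f
    using fourier_graph_norm[OF plancherel_graph[of f]] by simp
qed

lemma plancherel_gaussian: "plancherel (scaleC a (gaussian b))
    = scaleC (a * exp (b\<^sup>2 / 2)) (gaussian (- \<i> * b))"
proof (rule plancherel_eqI)
  have "(scaleC a (gaussian b), scaleC (a * exp (b\<^sup>2 / 2)) (gaussian (- \<i> * b))) \<in> gauss_pairs"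
    by (auto simp: gauss_pairs_def)
  then show "(scaleC a (gaussian b), scaleC (a * exp (b\<^sup>2 / 2)) (gaussian (- \<i> * b)))
      \<in> fourier_graph"
    unfolding fourier_graph_def using closure_subset span_base by blast
qed

section \<open>Agreement of the isometric extension with the Fourier integral\<close>

definition fourier_integral :: "(real \<Rightarrow> complex) \<Rightarrow> real \<Rightarrow> complex" where
  "fourier_integral f x = complex_of_real (1 / sqrt (2 * pi)) *
     (\<integral>y. f y * exp (- \<i> * complex_of_real (x * y)) \<partial>lborel)"

lemma fourier_integral_measurable [measurable]:
  assumes [measurable]: "f \<in> borel_measurable lborel"
  shows "fourier_integral f \<in> borel_measurable borel"
  unfolding fourier_integral_def by measurable

lemma norm_fourier_integral_le:
  "norm (fourier_integral f x) \<le> 1 / sqrt (2 * pi) * (\<integral>y. norm (f y) \<partial>lborel)"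
proof -
  have "norm (\<integral>y. f y * exp (- \<i> * complex_of_real (x * y)) \<partial>lborel)
      \<le> (\<integral>y. norm (f y * exp (- \<i> * complex_of_real (x * y))) \<partial>lborel)"
    by (rule integral_norm_bound)
  then show ?thesis
    unfolding fourier_integral_def norm_mult by (intro mult_mono) (auto simp: norm_mult norm_divide)
qed

text \<open>Fubini moves the transform from f to the Gaussian, where it is explicit. The Gaussian
  factor makes the kernel jointly integrable for merely integrable f.\<close>

lemma integral_fourier_gauss:
  assumes f: "integrable lborel f"
  shows "(\<integral>x. fourier_integral f x * cnj (gauss c x) \<partial>lborel)
    = exp ((cnj c)\<^sup>2 / 2) * (\<integral>y. f y * cnj (gauss (\<i> * c) y) \<partial>lborel)"
proof -
  have [measurable]: "f \<in> borel_measurable lborel" using f by auto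
  define K where "K x y = f y * (exp (- \<i> * complex_of_real (x * y)) * cnj (gauss c x))" for x y
  have nK: "norm (K x y) = norm (gauss c x) * norm (f y)" for x y
    by (simp add: K_def norm_mult)
  have Km [measurable]: "case_prod K \<in> borel_measurable (lborel \<Otimes>\<^sub>M lborel)"
    unfolding K_def by measurable
  have "integrable (lborel \<Otimes>\<^sub>M lborel) (case_prod K)"
  proof (rule lborel_pair.Fubini_integrable)
    show "integrable lborel (\<lambda>x. \<integral>y. norm (case_prod K (x, y)) \<partial>lborel)"
      using integrable_gauss[of c] by (auto simp: nK)
    have "integrable lborel (\<lambda>y. K x y)" for x
    proof (rule Bochner_Integration.integrable_bound)
      show "integrable lborel (\<lambda>y. norm (gauss c x) * norm (f y))" using f by simp
      show "(\<lambda>y. K x y) \<in> borel_measurable lborel" unfolding K_def by measurable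
    qed (simp add: nK)
    then show "AE x in lborel. integrable lborel (\<lambda>y. case_prod K (x, y))" by simp
  qed measurable
  then have fub: "(\<integral>x. (\<integral>y. K x y \<partial>lborel) \<partial>lborel) = (\<integral>y. (\<integral>x. K x y \<partial>lborel) \<partial>lborel)"
    using lborel_pair.Fubini_integral[of K] by simp
  have inner: "(\<integral>x. K x y \<partial>lborel)
      = of_real (sqrt (2 * pi)) * exp ((cnj c)\<^sup>2 / 2) * (f y * cnj (gauss (\<i> * c) y))" for y
  proof -
    have "exp (- \<i> * complex_of_real (x * y)) * cnj (gauss c x) = cnj (gauss (c + \<i> * of_real y) x)"
      for x
      unfolding gauss_def exp_cnj exp_add[symmetric]
      by (intro arg_cong[where f = exp]) (simp add: algebra_simps)
    then have "(\<integral>x. K x y \<partial>lborel) = f y * (\<integral>x. cnj (gauss (c + \<i> * of_real y) x) \<partial>lborel)"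
      unfolding K_def by simp
    also have "(\<integral>x. cnj (gauss (c + \<i> * of_real y) x) \<partial>lborel)
        = cnj (of_real (sqrt (2 * pi)) * exp ((c + \<i> * of_real y)\<^sup>2 / 2))"
      unfolding Bochner_Integration.integral_cnj integral_gauss ..
    also have "exp ((c + \<i> * of_real y)\<^sup>2 / 2) = exp (c\<^sup>2 / 2) * gauss (\<i> * c) y"
      unfolding gauss_def exp_add[symmetric]
      by (intro arg_cong[where f = exp]) (simp add: power2_eq_square field_simps)
    finally show ?thesis by (simp add: exp_cnj mult_ac)
  qed
  have "(\<integral>x. fourier_integral f x * cnj (gauss c x) \<partial>lborel)
      = of_real (1 / sqrt (2 * pi)) * (\<integral>x. (\<integral>y. K x y \<partial>lborel) \<partial>lborel)"
  proof -
    have "fourier_integral f x * cnj (gauss c x)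
        = of_real (1 / sqrt (2 * pi)) * (\<integral>y. K x y \<partial>lborel)" for x
      unfolding fourier_integral_def K_def mult.assoc[symmetric] integral_mult_left_zero by simp
    then show ?thesis by (simp only: integral_mult_right_zero)
  qed
  also have "\<dots> = of_real (1 / sqrt (2 * pi)) * (of_real (sqrt (2 * pi)) * exp ((cnj c)\<^sup>2 / 2) *
      (\<integral>y. f y * cnj (gauss (\<i> * c) y) \<partial>lborel))"
    unfolding fub inner integral_mult_right_zero ..
  also have "\<dots> = exp ((cnj c)\<^sup>2 / 2) * (\<integral>y. f y * cnj (gauss (\<i> * c) y) \<partial>lborel)"
    by simp
  finally show ?thesis .
qed

text \<open>Isometry determines the pairing of the abstract transform h with every Gaussian, and
  Fubini that of the integral formula; the two agree. Since the integral formula is at first only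
  known to be bounded, not square integrable, totality in \<open>L2\<close> cannot be used and the
  weighted \<open>gauss_uniqueness\<close> takes its place.\<close>

lemma plancherel_integral:
  assumes f: "square_integrable f" "integrable lborel f"
  shows "plancherel (L2_of f) = L2_of (fourier_integral f)" "square_integrable (fourier_integral f)"
proof -
  have [measurable]: "f \<in> borel_measurable lborel" using f by auto
  obtain h where h: "square_integrable h" "plancherel (L2_of f) = L2_of h" by (rule L2_cases)
  have [measurable]: "h \<in> borel_measurable lborel" using h by (simp add: square_integrable_def)
  have eq: "(\<integral>x. h x * cnj (gauss c x) \<partial>lborel)
      = (\<integral>x. fourier_integral f x * cnj (gauss c x) \<partial>lborel)" for c
  proof -
    have "cinner (L2_of f) (gaussian (\<i> * c))
        = cinner (L2_of h) (scaleC (exp (- (c\<^sup>2) / 2)) (gaussian c))"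
      using cinner_plancherel[of "L2_of f" "gaussian (\<i> * c)"] plancherel_gaussian[of 1 "\<i> * c"] h
      by (simp add: power_mult_distrib)
    then have "(\<integral>x. f x * cnj (gauss (\<i> * c) x) \<partial>lborel)
        = exp (- ((cnj c)\<^sup>2) / 2) * (\<integral>x. h x * cnj (gauss c x) \<partial>lborel)"
      using f h by (simp add: cinner_scaleC_right gaussian_def cinner_L2_of exp_cnj)
    then show ?thesis
      unfolding integral_fourier_gauss[OF f(2)]
        by (simp add: mult.assoc[symmetric] exp_add[symmetric])
  qed
  have i1: "integrable lborel (\<lambda>x. fourier_integral f x * gauss b x)" for b
  proof (rule Bochner_Integration.integrable_bound)
    let ?C = "1 / sqrt (2 * pi) * (\<integral>y. norm (f y) \<partial>lborel)"
    show "integrable lborel (\<lambda>x. ?C * norm (gauss b x))"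
      using integrable_gauss by simp
    show "AE x in lborel. norm (fourier_integral f x * gauss b x) \<le> norm (?C * norm (gauss b x))"
    proof (rule AE_I2)
      fix x
      have "norm (fourier_integral f x * gauss b x) \<le> ?C * norm (gauss b x)"
        unfolding norm_mult by (intro mult_right_mono norm_fourier_integral_le) simp
      then show "norm (fourier_integral f x * gauss b x) \<le> norm (?C * norm (gauss b x))"
        unfolding real_norm_def by linarith
    qed
  qed measurable
  have i2: "integrable lborel (\<lambda>x. h x * gauss b x)" for b
    by (rule square_integrable_mult_integrable) (use h in auto)
  have "AE x in lborel. h x - fourier_integral f x = 0"
  proof (rule gauss_uniqueness)
    show "integrable lborel (\<lambda>x. (h x - fourier_integral f x) * gauss 0 x)"
      unfolding left_diff_distrib by (intro Bochner_Integration.integrable_diff i1 i2)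
    fix t
    have "cnj (gauss (- \<i> * of_real t) x) = gauss (\<i> * of_real t) x" for x
      by (simp add: gauss_def exp_cnj)
    then show "(\<integral>x. (h x - fourier_integral f x) * gauss (\<i> * of_real t) x \<partial>lborel) = 0"
      unfolding left_diff_distrib using eq[of "- \<i> * of_real t"]
      by (subst Bochner_Integration.integral_diff[OF i2 i1]) simp
  qed
  then have "AE x in lborel. h x = fourier_integral f x" by eventually_elim simp
  from L2_of_eqI[OF h(1) _ this] h(2)
  show "plancherel (L2_of f) = L2_of (fourier_integral f)" "square_integrable (fourier_integral f)"
    by auto
qed

text \<open>Justifies the definite description in \<open>fourier\<close>: Gaussians are integrable,
  so the integral formula fixes an operator on a total set.\<close>

lemma fourier_eq: "blinfun_apply fourier = plancherel"
proof -
  let ?P = "\<lambda>F :: L2 \<Rightarrow>\<^sub>L L2. \<forall>f. square_integrable f \<and> integrable lborel f \<longrightarrow>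
     F (L2_of f) = L2_of (\<lambda>x. complex_of_real (1 / sqrt (2 * pi)) *
         (\<integral>y. f y * exp (- \<i> * complex_of_real (x * y)) \<partial>lborel))"
  have app: "blinfun_apply (Blinfun plancherel) = plancherel"
    by (rule bounded_linear_Blinfun_apply[OF bounded_linear_plancherel])
  have "fourier = Blinfun plancherel"
    unfolding fourier_def
  proof (rule the_equality)
    show P: "?P (Blinfun plancherel)"
      using plancherel_integral(1) by (simp add: app fourier_integral_def[abs_def])
    fix F assume F: "?P F"
    show "F = Blinfun plancherel"
    proof (rule blinfun_eq_on_gaussians)
      fix a b
      have "scaleC a (gaussian b) = L2_of (\<lambda>x. a * gauss b x)"
        by (simp add: gaussian_def scaleC_L2_of)
      moreover have "square_integrable (\<lambda>x. a * gauss b x)" "integrable lborel (\<lambda>x. a * gauss b x)"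
        using integrable_gauss by (auto intro: square_integrable_cmult)
      ultimately show "F (scaleC a (gaussian b)) = Blinfun plancherel (scaleC a (gaussian b))"
        using F P by simp
    qed
  qed
  then show ?thesis using app by (rule ssubst)
qed

lemmas fourier_gaussian = plancherel_gaussian[folded fourier_eq]
  and fourier_integral = plancherel_integral[folded fourier_eq]
  and cinner_fourier = cinner_plancherel[folded fourier_eq]

section \<open>Affine changes of variable\<close>

lemma L2_rep_L2_of: "square_integrable f \<Longrightarrow> L2_rel (L2_rep (L2_of f)) f"
  using Quotient3_rep_abs[OF Quotient3_L2, of f] by simp

lemma AE_affine:
  fixes c t :: real
  assumes "\<bar>c\<bar> = 1" "f \<in> borel_measurable lborel" "g \<in> borel_measurable lborel"
    "AE x in lborel. f x = (g x :: complex)"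
  shows "AE x in lborel. f (t + c * x) = g (t + c * x)"
  using AE_borel_affine[of c "\<lambda>x. f x = g x" t] assms by auto

lemma square_integrable_affine:
  fixes c t :: real
  assumes "\<bar>c\<bar> = 1" "square_integrable f"
  shows "square_integrable (\<lambda>x. f (t + c * x))"
  using assms lborel_integrable_real_affine[of "\<lambda>x. (norm (f x))\<^sup>2" c t]
  by (auto simp: square_integrable_def)

text \<open>Translations and the reflection: it is applied with c = 1 or -1, where the substitution
  is isometric. Dilations will come from products of generators instead.\<close>

definition affine_op :: "real \<Rightarrow> real \<Rightarrow> (L2 \<Rightarrow>\<^sub>L L2)" where
  "affine_op c t = Blinfun (\<lambda>u. L2_of (\<lambda>x. L2_rep u (t + c * x)))"

lemma affine_op_L2_of:
  assumes c: "\<bar>c\<bar> = 1" and f: "square_integrable f"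
  shows "affine_op c t (L2_of f) = L2_of (\<lambda>x. f (t + c * x))"
proof -
  define m where "m u = L2_of (\<lambda>x. L2_rep u (t + c * x))" for u
  have m: "m (L2_of g) = L2_of (\<lambda>x. g (t + c * x))" if g: "square_integrable g" for g
  proof -
    from L2_rep_L2_of[OF g] have r: "square_integrable (L2_rep (L2_of g))"
      "AE x in lborel. L2_rep (L2_of g) x = g x" by (auto simp: L2_rel_def)
    show ?thesis
      unfolding m_def
    proof (rule L2_of_eqI(1))
      show "square_integrable (\<lambda>x. L2_rep (L2_of g) (t + c * x))"
        by (rule square_integrable_affine[OF c r(1)])
      show "(\<lambda>x. g (t + c * x)) \<in> borel_measurable lborel"
        using square_integrable_affine[OF c g] by (simp add: square_integrable_def)
      show "AE x in lborel. L2_rep (L2_of g) (t + c * x) = g (t + c * x)"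
        using r g by (intro AE_affine c) (auto simp: square_integrable_def)
    qed
  qed
  have "bounded_linear m"
  proof (rule bounded_linear_intro)
    fix u v :: L2 and r :: real
    obtain g where g: "square_integrable g" "u = L2_of g" by (rule L2_cases)
    obtain h where h: "square_integrable h" "v = L2_of h" by (rule L2_cases)
    show "m (u + v) = m u + m v"
      using g h c by (simp add: m L2_of_add square_integrable_affine square_integrable_add)
    show "m (r *\<^sub>R u) = r *\<^sub>R m u"
      using g c
      by (simp add: m scaleR_L2_def scaleC_L2_of square_integrable_affine square_integrable_cmult)
    have "(norm (m u))\<^sup>2 = (norm u)\<^sup>2"
      using g c lborel_integral_real_affine[of c "\<lambda>x. (norm (g x))\<^sup>2" t]
      by (auto simp add: m norm_L2_of square_integrable_affine)
    then show "norm (m u) \<le> norm u * 1" by (simp add: power2_eq_iff_nonneg)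
  qed
  then show ?thesis
    unfolding affine_op_def m_def[symmetric] using m f by (simp add: bounded_linear_Blinfun_apply)
qed

lemma reflection_gaussian: "affine_op (-1) 0 (scaleC a (gaussian b)) = scaleC a (gaussian (- b))"
  by (simp add: gaussian_def scaleC_L2_of affine_op_L2_of square_integrable_cmult)
    (simp add: gauss_def)

text \<open>Applying b -> - i b twice gives - b, and the factors exp (b^2/2) and exp (- b^2/2)
  cancel. This yields surjectivity of \<open>fourier\<close> and an explicit formula for its
  adjoint.\<close>

lemma fourier_fourier: "fourier (fourier f) = affine_op (-1) 0 f"
proof -
  have "fourier o\<^sub>L fourier = affine_op (-1) 0"
    by (rule blinfun_eq_on_gaussians)
      (simp add: fourier_gaussian reflection_gaussian power_mult_distrib mult.assoc
        exp_add[symmetric])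
  then show ?thesis by (metis blinfun_apply_blinfun_compose)
qed

lemma fourier_reflection: "fourier (affine_op (-1) 0 f) = affine_op (-1) 0 (fourier f)"
  by (simp flip: fourier_fourier)

lemma reflection_reflection: "affine_op (-1) 0 (affine_op (-1) 0 f) = f"
proof -
  obtain u where u: "square_integrable u" "f = L2_of u" by (rule L2_cases)
  then show ?thesis
    using square_integrable_affine[of "-1" u 0] by (simp add: affine_op_L2_of)
qed

section \<open>Multiplication operators\<close>

definition bounded_borel :: "(real \<Rightarrow> complex) \<Rightarrow> bool" where
  "bounded_borel \<phi> \<longleftrightarrow> \<phi> \<in> borel_measurable borel \<and> (\<exists>B. \<forall>x. norm (\<phi> x) \<le> B)"

lemma bounded_borel_measurable [measurable_dest]: "bounded_borel \<phi> \<Longrightarrow> \<phi> \<in> borel_measurable borel"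
  by (simp add: bounded_borel_def)

lemma bounded_borel_const [simp]: "bounded_borel (\<lambda>_. c)"
  by (auto simp: bounded_borel_def)

lemma bounded_borel_mult:
  assumes "bounded_borel \<phi>" "bounded_borel \<psi>"
  shows "bounded_borel (\<lambda>x. \<phi> x * \<psi> x)"
proof -
  obtain B C where B: "\<And>x. norm (\<phi> x) \<le> B" and C: "\<And>x. norm (\<psi> x) \<le> C"
    using assms by (auto simp: bounded_borel_def)
  have "norm (\<phi> x * \<psi> x) \<le> \<bar>B\<bar> * \<bar>C\<bar>" for x
    unfolding norm_mult using B[of x] C[of x] by (intro mult_mono) auto
  then show ?thesis using assms by (auto simp: bounded_borel_def)
qed

lemma bounded_borel_add:
  assumes "bounded_borel \<phi>" "bounded_borel \<psi>"
  shows "bounded_borel (\<lambda>x. \<phi> x + \<psi> x)"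
proof -
  obtain B C where B: "\<And>x. norm (\<phi> x) \<le> B" and C: "\<And>x. norm (\<psi> x) \<le> C"
    using assms by (auto simp: bounded_borel_def)
  have "norm (\<phi> x + \<psi> x) \<le> B + C" for x
    using norm_triangle_mono[OF B C] .
  then show ?thesis using assms by (auto simp: bounded_borel_def)
qed

lemma bounded_borel_cnj: "bounded_borel \<phi> \<Longrightarrow> bounded_borel (\<lambda>x. cnj (\<phi> x))"
  by (auto simp: bounded_borel_def)

lemma bounded_borel_exp:
  assumes [measurable]: "h \<in> borel_measurable borel"
  shows "bounded_borel (\<lambda>x. iexp (h x))"
  unfolding bounded_borel_def by (auto intro!: exI[of _ 1])

lemma bounded_borel_comp:
  "bounded_borel \<phi> \<Longrightarrow> h \<in> borel_measurable borel \<Longrightarrow> bounded_borel (\<lambda>x. \<phi> (h x))"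
  unfolding bounded_borel_def by (auto intro: measurable_compose)

lemma square_integrable_bounded_borel:
  "bounded_borel \<phi> \<Longrightarrow> square_integrable f \<Longrightarrow> square_integrable (\<lambda>x. \<phi> x * f x)"
  unfolding bounded_borel_def by (auto intro!: square_integrable_mult)

lemma mult_op_L2_of:
  "bounded_borel \<phi> \<Longrightarrow> square_integrable f \<Longrightarrow> mult_op \<phi> (L2_of f) = L2_of (\<lambda>x. \<phi> x * f x)"
  unfolding bounded_borel_def by (auto intro!: mult_op_apply)

lemma mult_op_mult:
  "bounded_borel \<phi> \<Longrightarrow> bounded_borel \<psi> \<Longrightarrow> mult_op \<phi> (mult_op \<psi> u) = mult_op (\<lambda>x. \<phi> x * \<psi> x) u"
  by (rule L2_cases[of u])
    (simp add: mult_op_L2_of square_integrable_bounded_borel bounded_borel_mult mult.assoc)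

lemma mult_op_add:
  "bounded_borel \<phi> \<Longrightarrow> bounded_borel \<psi> \<Longrightarrow> mult_op (\<lambda>x. \<phi> x + \<psi> x) u = mult_op \<phi> u + mult_op \<psi> u"
  by (rule L2_cases[of u])
    (simp add: mult_op_L2_of square_integrable_bounded_borel bounded_borel_add L2_of_add
      distrib_right)

lemma mult_op_const: "mult_op (\<lambda>_. c) u = scaleC c u"
  by (rule L2_cases[of u]) (simp add: mult_op_L2_of scaleC_L2_of)

lemma mult_op_scaleC: "bounded_borel \<phi> \<Longrightarrow> mult_op \<phi> (scaleC c u) = scaleC c (mult_op \<phi> u)"
  by (simp add: mult_op_mult mult.commute flip: mult_op_const)

lemma cinner_mult_op:
  "bounded_borel \<phi> \<Longrightarrow> cinner (mult_op \<phi> u) v = cinner u (mult_op (\<lambda>x. cnj (\<phi> x)) v)"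
  by (rule L2_cases[of u], rule L2_cases[of v])
    (simp add: mult_op_L2_of square_integrable_bounded_borel bounded_borel_cnj cinner_L2_of, simp
      add: mult_ac)

lemma mult_op_cong_AE:
  assumes "bounded_borel \<phi>" "bounded_borel \<psi>" "AE x in lborel. \<phi> x = \<psi> x"
  shows "mult_op \<phi> = mult_op \<psi>"
proof (rule blinfun_eqI)
  fix u
  obtain f where f: "square_integrable f" "u = L2_of f" by (rule L2_cases)
  have "AE x in lborel. \<phi> x * f x = \<psi> x * f x"
    using assms(3) by eventually_elim simp
  then show "mult_op \<phi> u = mult_op \<psi> u"
    using f assms by (simp add: mult_op_L2_of L2_of_eq_iff square_integrable_bounded_borel)
qed

lemma mult_op_tendsto:
  assumes \<phi>: "\<And>n. \<phi> n \<in> borel_measurable borel" "\<And>n x. norm (\<phi> n x) \<le> B"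
    and \<psi>: "bounded_borel \<psi>" and lim: "AE x in lborel. (\<lambda>n. \<phi> n x) \<longlonglongrightarrow> \<psi> x"
  shows "(\<lambda>n. mult_op (\<phi> n) u) \<longlonglongrightarrow> mult_op \<psi> u"
proof -
  obtain f where f: "square_integrable f" "u = L2_of f" by (rule L2_cases)
  have b: "bounded_borel (\<phi> n)" for n using \<phi> by (auto simp: bounded_borel_def)
  have [measurable]: "f \<in> borel_measurable borel" "\<psi> \<in> borel_measurable borel"
    "\<And>n. \<phi> n \<in> borel_measurable borel"
    using f \<psi> b by (auto simp: square_integrable_def bounded_borel_def)
  have "(\<lambda>n. L2_of (\<lambda>x. \<phi> n x * f x)) \<longlonglongrightarrow> L2_of (\<lambda>x. \<psi> x * f x)"
  proof (rule L2_tendsto_dominated(3))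
    show "integrable lborel (\<lambda>x. (B * norm (f x))\<^sup>2)"
      using f by (simp add: power_mult_distrib square_integrable_def)
    show "AE x in lborel. norm (\<phi> n x * f x) \<le> B * norm (f x)" for n
      using \<phi>(2)[of n] by (intro AE_I2) (simp add: norm_mult mult_right_mono)
    show "AE x in lborel. (\<lambda>n. \<phi> n x * f x) \<longlonglongrightarrow> \<psi> x * f x"
      using lim by eventually_elim (intro tendsto_intros)
  qed measurable
  then show ?thesis using f b \<psi> by (simp add: mult_op_L2_of)
qed

section \<open>Unitary operators\<close>

lemma unitary_clinear: "unitary U \<Longrightarrow> U (scaleC c f) = scaleC c (U f)"
  and unitary_cinner: "unitary U \<Longrightarrow> cinner (U f) (U g) = cinner f g"
  and unitary_surj: "unitary U \<Longrightarrow> surj U"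
  by (auto simp: unitary_def clinear_def)

lemma unitary_norm: "unitary U \<Longrightarrow> norm (U f) = norm f"
  using unitary_cinner[of U f f]
  by (simp add: cinner_self_norm power2_eq_iff_nonneg flip: of_real_power)

lemma unitary_inj:
  assumes "unitary U" "U f = U g"
  shows "f = g"
proof -
  have "norm (f - g) = norm (U (f - g))" by (simp only: unitary_norm[OF assms(1)])
  also have "\<dots> = 0" using assms(2) by (simp add: blinfun.diff_right)
  finally show ?thesis by simp
qed

lemma unitary_inverse_ex:
  assumes U: "unitary U"
  shows "\<exists>V :: L2 \<Rightarrow>\<^sub>L L2. \<forall>f. U (V f) = f"
proof -
  define V where "V = inv_into UNIV (blinfun_apply U)"
  have UV: "U (V f) = f" for f
    unfolding V_def using unitary_surj[OF U] by (rule surj_f_inv_f)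
  have "bounded_linear V"
  proof (rule bounded_linear_intro)
    show "V (f + g) = V f + V g" for f g
      by (rule unitary_inj[OF U]) (simp add: UV blinfun.add_right)
    show "V (r *\<^sub>R f) = r *\<^sub>R V f" for r f
      by (rule unitary_inj[OF U]) (simp add: UV blinfun.scaleR_right)
    show "norm (V f) \<le> norm f * 1" for f
      using unitary_norm[OF U, of "V f"] by (simp add: UV)
  qed
  then show ?thesis
    using UV by (intro exI[of _ "Blinfun V"]) (simp add: bounded_linear_Blinfun_apply)
qed

text \<open>A right inverse of a unitary satisfies the identity that describes the adjoint, and
  nondegeneracy of the inner product makes it the only solution.\<close>

lemma adj_eqI:
  fixes U V :: "L2 \<Rightarrow>\<^sub>L L2"
  assumes U: "unitary U" and V: "\<And>f. U (V f) = f"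
  shows "adj U = V"
  unfolding adj_def
proof (rule the_equality)
  show "\<forall>f g. cinner (U f) g = cinner f (V g)"
    using unitary_cinner[OF U, of _ "V _"] V by simp
  fix S assume "\<forall>f g. cinner (U f) g = cinner f (blinfun_apply S g)"
  then have "cinner f (S g) = cinner f (V g)" for f g
    using unitary_cinner[OF U, of f "V g"] V by simp
  then show "S = V" by (intro blinfun_eqI cinner_eqI_right) simp
qed

lemma unitary_adj_right: "unitary U \<Longrightarrow> U (adj U f) = f"
  using unitary_inverse_ex adj_eqI by metis

lemma unitary_adj_left: "unitary U \<Longrightarrow> adj U (U f) = f"
  using unitary_adj_right unitary_inj by metis

lemma cinner_adj: "unitary U \<Longrightarrow> cinner (U f) g = cinner f (adj U g)"
  using unitary_cinner[of U f "adj U g"] by (simp add: unitary_adj_right)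

lemma unitary_adj:
  assumes U: "unitary U"
  shows "unitary (adj U)"
  unfolding unitary_def clinear_def
proof (intro conjI allI)
  fix c f g
  show "adj U (scaleC c f) = scaleC c (adj U f)"
    by (rule unitary_inj[OF U]) (simp add: unitary_adj_right[OF U] unitary_clinear[OF U])
  show "surj (adj U)" using unitary_adj_left[OF U] by (metis surjI)
  show "cinner (adj U f) (adj U g) = cinner f g"
    using unitary_cinner[OF U, of "adj U f" "adj U g"] by (simp add: unitary_adj_right[OF U])
qed

lemma adj_adj: "unitary U \<Longrightarrow> adj (adj U) = U"
  by (intro adj_eqI unitary_adj unitary_adj_left)

lemma unitary_compose: "unitary U \<Longrightarrow> unitary V \<Longrightarrow> unitary (U o\<^sub>L V)"
  using comp_surj[of V U] by (simp add: unitary_def clinear_def comp_def)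

lemma unitary_id: "unitary id_blinfun"
  by (simp add: unitary_def clinear_def)

lemma adj_id: "adj id_blinfun = id_blinfun"
  by (rule adj_eqI[OF unitary_id]) simp

lemma adj_compose: "unitary U \<Longrightarrow> unitary V \<Longrightarrow> adj (U o\<^sub>L V) = adj V o\<^sub>L adj U"
  by (intro adj_eqI unitary_compose) (simp_all add: unitary_adj_right)

lemma unitaryI:
  fixes U :: "L2 \<Rightarrow>\<^sub>L L2" and V :: "L2 \<Rightarrow> L2"
  assumes "\<And>c f. U (scaleC c f) = scaleC c (U f)" "\<And>f g. cinner (U f) (U g) = cinner f g"
    "\<And>f. U (V f) = f"
  shows "unitary U"
  using assms surjI[of U V] by (simp add: unitary_def clinear_def)

lemma Ad_apply:
  fixes U T :: "L2 \<Rightarrow>\<^sub>L L2"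
  shows "Ad U T f = U (T (adj U f))"
  by (simp add: Ad_def)

text \<open>Rewrites conjugation as an intertwining relation free of adjoints, the form in which
  \<open>Ad\<close> is evaluated.\<close>

lemma Ad_eq_iff:
  fixes U T T' :: "L2 \<Rightarrow>\<^sub>L L2"
  shows "unitary U \<Longrightarrow> Ad U T = T' \<longleftrightarrow> (\<forall>f. U (T f) = T' (U f))"
  unfolding Ad_def by (auto intro!: blinfun_eqI simp: unitary_adj_right unitary_adj_left)

lemma Ad_intertwines:
  fixes U T :: "L2 \<Rightarrow>\<^sub>L L2"
  shows "unitary U \<Longrightarrow> U (T f) = Ad U T (U f)"
  by (simp add: Ad_apply unitary_adj_left)

lemma Ad_compose: "unitary U \<Longrightarrow> unitary V \<Longrightarrow> Ad (U o\<^sub>L V) T = Ad U (Ad V T)"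
  by (rule blinfun_eqI) (simp add: Ad_apply adj_compose)

lemma Ad_id_op: "Ad id_blinfun T = T"
  by (rule blinfun_eqI) (simp add: Ad_apply adj_id)

lemma Ad_adj_left: "unitary U \<Longrightarrow> Ad (adj U) (Ad U T) = T"
  by (rule blinfun_eqI) (simp add: Ad_apply adj_adj unitary_adj_left)

lemma Ad_adj_right: "unitary U \<Longrightarrow> Ad U (Ad (adj U) T) = T"
  by (rule blinfun_eqI) (simp add: Ad_apply adj_adj unitary_adj_right)

lemma Ad_inject: "unitary U \<Longrightarrow> Ad U S = Ad U T \<longleftrightarrow> S = T"
  by (metis Ad_adj_left)

lemma Ad_id: "unitary U \<Longrightarrow> Ad U id_blinfun = id_blinfun"
  by (simp add: Ad_eq_iff)

lemma Ad_zero: "unitary U \<Longrightarrow> Ad U 0 = 0"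
  by (simp add: Ad_eq_iff blinfun.zero_right)

lemma Ad_diff: "unitary U \<Longrightarrow> Ad U (S - T) = Ad U S - Ad U T"
  by (simp add: Ad_eq_iff blinfun.diff_left blinfun.diff_right Ad_apply unitary_adj_left)

lemma unitary_mult_op:
  assumes \<phi>: "bounded_borel \<phi>" "\<And>x. norm (\<phi> x) = 1"
  shows "unitary (mult_op \<phi>)" "adj (mult_op \<phi>) = mult_op (\<lambda>x. cnj (\<phi> x))"
proof -
  have one: "\<phi> x * cnj (\<phi> x) = 1" for x
    using \<phi>(2)[of x] by (simp flip: complex_norm_square)
  have inv: "mult_op \<phi> (mult_op (\<lambda>x. cnj (\<phi> x)) f) = f"
    and inv': "mult_op (\<lambda>x. cnj (\<phi> x)) (mult_op \<phi> f) = f" for f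
    using \<phi>(1) one by (simp_all add: mult_op_mult bounded_borel_cnj mult_op_const
      mult.commute[of "cnj _"])
  show u: "unitary (mult_op \<phi>)"
    by (rule unitaryI[OF _ _ inv]) (simp_all add: mult_op_scaleC cinner_mult_op \<phi> inv')
  show "adj (mult_op \<phi>) = mult_op (\<lambda>x. cnj (\<phi> x))"
    by (rule adj_eqI[OF u inv])
qed

lemma unitary_fourier: "unitary fourier"
proof (rule unitaryI)
  show "fourier (fourier (affine_op (-1) 0 f)) = f" for f
    by (simp add: fourier_fourier reflection_reflection)
  \<comment> \<open>The construction gave only real linearity. Preservation of the complex inner
    product supplies the rest: the squared norm of the difference expands to 0.\<close>
  show "fourier (scaleC c f) = scaleC c (fourier f)" for c f
  proof -
    have "cinner (fourier (scaleC c f) - scaleC c (fourier f)) (fourier (scaleC c f)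
        - scaleC c (fourier f)) = 0"
      by (simp only: cinner_diff_left cinner_diff_right cinner_scaleC_left cinner_scaleC_right
          cinner_fourier) simp
    then show ?thesis by (simp add: cinner_self_norm)
  qed
qed (rule cinner_fourier)

lemma adj_fourier: "adj fourier = fourier o\<^sub>L affine_op (-1) 0"
  by (rule adj_eqI[OF unitary_fourier]) (simp add: fourier_fourier reflection_reflection)

lemma phase_apply: "phase \<psi> f = scaleC (iexp \<psi>) f"
  unfolding phase_def by (simp add: bounded_linear_Blinfun_apply[OF bounded_linear_scaleC])

lemma phase_eq_mult_op: "phase \<psi> = mult_op (\<lambda>_. iexp \<psi>)"
  by (rule blinfun_eqI) (simp add: phase_apply mult_op_const)

lemma unitary_phase: "unitary (phase \<psi>)" and adj_phase: "adj (phase \<psi>) = phase (- \<psi>)"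
  unfolding phase_eq_mult_op
  using unitary_mult_op[of "\<lambda>_. iexp \<psi>"] by (simp_all add: exp_cnj)

lemma unitary_exp_op:
  assumes [measurable]: "h \<in> borel_measurable borel"
  shows "unitary (mult_op (\<lambda>x. iexp (h x)))"
    and "adj (mult_op (\<lambda>x. iexp (h x))) = mult_op (\<lambda>x. iexp (- h x))"
  using unitary_mult_op[OF bounded_borel_exp[OF assms]] by (simp_all add: exp_cnj)

lemma chirp_eq: "chirp s = mult_op (\<lambda>x. iexp (- (s * x\<^sup>2 / 2)))"
  by (simp add: chirp_def)

lemma unitary_chirp: "unitary (chirp s)" and adj_chirp: "adj (chirp s) = chirp (- s)"
  unfolding chirp_eq by (subst unitary_exp_op | simp)+

lemma unitary_modulation: "unitary (modulation l)" and adj_modulation: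
  "adj (modulation l) = modulation (- l)"
  unfolding modulation_def by (subst unitary_exp_op | simp)+

section \<open>Weyl operators\<close>

text \<open>The symmetric phase - l m / 2 turns conjugation by chirps and by the Fourier transform
  into a linear action on (l, m) without scalar factors; only modulations contribute a
  scalar.\<close>

definition weyl :: "real \<Rightarrow> real \<Rightarrow> (L2 \<Rightarrow>\<^sub>L L2)" where
  "weyl l m = mult_op (\<lambda>x. iexp (l * x - l * m / 2)) o\<^sub>L affine_op 1 (- m)"

lemma weyl_L2_of:
  assumes "square_integrable f"
  shows "weyl l m (L2_of f) = L2_of (\<lambda>x. iexp (l * x - l * m / 2) * f (x - m))"
proof -
  have "square_integrable (\<lambda>x. f (x - m))"
    using square_integrable_affine[of 1 f "- m"] assms by simp
  then show ?thesis
    using assms bounded_borel_exp[of "\<lambda>x. l * x - l * m / 2"]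
    by (simp add: weyl_def affine_op_L2_of mult_op_L2_of del: of_real_mult of_real_diff
      of_real_divide)
qed

lemma square_integrable_weyl:
  assumes "square_integrable f"
  shows "square_integrable (\<lambda>x. iexp (l * x - l * m / 2) * f (x - m))"
  using square_integrable_affine[of 1 f "- m"] assms bounded_borel_exp[of "\<lambda>x. l * x - l * m / 2"]
  by (intro square_integrable_bounded_borel) auto

lemma modulation_eq_weyl: "modulation l = weyl l 0"
proof (rule blinfun_eqI)
  fix u
  obtain f where f: "square_integrable f" "u = L2_of f" by (rule L2_cases)
  then show "modulation l u = weyl l 0 u"
    using bounded_borel_exp[of "\<lambda>x. l * x"] by (simp add: modulation_def mult_op_L2_of weyl_L2_of)
qed

lemma chirp_weyl: "chirp s (weyl l m u) = weyl (l - s * m) m (chirp s u)"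
proof -
  obtain f where f: "square_integrable f" "u = L2_of f" by (rule L2_cases)
  have b: "bounded_borel (\<lambda>x. iexp (- (s * x\<^sup>2 / 2)))"
    by (rule bounded_borel_exp) measurable
  have "iexp (- (s * x\<^sup>2 / 2)) * (iexp (l * x - l * m / 2) * f (x - m))
     = iexp ((l - s * m) * x - (l - s * m) * m / 2) *
      (iexp (- (s * (x - m)\<^sup>2 / 2)) * f (x - m))" for x
    unfolding mult.assoc[symmetric] exp_add[symmetric]
    by (intro arg_cong2[where f = "(*)"] arg_cong[where f = exp] refl)
      (simp add: power2_eq_square field_simps)
  then show ?thesis
    unfolding chirp_eq f(2) using f(1) b
    by (simp only: weyl_L2_of mult_op_L2_of square_integrable_weyl square_integrable_bounded_borel)
qed

lemma modulation_weyl: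
  "modulation c (weyl l m u) = scaleC (iexp (c * m)) (weyl l m (modulation c u))"
proof -
  obtain f where f: "square_integrable f" "u = L2_of f" by (rule L2_cases)
  have b: "bounded_borel (\<lambda>x. iexp (c * x))"
    by (rule bounded_borel_exp) measurable
  have "iexp (c * x) * (iexp (l * x - l * m / 2) * f (x - m))
     = iexp (c * m) * (iexp (l * x - l * m / 2) *
      (iexp (c * (x - m)) * f (x - m)))" for x
    unfolding mult.assoc[symmetric] exp_add[symmetric]
    by (intro arg_cong2[where f = "(*)"] arg_cong[where f = exp] refl)
      (simp add: field_simps)
  moreover have "square_integrable (\<lambda>x. iexp (l * x - l * m / 2) *
      (iexp (c * (x - m)) * f (x - m)))"
    by (rule square_integrable_weyl[OF square_integrable_bounded_borel[OF b f(1)]])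
  ultimately show ?thesis
    unfolding modulation_def f(2) using f(1) b
    by (simp only: weyl_L2_of mult_op_L2_of square_integrable_weyl square_integrable_bounded_borel
        scaleC_L2_of)
qed

lemma weyl_gaussian:
  "weyl l m (scaleC a (gaussian b)) =
    scaleC (a * exp (- (complex_of_real m)\<^sup>2 / 2 - b * of_real m - \<i> * of_real (l * m / 2)))
      (gaussian (b + of_real m + \<i> * of_real l))"
proof -
  have "iexp (l * x - l * m / 2) * (a * gauss b (x - m))
    = a * exp (- (complex_of_real m)\<^sup>2 / 2 - b * of_real m - \<i> * of_real (l * m / 2)) *
      gauss (b + of_real m + \<i> * of_real l) x" for x
    unfolding gauss_def mult.assoc exp_add[symmetric] mult.left_commute[of _ a]
    by (intro arg_cong2[where f = "(*)"] arg_cong[where f = exp] refl)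
      (simp add: power2_eq_square field_simps)
  then show ?thesis
    unfolding gaussian_def
    by (simp only: scaleC_L2_of square_integrable_gauss weyl_L2_of square_integrable_cmult)
qed

text \<open>Both sides are explicit on Gaussians, so the comparison of scalars and parameters
  replaces a change of variable in an integral that a general element of \<open>L2\<close> does not
  admit.\<close>

lemma fourier_weyl: "fourier (weyl l m u) = weyl (- m) l (fourier u)"
proof -
  have "fourier o\<^sub>L weyl l m = weyl (- m) l o\<^sub>L fourier"
  proof (rule blinfun_eq_on_gaussians)
    fix a b
    have arg: "- \<i> * (b + of_real m + \<i> * of_real l) = - \<i> * b + of_real l + \<i> * of_real (- m)"
      by (simp add: algebra_simps)
    have "a * exp (- (complex_of_real m)\<^sup>2 / 2 - b * of_real m - \<i> * of_real (l * m / 2)) *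
        exp ((b + of_real m + \<i> * of_real l)\<^sup>2 / 2) =
      a * exp (b\<^sup>2 / 2) * exp
        (- (complex_of_real l)\<^sup>2 / 2 - (- \<i> * b) * of_real l - \<i> * of_real (- m * l / 2))"
      unfolding mult.assoc exp_add[symmetric]
      by (intro arg_cong2[where f = "(*)"] arg_cong[where f = exp] refl)
        (simp add: power2_eq_square field_simps)
    then show "(fourier o\<^sub>L weyl l m) (scaleC a (gaussian b))
        = (weyl (- m) l o\<^sub>L fourier) (scaleC a (gaussian b))"
      by (simp only: blinfun_apply_blinfun_compose weyl_gaussian fourier_gaussian arg)
  qed
  then show ?thesis by (metis blinfun_apply_blinfun_compose)
qed

section \<open>Intertwining relations\<close>

lemma cinner_mult_op_L2_of:
  assumes "bounded_borel \<phi>" "square_integrable f" "square_integrable g"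
  shows "cinner (mult_op \<phi> (L2_of f)) (L2_of g) = (\<integral>x. \<phi> x * (f x * cnj (g x)) \<partial>lborel)"
  using assms by (simp add: mult_op_L2_of cinner_L2_of square_integrable_bounded_borel mult.assoc)

lemma integrable_bounded_borel_mult:
  assumes "bounded_borel \<phi>" "integrable lborel h"
  shows "integrable lborel (\<lambda>x. \<phi> x * h x)"
proof -
  obtain B where B: "\<And>x. norm (\<phi> x) \<le> B" using assms by (auto simp: bounded_borel_def)
  show ?thesis
  proof (rule Bochner_Integration.integrable_bound)
    show "integrable lborel (\<lambda>x. B * norm (h x))" using assms by simp
    show "(\<lambda>x. \<phi> x * h x) \<in> borel_measurable lborel"
      using assms by (intro borel_measurable_times) (auto simp: bounded_borel_def)
    show "AE x in lborel. norm (\<phi> x * h x) \<le> norm (B * norm (h x))"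
    proof (rule AE_I2)
      fix x
      have "norm (\<phi> x * h x) \<le> B * norm (h x)"
        unfolding norm_mult using B by (intro mult_right_mono) auto
      then show "norm (\<phi> x * h x) \<le> norm (B * norm (h x))"
        unfolding real_norm_def by linarith
    qed
  qed
qed

text \<open>The matrix coefficients of the two sides are integrals against integrable functions whose
  Fourier transforms agree by the hypothesis.\<close>

lemma intertwine_mult_op:
  assumes T: "unitary T" and k: "k \<noteq> 0"
    and eq: "\<And>l u. T (modulation l u) = mult_op (\<lambda>x. iexp (l * (k * x + r))) (T u)"
    and \<phi>: "bounded_borel \<phi>"
  shows "T (mult_op \<phi> u) = mult_op (\<lambda>x. \<phi> (k * x + r)) (T u)"
proof (rule cinner_eqI)
  fix v
  obtain f where f: "square_integrable f" "u = L2_of f" by (rule L2_cases)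
  obtain tf where tf: "square_integrable tf" "T u = L2_of tf" by (rule L2_cases)
  obtain g where g: "square_integrable g" "v = L2_of g" by (rule L2_cases)
  obtain tg where tg: "square_integrable tg" "adj T v = L2_of tg" by (rule L2_cases)
  define b where "b x = f x * cnj (tg x)" for x
  define a where "a x = tf x * cnj (g x)" for x
  \<comment> \<open>The function a transported along y = k x + r, with the Jacobian: both matrix
    coefficients become integrals of the same symbol in the variable y.\<close>
  define a' where "a' y = a (- r / k + (1 / k) * y) / of_real \<bar>k\<bar>" for y
  have ia: "integrable lborel a" and ib: "integrable lborel b"
    unfolding a_def b_def using f tf g tg by (auto intro: integrable_cinner)
  have ia': "integrable lborel a'"
    unfolding a'_def
    using lborel_integrable_real_affine[OF ia, of "1 / k" "- r / k"] k by (simp add: divide_inverse)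
  have b_int: "cinner (T (mult_op \<psi> u)) v = (\<integral>x. \<psi> x * b x \<partial>lborel)" if "bounded_borel \<psi>" for \<psi>
    unfolding cinner_adj[OF T] tg(2) f(2) b_def using that f tg by (simp add: cinner_mult_op_L2_of)
  have a_int: "cinner (mult_op (\<lambda>x. \<psi> (k * x + r)) (T u)) v = (\<integral>y. \<psi> y * a' y \<partial>lborel)"
    if "bounded_borel \<psi>" for \<psi>
  proof -
    have "bounded_borel (\<lambda>x. \<psi> (k * x + r))" using that by (rule bounded_borel_comp) measurable
    then have "cinner (mult_op (\<lambda>x. \<psi> (k * x + r)) (T u)) v = (\<integral>x. \<psi> (k * x + r) * a x \<partial>lborel)"
      unfolding tf(2) g(2) a_def using tf g by (simp add: cinner_mult_op_L2_of)
    also have "\<dots> = (\<integral>x. of_real \<bar>k\<bar> * (\<psi> (r + k * x) * a' (r + k * x)) \<partial>lborel)"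
      using k by (intro Bochner_Integration.integral_cong)
        (auto simp: a'_def add_divide_distrib add.commute)
    also have "\<dots> = \<bar>k\<bar> *\<^sub>R (\<integral>x. \<psi> (r + k * x) * a' (r + k * x) \<partial>lborel)"
      by (simp add: scaleR_conv_of_real)
    also have "\<dots> = (\<integral>y. \<psi> y * a' y \<partial>lborel)"
      by (rule lborel_integral_real_affine[symmetric, OF k])
    finally show ?thesis .
  qed
  have "AE x in lborel. b x - a' x = 0"
  proof (rule fourier_uniqueness)
    show "integrable lborel (\<lambda>x. b x - a' x)" using ia' ib by simp
    fix t
    have e: "bounded_borel (\<lambda>x. iexp (t * x))"
      by (rule bounded_borel_exp) measurable
    have "(\<integral>x. (b x - a' x) * iexp (t * x) \<partial>lborel)
        = (\<integral>x. iexp (t * x) * b x - iexp (t * x) * a' x \<partial>lborel)"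
      by (intro Bochner_Integration.integral_cong) (auto simp: algebra_simps)
    also have "\<dots> = (\<integral>x. iexp (t * x) * b x \<partial>lborel) - (\<integral>x. iexp (t * x) * a' x \<partial>lborel)"
      by (intro Bochner_Integration.integral_diff integrable_bounded_borel_mult e ib ia')
    also have "\<dots> = cinner (T (modulation t u)) v - cinner (T (modulation t u)) v"
      using a_int[OF e] b_int[OF e] by (simp only: eq flip: modulation_def)
    finally show "(\<integral>x. (b x - a' x) * iexp (t * x) \<partial>lborel) = 0" by simp
  qed
  then have "AE x in lborel. \<phi> x * b x = \<phi> x * a' x" by eventually_elim simp
  then have "(\<integral>x. \<phi> x * b x \<partial>lborel) = (\<integral>x. \<phi> x * a' x \<partial>lborel)"
    using integrable_bounded_borel_mult[OF \<phi> ib] integrable_bounded_borel_mult[OF \<phi> ia']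
    by (intro integral_cong_AE) auto
  then show "cinner (T (mult_op \<phi> u)) v = cinner (mult_op (\<lambda>x. \<phi> (k * x + r)) (T u)) v"
    by (simp add: a_int b_int \<phi>)
qed

text \<open>Fubini exchanges the exceptional sets: for some fixed x the equation u (x - m) = u x
  holds for almost all m, and x - m runs through the line.\<close>

lemma translation_invariant_AE_const:
  fixes u :: "real \<Rightarrow> complex"
  assumes [measurable]: "u \<in> borel_measurable borel" and inv: "\<And>m. AE x in lborel. u (x - m) = u x"
  shows "\<exists>c. AE x in lborel. u x = c"
proof -
  have "AE m in lborel. AE x in lborel. u (x - m) = u x" using inv by simp
  then have "AE x in lborel. AE m in lborel. u (x - m) = u x"
    by (subst (asm) lborel_pair.AE_commute) measurable
  then have "\<exists>x. AE m in lborel. u (x - m) = u x"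
    by (intro eventually_happens') (auto simp: ae_filter_eq_bot_iff)
  then obtain x where "AE m in lborel. u (x - m) = u x" ..
  from AE_borel_affine[OF _ _ this, of "-1" x] have "AE y in lborel. u y = u x" by simp
  then show ?thesis by blast
qed

text \<open>If \<open>U\<close> commutes with the modulations, then \<open>U\<close> is multiplication by \<open>U g / g\<close>, where \<open>g\<close> is
  the Gaussian; commutation with the translations makes this function constant.\<close>

lemma scalar_if_commutes_weyl:
  assumes U: "unitary U" and mod: "\<And>l u. U (modulation l u) = modulation l (U u)"
    and tr: "\<And>m u. U (weyl 0 m u) = weyl 0 m (U u)"
  shows "\<exists>\<psi>. U = phase \<psi>"
proof -
  obtain h where h: "square_integrable h" "U (gaussian 0) = L2_of h" by (rule L2_cases)
  have [measurable]: "h \<in> borel_measurable borel" using h by (simp add: square_integrable_def)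
  have com: "U (mult_op \<phi> u) = mult_op \<phi> (U u)" if "bounded_borel \<phi>" for \<phi> u
    using intertwine_mult_op[OF U, of 1 0 \<phi> u] mod that by (simp add: modulation_def)
  have g0: "gauss 0 x \<noteq> 0" for x by (simp add: gauss_def)
  have ptw: "AE x in lborel. uf x * gauss 0 x = f x * h x"
    if f: "square_integrable f" and uf: "square_integrable uf" "U (L2_of f) = L2_of uf" for f uf
  proof -
    have [measurable]: "f \<in> borel_measurable borel" using f by (simp add: square_integrable_def)
    \<comment> \<open>On \<open>A n\<close> the quotient of f by the Gaussian is bounded by n, hence
      a symbol to which \<open>com\<close> applies; these sets exhaust the line.\<close>
    define A where "A n x = (norm (f x) \<le> real n * norm (gauss 0 x))" for n x
    have [measurable]: "Measurable.pred borel (A n)" for n unfolding A_def by measurable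
    define \<eta> where "\<eta> n x = (if A n x then 1 else 0 :: complex)" for n x
    define \<phi> where "\<phi> n x = (if A n x then f x / gauss 0 x else 0)" for n x
    have b1: "bounded_borel (\<eta> n)" for n
      unfolding bounded_borel_def \<eta>_def by (auto intro!: exI[of _ 1])
    have b2: "bounded_borel (\<phi> n)" for n
      unfolding bounded_borel_def
    proof
      show "\<phi> n \<in> borel_measurable borel" unfolding \<phi>_def by measurable
      have "norm (\<phi> n x) \<le> real n" for x
        using g0[of x] by (auto simp: \<phi>_def A_def norm_divide divide_le_eq)
      then show "\<exists>B. \<forall>x. norm (\<phi> n x) \<le> B" by blast
    qed
    have "AE x in lborel. \<eta> n x * uf x = \<phi> n x * h x" for n
    proof -
      have "(\<lambda>x. \<eta> n x * f x) = (\<lambda>x. \<phi> n x * gauss 0 x)"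
        using g0 by (auto simp: \<eta>_def \<phi>_def)
      then have "mult_op (\<eta> n) (L2_of f) = mult_op (\<phi> n) (gaussian 0)"
        using b1 b2 f by (simp add: mult_op_L2_of gaussian_def)
      then have "mult_op (\<eta> n) (L2_of uf) = mult_op (\<phi> n) (L2_of h)"
        using com[OF b1, of n "L2_of f"] com[OF b2, of n "gaussian 0"] uf h by simp
      then show ?thesis
        using b1 b2 uf h by (simp add: mult_op_L2_of L2_of_eq_iff square_integrable_bounded_borel)
    qed
    then have "AE x in lborel. \<forall>n. \<eta> n x * uf x = \<phi> n x * h x" by (simp add: AE_all_countable)
    then show ?thesis
    proof eventually_elim
      fix x assume *: "\<forall>n. \<eta> n x * uf x = \<phi> n x * h x"
      obtain n where "norm (f x) / norm (gauss 0 x) \<le> real n" using real_arch_simple by blast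
      then have "A n x" using g0[of x] by (simp add: A_def divide_le_eq)
      with *[rule_format, of n] show "uf x * gauss 0 x = f x * h x"
        using g0[of x] by (simp add: \<eta>_def \<phi>_def)
    qed
  qed
  define w where "w x = h x / gauss 0 x" for x
  have [measurable]: "w \<in> borel_measurable borel" unfolding w_def by measurable
  have "AE x in lborel. w (x - m) = w x" for m
  proof -
    have sq: "square_integrable (\<lambda>x. gauss 0 (x - m))" "square_integrable (\<lambda>x. h (x - m))"
      using square_integrable_affine[of 1 "gauss 0" "- m"] square_integrable_affine[of 1 h "- m"] h
      by simp_all
    have "U (L2_of (\<lambda>x. gauss 0 (x - m))) = L2_of (\<lambda>x. h (x - m))"
      using tr[of m "gaussian 0"] h by (simp add: gaussian_def weyl_L2_of)
    from ptw[OF sq(1) sq(2) this] show ?thesis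
      by eventually_elim (use g0 in \<open>simp add: w_def field_simps\<close>)
  qed
  then obtain c where c: "AE x in lborel. w x = c"
    using translation_invariant_AE_const[of w] by auto
  have Uc: "U u = scaleC c u" for u
  proof -
    obtain f where f: "square_integrable f" "u = L2_of f" by (rule L2_cases)
    obtain uf where uf: "square_integrable uf" "U u = L2_of uf" by (rule L2_cases)
    have "AE x in lborel. uf x = c * f x"
      using ptw[OF f(1) uf(1) uf(2)[unfolded f(2)]] c
      by eventually_elim (use g0 in \<open>auto simp: w_def field_simps\<close>)
    then show ?thesis
      using f uf by (simp add: scaleC_L2_of L2_of_eq_iff square_integrable_cmult)
  qed
  have "norm c = 1"
  proof -
    have "norm (gaussian 0) \<noteq> 0"
      using cinner_gaussian[of 0 0] by auto
    moreover have "norm c * norm (gaussian 0) = norm (gaussian 0)"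
      using unitary_norm[OF U, of "gaussian 0"] by (simp add: Uc)
    ultimately show ?thesis by simp
  qed
  then have "iexp (Arg c) = c" by (simp add: complex_norm_eq_1_exp_eq)
  then have "U = phase (Arg c)"
    by (intro blinfun_eqI) (simp add: Uc phase_apply)
  then show ?thesis by blast
qed

section \<open>The position and momentum nests\<close>

definition ray :: "real \<Rightarrow> real \<Rightarrow> complex" where "ray t x = (if t \<le> x then 1 else 0)"

definition pos_proj :: "real \<Rightarrow> (L2 \<Rightarrow>\<^sub>L L2)" where "pos_proj t = mult_op (ray t)"

text \<open>The ray on the Fourier side. \<open>mom_proj 0\<close> will turn out to be the
  projection onto the Hardy space and \<open>mom_proj t\<close> the one onto its product with exp (i
  t x).\<close>

definition mom_proj :: "real \<Rightarrow> (L2 \<Rightarrow>\<^sub>L L2)" where "mom_proj t = Ad (adj fourier) (pos_proj t)"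

lemma bounded_borel_ray [simp]: "bounded_borel (ray t)"
proof -
  have "ray t \<in> borel_measurable borel" unfolding ray_def by measurable
  moreover have "norm (ray t x) \<le> 1" for x by (simp add: ray_def)
  ultimately show ?thesis by (auto simp: bounded_borel_def)
qed

lemma weyl_mult_op:
  assumes \<phi>: "bounded_borel \<phi>"
  shows "weyl l m (mult_op \<phi> u) = mult_op (\<lambda>x. \<phi> (x - m)) (weyl l m u)"
proof -
  obtain f where f: "square_integrable f" "u = L2_of f" by (rule L2_cases)
  have b: "bounded_borel (\<lambda>x. \<phi> (x - m))" using \<phi> by (rule bounded_borel_comp) measurable
  show ?thesis
    unfolding f(2) using f(1) \<phi> b
    by (simp only: mult_op_L2_of weyl_L2_of square_integrable_bounded_borel square_integrable_weyl
        mult.left_commute)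
qed

lemma unitary_weyl: "unitary (weyl l m)"
proof -
  have "weyl l m (weyl (- l) (- m) f) = f" for f
  proof -
    obtain u where u: "square_integrable u" "f = L2_of u" by (rule L2_cases)
    have "iexp (l * x - l * m / 2) *
        (iexp (- l * (x - m) - (- l) * (- m) / 2) * u (x - m - - m)) = u x" for x
    proof -
      have "iexp (l * x - l * m / 2) *
        iexp (- l * (x - m) - (- l) * (- m) / 2) = 1"
        unfolding exp_add[symmetric] by (simp add: algebra_simps)
      then show ?thesis by (simp add: mult.assoc[symmetric])
    qed
    then show ?thesis
      unfolding u(2) by (simp only: weyl_L2_of square_integrable_weyl u(1))
  qed
  then have s: "weyl l m (weyl (- l) (- m) f) = f" for f by blast
  have aff: "cinner (affine_op 1 t f) (affine_op 1 t g) = cinner f g"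
    "affine_op 1 t (scaleC c f) = scaleC c (affine_op 1 t f)" for t f g c
  proof -
    obtain u where u: "square_integrable u" "f = L2_of u" by (rule L2_cases)
    obtain v where v: "square_integrable v" "g = L2_of v" by (rule L2_cases)
    show "cinner (affine_op 1 t f) (affine_op 1 t g) = cinner f g"
      using u v square_integrable_affine[of 1 u t] square_integrable_affine[of 1 v t]
        lborel_integral_real_affine[of 1 "\<lambda>x. u x * cnj (v x)" t]
      by (simp add: affine_op_L2_of cinner_L2_of)
    show "affine_op 1 t (scaleC c f) = scaleC c (affine_op 1 t f)"
      using u square_integrable_affine[of 1 u t]
      by (simp add: affine_op_L2_of scaleC_L2_of square_integrable_cmult)
  qed
  have m: "unitary (mult_op (\<lambda>x. iexp (l * x - l * m / 2)))"
    by (rule unitary_exp_op) measurable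
  show ?thesis
    by (rule unitaryI[OF _ _ s])
      (simp_all only: weyl_def blinfun_apply_blinfun_compose aff unitary_clinear[OF m]
        unitary_cinner[OF m])
qed

lemma Ad_weyl_pos_proj: "Ad (weyl l m) (pos_proj t) = pos_proj (t + m)"
proof -
  have "(\<lambda>x. ray t (x - m)) = ray (t + m)" by (auto simp: ray_def fun_eq_iff)
  then show ?thesis
    by (simp add: Ad_eq_iff unitary_weyl pos_proj_def weyl_mult_op)
qed

lemma Ad_cong_commute:
  assumes "unitary U" "unitary V" "unitary U'" "unitary V'" "\<And>f. U (V f) = V' (U' f)"
  shows "Ad U (Ad V T) = Ad V' (Ad U' T)"
proof -
  have "U o\<^sub>L V = V' o\<^sub>L U'" by (rule blinfun_eqI) (simp add: assms)
  then show ?thesis using assms by (simp flip: Ad_compose)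
qed

lemma Ad_mult_op_pos_proj:
  assumes "bounded_borel \<phi>" "\<And>x. norm (\<phi> x) = 1"
  shows "Ad (mult_op \<phi>) (pos_proj t) = pos_proj t"
  using assms by (simp add: Ad_eq_iff unitary_mult_op pos_proj_def mult_op_mult mult.commute)

lemma Ad_chirp_pos_proj: "Ad (chirp s) (pos_proj t) = pos_proj t"
  unfolding chirp_eq by (rule Ad_mult_op_pos_proj[OF bounded_borel_exp]) auto

lemma Ad_fourier_mom_proj: "Ad fourier (mom_proj t) = pos_proj t"
  by (simp add: mom_proj_def Ad_adj_right unitary_fourier)

lemma mom_proj_eqI: "Ad fourier T = pos_proj t \<Longrightarrow> T = mom_proj t"
  using Ad_adj_left[OF unitary_fourier, of T] by (simp add: mom_proj_def)

lemma Ad_weyl_mom_proj: "Ad (weyl l m) (mom_proj t) = mom_proj (t + l)"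
proof (rule mom_proj_eqI)
  have "Ad fourier (Ad (weyl l m) (mom_proj t)) = Ad (weyl (- m) l) (Ad fourier (mom_proj t))"
    by (rule Ad_cong_commute) (simp_all add: unitary_fourier unitary_weyl fourier_weyl)
  then show "Ad fourier (Ad (weyl l m) (mom_proj t)) = pos_proj (t + l)"
    by (simp add: Ad_fourier_mom_proj Ad_weyl_pos_proj)
qed

lemma Ad_modulation_mom_proj: "Ad (modulation l) (mom_proj t) = mom_proj (t + l)"
  by (simp add: modulation_eq_weyl Ad_weyl_mom_proj)

text \<open>The hypothesis extends by linearity to step functions, which are combinations of rays.
  Step functions on finer and finer grids converge boundedly to exp (i l x), so both sides converge
  strongly. This is a counterpart of \<open>intertwine_mult_op\<close>, which starts from
  modulations.\<close>

lemma intertwine_modulation_if_intertwine_pos_proj: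
  assumes U: "unitary U" and \<gamma> [measurable]: "\<gamma> \<in> borel_measurable borel"
    and pos_proj: "\<And>t u. U (pos_proj t u) = mult_op (\<lambda>x. ray t (\<gamma> x)) (U u)"
  shows "U (modulation l u) = mult_op (\<lambda>x. iexp (l * \<gamma> x)) (U u)"
proof -
  define P where "P \<phi> \<longleftrightarrow> bounded_borel \<phi> \<and> (\<forall>u. U (mult_op \<phi> u) = mult_op (\<lambda>x. \<phi> (\<gamma> x)) (U u))" for \<phi>
  have Pray: "P (ray t)" for t using pos_proj by (simp add: P_def pos_proj_def)
  have Padd: "P (\<lambda>x. \<phi> x + \<psi> x)" if "P \<phi>" "P \<psi>" for \<phi> \<psi>
    using that unfolding P_def
    by (auto simp: mult_op_add bounded_borel_add bounded_borel_comp blinfun.add_right)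
  have Pscale: "P (\<lambda>x. c * \<phi> x)" if "P \<phi>" for c \<phi>
  proof -
    have b: "bounded_borel \<phi>" "bounded_borel (\<lambda>x. \<phi> (\<gamma> x))"
      using that by (auto simp: P_def bounded_borel_comp)
    have "mult_op (\<lambda>x. c * \<psi> x) u = scaleC c (mult_op \<psi> u)" if "bounded_borel \<psi>" for \<psi> u
      using mult_op_mult[of "\<lambda>_. c" \<psi> u] that by (simp add: mult_op_const)
    then show ?thesis
      using that b unfolding P_def by (auto simp: unitary_clinear[OF U] bounded_borel_mult)
  qed
  have Psum: "P (\<lambda>x. \<Sum>k\<in>S. c k * (ray (a k) x + (-1) * ray (b k) x))"
    if "finite S" for S :: "int set" and c a b
    using that
  proof induction
    case empty
    show ?case using Pscale[OF Pray, of 0 0] by simp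
  next
    case (insert k S)
    show ?case
      unfolding sum.insert[OF insert.hyps]
      by (intro Padd Pscale Pray insert.IH)
  qed
  \<comment> \<open>The grid points k / n with k in \<open>S n\<close> fill [- n, n): the mesh tends
    to 0 while the cut-off tends to infinity.\<close>
  define S where "S n = {- (int n * int n) ..< int n * int n}" for n
  define \<phi> where "\<phi> n x = (\<Sum>k\<in>S n. iexp (l * (of_int k / real n)) *
      (ray (of_int k / real n) x + (-1) * ray (of_int (k + 1) / real n) x))" for n x
  have \<phi>_eq: "\<phi> n x = (if \<lfloor>real n * x\<rfloor> \<in> S n then iexp (l * (of_int \<lfloor>real n * x\<rfloor> / real n)) else 0)"
    if "n > 0" for n x
  proof -
    \<comment> \<open>A difference of two neighbouring rays is the indicator of [k / n, (k + 1) /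
      n), so exactly one summand survives at x.\<close>
    have "ray (of_int k / real n) x + (-1) * ray (of_int (k + 1) / real n) x
        = (if k = \<lfloor>real n * x\<rfloor> then 1 else 0)" for k
    proof -
      have "of_int k / real n \<le> x \<longleftrightarrow> of_int k \<le> real n * x"
        using that by (simp add: divide_le_eq mult.commute)
      moreover have "of_int (k + 1) / real n \<le> x \<longleftrightarrow> of_int k + 1 \<le> real n * x"
        using that by (simp add: divide_le_eq mult.commute)
      moreover have "k = \<lfloor>real n * x\<rfloor> \<longleftrightarrow> of_int k \<le> real n * x \<and> \<not> of_int k + 1 \<le> real n * x"
        by linarith
      ultimately show ?thesis by (auto simp: ray_def)
    qed
    then have "\<phi> n x = (\<Sum>k\<in>S n. if k = \<lfloor>real n * x\<rfloor> then iexp (l * (of_int k / real n)) else 0)"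
      unfolding \<phi>_def by (intro sum.cong) auto
    also have "\<dots> = (if \<lfloor>real n * x\<rfloor> \<in> S n then iexp (l * (of_int \<lfloor>real n * x\<rfloor> / real n)) else 0)"
      by (subst sum.delta) (auto simp: S_def)
    finally show ?thesis .
  qed
  have P\<phi>: "P (\<phi> n)" for n unfolding \<phi>_def by (rule Psum) (simp add: S_def)
  have n\<phi>: "norm (\<phi> (Suc n) x) \<le> 1" for n x by (simp add: \<phi>_eq)
  have lim: "(\<lambda>n. \<phi> (Suc n) x) \<longlonglongrightarrow> iexp (l * x)" for x
  proof -
    have "(\<lambda>n. of_int \<lfloor>real (Suc n) * x\<rfloor> / real (Suc n)) \<longlonglongrightarrow> x"
    proof (rule real_tendsto_sandwich)
      show "(\<lambda>n. x - inverse (real (Suc n))) \<longlonglongrightarrow> x"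
        using tendsto_diff[OF tendsto_const LIMSEQ_inverse_real_of_nat, of x] by simp
      have fl: "(real (Suc n) * x - 1) / real (Suc n) \<le> of_int \<lfloor>real (Suc n) * x\<rfloor> / real (Suc n)"
        "of_int \<lfloor>real (Suc n) * x\<rfloor> / real (Suc n) \<le> (real (Suc n) * x) / real (Suc n)" for n
        by (intro divide_right_mono; linarith)+
      show "\<forall>\<^sub>F n in sequentially. x - inverse (real (Suc n))
          \<le> of_int \<lfloor>real (Suc n) * x\<rfloor> / real (Suc n)"
        using fl(1) by (intro always_eventually allI)
          (simp add: diff_divide_distrib inverse_eq_divide del: of_nat_Suc)
      show "\<forall>\<^sub>F n in sequentially. of_int \<lfloor>real (Suc n) * x\<rfloor> / real (Suc n) \<le> x"
        using fl(2) by (intro always_eventually allI) (simp del: of_nat_Suc)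
    qed (rule tendsto_const)
    then have "(\<lambda>n. iexp (l * (of_int \<lfloor>real (Suc n) * x\<rfloor> / real (Suc n)))) \<longlonglongrightarrow> iexp (l * x)"
      by (intro tendsto_intros)
    moreover have "\<forall>\<^sub>F n in sequentially. iexp (l * (of_int \<lfloor>real (Suc n) * x\<rfloor> / real (Suc n)))
        = \<phi> (Suc n) x"
    proof -
      obtain N where N: "\<bar>x\<bar> + 1 \<le> real N" using real_arch_simple by blast
      have "\<lfloor>real (Suc n) * x\<rfloor> \<in> S (Suc n)" if "n \<ge> N" for n
      proof -
        have "\<bar>x\<bar> + 1 \<le> real (Suc n)" using N that by simp
        then have "- real (Suc n) \<le> x" "x < real (Suc n)" by linarith+
        then have "real (Suc n) * x < real (Suc n) * real (Suc n)"
          "real (Suc n) * - real (Suc n) \<le> real (Suc n) * x"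
          by (intro mult_strict_left_mono mult_left_mono; simp)+
        then show ?thesis
          unfolding S_def by (simp add: floor_less_iff le_floor_iff del: of_nat_Suc)
      qed
      then show ?thesis
        by (intro eventually_sequentiallyI[of N]) (simp add: \<phi>_eq)
    qed
    ultimately show ?thesis by (rule Lim_transform_eventually)
  qed
  have "(\<lambda>n. mult_op (\<phi> (Suc n)) u) \<longlonglongrightarrow> modulation l u"
    unfolding modulation_def
    by (rule mult_op_tendsto[where B = 1])
      (use P\<phi> n\<phi> lim in \<open>auto simp: P_def bounded_borel_def intro!: bounded_borel_exp\<close>)
  then have "(\<lambda>n. U (mult_op (\<phi> (Suc n)) u)) \<longlonglongrightarrow> U (modulation l u)"
    by (rule blinfun.tendsto[OF tendsto_const])
  moreover have "(\<lambda>n. U (mult_op (\<phi> (Suc n)) u)) \<longlonglongrightarrow> mult_op (\<lambda>x. iexp (l * \<gamma> x)) (U u)"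
  proof -
    have "U (mult_op (\<phi> (Suc n)) u) = mult_op (\<lambda>x. \<phi> (Suc n) (\<gamma> x)) (U u)" for n
      using P\<phi> by (simp add: P_def)
    moreover have "(\<lambda>n. mult_op (\<lambda>x. \<phi> (Suc n) (\<gamma> x)) (U u)) \<longlonglongrightarrow> mult_op (\<lambda>x. iexp (l * \<gamma> x)) (U u)"
    proof (rule mult_op_tendsto[where B = 1])
      show "(\<lambda>x. \<phi> (Suc n) (\<gamma> x)) \<in> borel_measurable borel" for n
        using P\<phi>[of "Suc n"] by (auto simp: P_def bounded_borel_def intro: measurable_compose[OF \<gamma>])
      show "bounded_borel (\<lambda>x. iexp (l * \<gamma> x))"
        by (rule bounded_borel_exp) measurable
      show "AE x in lborel. (\<lambda>n. \<phi> (Suc n) (\<gamma> x)) \<longlonglongrightarrow> iexp (l * \<gamma> x)"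
        using lim by simp
    qed (rule n\<phi>)
    ultimately show ?thesis by simp
  qed
  ultimately show ?thesis by (rule LIMSEQ_unique)
qed

text \<open>Modulations carry \<open>mom_proj 0\<close> to every \<open>mom_proj l\<close>, so U
  fixes the whole momentum nest. Seen through the Fourier transform it fixes the position nest, thus
  commutes with modulations there, which means that U itself commutes with translations.\<close>

lemma scalar_if_commutes_mom_proj:
  assumes U: "unitary U" and mod: "\<And>l u. U (modulation l u) = modulation l (U u)"
    and fixed: "Ad U (mom_proj 0) = mom_proj 0"
  shows "\<exists>\<psi>. U = phase \<psi>"
proof -
  have AdQ: "Ad U (mom_proj l) = mom_proj l" for l
  proof -
    have "Ad U (Ad (modulation l) (mom_proj 0)) = Ad (modulation l) (Ad U (mom_proj 0))"
      by (rule Ad_cong_commute) (simp_all add: U unitary_modulation mod)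
    then show ?thesis by (simp add: Ad_modulation_mom_proj fixed)
  qed
  define V where "V = fourier o\<^sub>L U o\<^sub>L adj fourier"
  have V: "unitary V" unfolding V_def by (intro unitary_compose unitary_fourier unitary_adj U)
  have VF: "V (fourier f) = fourier (U f)" for f
    by (simp add: V_def unitary_adj_left[OF unitary_fourier])
  have "Ad V (pos_proj t) = pos_proj t" for t
  proof -
    have "Ad V (pos_proj t) = Ad fourier (Ad U (mom_proj t))"
      unfolding V_def mom_proj_def
        by (simp add: Ad_compose unitary_compose unitary_fourier unitary_adj U)
    then show ?thesis by (simp add: AdQ Ad_fourier_mom_proj)
  qed
  then have "V (pos_proj t u) = mult_op (\<lambda>x. ray t x) (V u)" for t u
    using V by (simp add: Ad_eq_iff pos_proj_def)
  then have Vmod: "V (modulation l u) = modulation l (V u)" for l u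
    using intertwine_modulation_if_intertwine_pos_proj[OF V, of "\<lambda>x. x" l u]
      by (simp add: modulation_def)
  have "U (weyl 0 m u) = weyl 0 m (U u)" for m u
  proof (rule unitary_inj[OF unitary_fourier])
    have "fourier (U (weyl 0 m u)) = V (weyl (- m) 0 (fourier u))"
      by (simp add: VF[symmetric] fourier_weyl)
    also have "\<dots> = weyl (- m) 0 (V (fourier u))"
      using Vmod[of "- m"] by (simp add: modulation_eq_weyl)
    also have "\<dots> = fourier (weyl 0 m (U u))"
      by (simp add: VF fourier_weyl)
    finally show "fourier (U (weyl 0 m u)) = fourier (weyl 0 m (U u))" .
  qed
  with U mod show ?thesis by (rule scalar_if_commutes_weyl)
qed

section \<open>The Hardy space\<close>

text \<open>Integrating \<open>D (x + 1) - D x = \<integral>\<^bsub>[0,1]\<^esub> d (x + s) ds\<close> over the line gives \<open>0\<close> on the left.\<close>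

lemma integral_derivative_eq_0:
  fixes D d :: "real \<Rightarrow> complex"
  assumes D: "integrable lborel D" and d: "integrable lborel d" "continuous_on UNIV d"
    and deriv: "\<And>x. (D has_vector_derivative d x) (at x)"
  shows "(\<integral>x. d x \<partial>lborel) = 0"
proof -
  have [measurable]: "d \<in> borel_measurable borel" using d by simp
  define K where "K s x = indicator {0..1} s *\<^sub>R d (x + s)" for s x :: real
  have Km [measurable]: "case_prod K \<in> borel_measurable (lborel \<Otimes>\<^sub>M lborel)"
    unfolding K_def by measurable
  have shift: "integrable lborel (\<lambda>x. f (x + s))" "(\<integral>x. f (x + s) \<partial>lborel) = (\<integral>x. f x \<partial>lborel)"
    if "integrable lborel f" for f :: "real \<Rightarrow> 'b :: {banach, second_countable_topology}" and s
    using lborel_integrable_real_affine[OF that, of 1 s] lborel_integral_real_affine[of 1 f s]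
    by (simp_all add: add.commute)
  have nK: "(\<integral>x. norm (K s x) \<partial>lborel) = indicator {0..1} s * (\<integral>x. norm (d x) \<partial>lborel)" for s
    using shift(2)[OF integrable_norm[OF d(1)], of s] by (simp add: K_def)
  have iK: "(\<integral>x. K s x \<partial>lborel) = indicator {0..1} s *\<^sub>R (\<integral>x. d x \<partial>lborel)" for s
    using shift(2)[OF d(1), of s] by (simp add: K_def)
  have "integrable (lborel \<Otimes>\<^sub>M lborel) (case_prod K)"
  proof (rule lborel_pair.Fubini_integrable)
    show "integrable lborel (\<lambda>s. \<integral>x. norm (case_prod K (s, x)) \<partial>lborel)"
      by (simp add: nK)
    show "AE s in lborel. integrable lborel (\<lambda>x. case_prod K (s, x))"
      using shift(1)[OF d(1)] by (auto simp: K_def)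
  qed measurable
  then have "(\<integral>x. (\<integral>s. K s x \<partial>lborel) \<partial>lborel) = (\<integral>s. (\<integral>x. K s x \<partial>lborel) \<partial>lborel)"
    by (rule lborel_pair.Fubini_integral)
  also have "\<dots> = (\<integral>x. d x \<partial>lborel)" by (simp add: iK)
  finally have "(\<integral>x. (\<integral>s. K s x \<partial>lborel) \<partial>lborel) = (\<integral>x. d x \<partial>lborel)" .
  moreover have "(\<integral>s. K s x \<partial>lborel) = D (x + 1) - D x" for x
  proof -
    have "(\<integral>s. K s x \<partial>lborel) = D (x + 1) - D (x + 0)"
      unfolding K_def
    proof (rule integral_FTC_atLeastAtMost)
      show "((\<lambda>s. D (x + s)) has_vector_derivative d (x + s)) (at s within {0..1})" for s
      proof (rule has_vector_derivative_at_within)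
        have "((\<lambda>s. x + s) has_vector_derivative 1) (at s)"
          using has_vector_derivative_add[OF has_vector_derivative_const has_vector_derivative_id]
            by simp
        from vector_diff_chain_at[OF this deriv[of "x + s"]]
        show "((\<lambda>s. D (x + s)) has_vector_derivative d (x + s)) (at s)" by (simp add: o_def)
      qed
      show "continuous_on {0..1} (\<lambda>s. d (x + s))"
        by (rule continuous_on_compose2[OF d(2)]) (auto intro!: continuous_intros)
    qed simp
    then show ?thesis by simp
  qed
  ultimately have "(\<integral>x. D (x + 1) - D x \<partial>lborel) = (\<integral>x. d x \<partial>lborel)" by simp
  then show ?thesis
    using shift[OF D, of 1] D by (simp add: Bochner_Integration.integral_diff)
qed

text \<open>A contour argument on rectangles would need the vertical sides to vanish at infinity.
  Instead a primitive on the half-plane is used: its increment D across the strip is integrable by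
  Tonelli, being a vertical integral of h, and the derivative of D, which is the difference of h on
  the two lines, then has integral 0.\<close>

lemma horizontal_integral_eq:
  fixes h :: "complex \<Rightarrow> complex"
  assumes h: "h holomorphic_on {z. Im z > c}" and y: "c < y1" "y1 \<le> y2"
    and int: "\<And>y. y1 \<le> y \<Longrightarrow> integrable lborel (\<lambda>x. h (Complex x y))"
    and bnd: "\<And>y. y1 \<le> y \<Longrightarrow> (\<integral>x. norm (h (Complex x y)) \<partial>lborel) \<le> B"
  shows "(\<integral>x. h (Complex x y1) \<partial>lborel) = (\<integral>x. h (Complex x y2) \<partial>lborel)"
proof -
  have op: "open {z. Im z > c}" by (rule open_halfspace_Im_gt)
  have conv: "convex {z. Im z > c}" by (rule convex_halfspace_Im_gt)
  obtain \<Phi> where \<Phi>': "\<And>z. z \<in> {z. Im z > c}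
      \<Longrightarrow> (\<Phi> has_field_derivative h z) (at z within {z. Im z > c})"
    by (rule holomorphic_convex_primitive'[OF conv op h]) (rule that, assumption)
  have \<Phi>: "(\<Phi> has_field_derivative h z) (at z)" if "Im z > c" for z
    using \<Phi>'[of z] that by (simp add: at_within_open[OF _ op])
  have hc: "continuous_on {z. Im z > c} h" using h by (rule holomorphic_on_imp_continuous_on)
  have cont: "continuous_on S (\<lambda>t. h (Complex (f t) (g t)))"
    if "continuous_on S f" "continuous_on S g" "\<And>t. t \<in> S \<Longrightarrow> g t > c"
      for f g :: "'b :: topological_space \<Rightarrow> real" and S
    by (rule continuous_on_compose2[OF hc])
      (use that in \<open>auto simp: Complex_eq intro!: continuous_intros\<close>)
  have dx: "((\<lambda>x. \<Phi> (Complex x y)) has_vector_derivative h (Complex x y)) (at x)" if "y > c" for x y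
  proof -
    have "((\<lambda>x. Complex x y) has_vector_derivative 1) (at x)"
      unfolding Complex_eq
        by (rule has_vector_derivative_real_field) (auto intro!: derivative_eq_intros)
    from field_vector_diff_chain_at[OF this \<Phi>] that show ?thesis by (simp add: o_def)
  qed
  have dy: "((\<lambda>y. \<Phi> (Complex x y)) has_vector_derivative \<i> * h (Complex x y)) (at y)" if "y > c"
    for x y
  proof -
    have "((\<lambda>y. Complex x y) has_vector_derivative \<i>) (at y)"
      unfolding Complex_eq
        by (rule has_vector_derivative_real_field) (auto intro!: derivative_eq_intros)
    from field_vector_diff_chain_at[OF this \<Phi>] that show ?thesis by (simp add: o_def)
  qed
  define D where "D x = \<Phi> (Complex x y2) - \<Phi> (Complex x y1)" for x
  define d where "d x = h (Complex x y2) - h (Complex x y1)" for x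
  have Dd: "(D has_vector_derivative d x) (at x)" for x
    unfolding D_def d_def using y by (intro has_vector_derivative_diff dx) auto
  have D_int: "D x = (\<integral>y. indicator {y1..y2} y *\<^sub>R (\<i> * h (Complex x y)) \<partial>lborel)" for x
    unfolding D_def
  proof (rule integral_FTC_atLeastAtMost[symmetric])
    show "((\<lambda>y. \<Phi> (Complex x y)) has_vector_derivative \<i> * h (Complex x y)) (at y within {y1..y2})"
      if "y1 \<le> y" for y
      using that y by (intro has_vector_derivative_at_within[OF dy]) simp
    show "continuous_on {y1..y2} (\<lambda>y. \<i> * h (Complex x y))"
      using y by (intro continuous_intros cont) auto
  qed (rule y)
  \<comment> \<open>Cut off to the closed strip, because h is only known to be continuous above
    height c and joint measurability is needed everywhere.\<close>
  define k where "k x y = indicator {y1..y2} y *\<^sub>R h (Complex x y)" for x y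
  have km: "(\<lambda>p. k (fst p) (snd p)) \<in> borel_measurable borel"
  proof -
    have "(\<lambda>p. indicator (UNIV \<times> {y1..y2}) p *\<^sub>R h (Complex (fst p) (snd p)))
        \<in> borel_measurable borel"
    proof (rule borel_measurable_continuous_on_indicator)
      show "UNIV \<times> {y1..y2} \<in> sets (borel :: (real \<times> real) measure)"
        by (intro borel_closed closed_Times) auto
      show "continuous_on (UNIV \<times> {y1..y2}) (\<lambda>p. h (Complex (fst p) (snd p)))"
        using y by (intro cont continuous_intros) auto
    qed
    moreover have "indicator (UNIV \<times> {y1..y2}) p *\<^sub>R h (Complex (fst p) (snd p))
        = k (fst p) (snd p)" for p
      by (cases p) (auto simp: k_def indicator_def)
    ultimately show ?thesis by simp
  qed
  then have km' [measurable]: "case_prod k \<in> borel_measurable (lborel \<Otimes>\<^sub>M lborel)"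
    by (simp add: lborel_prod case_prod_unfold)
  have D_le: "ennreal (norm (D x)) \<le> (\<integral>\<^sup>+y. ennreal (norm (k x y)) \<partial>lborel)" for x
  proof -
    have "D x = (\<integral>y. \<i> * k x y \<partial>lborel)" unfolding D_int k_def by simp
    then have "norm (D x) = norm (\<integral>y. k x y \<partial>lborel)" by (simp add: norm_mult)
    then show ?thesis using integral_norm_bound_ennreal[of lborel "k x"]
    proof (cases "integrable lborel (k x)")
      \<comment> \<open>The Bochner integral of a non-integrable function is 0 by convention, so the
        bound holds here without excluding the case.\<close>
      case False
      then have "D x = 0"
        using \<open>norm (D x) = norm (\<integral>y. k x y \<partial>lborel)\<close> by (simp add: not_integrable_integral_eq)
      then show ?thesis by simp
    qed simp
  qed
  have Dc: "continuous_on UNIV D"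
    using Dd by (auto simp: continuous_on_eq_continuous_within intro:
      has_vector_derivative_continuous)
  have iD: "integrable lborel D"
  proof (rule integrableI_bounded)
    show "D \<in> borel_measurable lborel" using Dc by (simp add: borel_measurable_continuous_onI)
    have "(\<integral>\<^sup>+x. ennreal (norm (D x)) \<partial>lborel)
        \<le> (\<integral>\<^sup>+x. (\<integral>\<^sup>+y. ennreal (norm (k x y)) \<partial>lborel) \<partial>lborel)"
      by (intro nn_integral_mono D_le)
    also have "\<dots> = (\<integral>\<^sup>+y. (\<integral>\<^sup>+x. ennreal (norm (k x y)) \<partial>lborel) \<partial>lborel)"
      by (rule lborel_pair.Fubini'[symmetric]) measurable
    also have "\<dots> \<le> (\<integral>\<^sup>+y. ennreal B * indicator {y1..y2} y \<partial>lborel)"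
    proof (intro nn_integral_mono)
      fix y
      show "(\<integral>\<^sup>+x. ennreal (norm (k x y)) \<partial>lborel) \<le> ennreal B * indicator {y1..y2} y"
      proof (cases "y \<in> {y1..y2}")
        case True
        then have "(\<integral>\<^sup>+x. ennreal (norm (k x y)) \<partial>lborel)
            = ennreal (\<integral>x. norm (h (Complex x y)) \<partial>lborel)"
          using int[of y] by (subst nn_integral_eq_integral[symmetric]) (auto simp: k_def)
        also have "\<dots> \<le> ennreal B" using bnd[of y] True by (intro ennreal_leI) auto
        finally show ?thesis using True by simp
      qed (simp add: k_def)
    qed
    also have "\<dots> < \<infinity>"
      using y(2) by (subst nn_integral_cmult_indicator) (auto simp: ennreal_mult_less_top)
    finally show "(\<integral>\<^sup>+x. ennreal (norm (D x)) \<partial>lborel) < \<infinity>" .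
  qed
  have "(\<integral>x. d x \<partial>lborel) = 0"
  proof (rule integral_derivative_eq_0[OF iD _ _ Dd])
    show "integrable lborel d" unfolding d_def using int y by auto
    show "continuous_on UNIV d" unfolding d_def using y by (intro continuous_intros cont) auto
  qed
  then show ?thesis
    unfolding d_def using int y by (subst (asm) Bochner_Integration.integral_diff) auto
qed

section \<open>One-sided exponentials and Cauchy kernels\<close>

lemma integral_exp_ray:
  assumes a: "Re a > 0"
  shows "integrable lborel (\<lambda>x. indicator {0<..} x *\<^sub>R exp (- a * complex_of_real x))"
    and "(\<integral>x. indicator {0<..} x *\<^sub>R exp (- a * complex_of_real x) \<partial>lborel) = 1 / a"
proof -
  have s: "set_integrable lborel {0<..} (\<lambda>x. exp (- a * complex_of_real x))"
    unfolding set_integrable_def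
  proof (rule Bochner_Integration.integrable_bound)
    show "integrable lborel (\<lambda>x. indicator {0<..} x *\<^sub>R exp (- (x * Re a)))"
      using integrable_I0i_exp_mscale[OF a] unfolding set_integrable_def .
  qed (auto simp: indicator_def mult.commute)
  then show "integrable lborel (\<lambda>x. indicator {0<..} x *\<^sub>R exp (- a * complex_of_real x))"
    by (simp add: set_integrable_def)
  have a0: "a \<noteq> 0" using a by auto
  have "(LBINT x=0..\<infinity>. exp (- a * complex_of_real x)) = 0 - (- (1 / a))"
  proof (rule interval_integral_FTC_integrable[where F = "\<lambda>x. - exp (- a * complex_of_real x) / a"])
    have "((\<lambda>z. - exp (- a * z) / a) has_field_derivative exp (- a * z)) (at z)" for z
      using a0 by (auto intro!: derivative_eq_intros)
    from has_vector_derivative_real_field[OF this]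
    show "((\<lambda>x. - exp (- a * complex_of_real x) / a) has_vector_derivative exp (- a
        * complex_of_real x)) (at x)" for x .
    show "isCont (\<lambda>x. exp (- a * complex_of_real x)) x" for x by (intro continuous_intros)
    show "set_integrable lborel (einterval 0 \<infinity>) (\<lambda>x. exp (- a * complex_of_real x))"
      using s by (simp add: zero_ereal_def)
    have "((\<lambda>x. - exp (- a * complex_of_real x) / a)
        \<longlongrightarrow> - exp (- a * complex_of_real 0) / a) (at_right 0)"
      using a0 by (intro tendsto_intros) auto
    then show "(((\<lambda>x. - exp (- a * complex_of_real x) / a) \<circ> real_of_ereal)
        \<longlongrightarrow> - (1 / a)) (at_right 0)"
      by (simp add: zero_ereal_def ereal_tendsto_simps)
    have "((\<lambda>x. exp (- (Re a * x)) / norm a) \<longlongrightarrow> 0 / norm a) at_top"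
    proof (rule tendsto_divide)
      have "filterlim (\<lambda>x. - (Re a * x)) at_bot at_top"
        using a by (intro filterlim_uminus_at_bot_at_top[THEN filterlim_compose]
            filterlim_tendsto_pos_mult_at_top[OF tendsto_const] filterlim_ident)
      then show "((\<lambda>x. exp (- (Re a * x))) \<longlongrightarrow> 0) at_top"
        by (rule filterlim_compose[OF exp_at_bot])
    qed (use a0 in auto)
    then have "((\<lambda>x. norm (- exp (- a * complex_of_real x) / a)) \<longlongrightarrow> 0) at_top"
      by (simp add: norm_divide)
    then show "(((\<lambda>x. - exp (- a * complex_of_real x) / a) \<circ> real_of_ereal) \<longlongrightarrow> 0) (at_left \<infinity>)"
      unfolding ereal_tendsto_simps by (rule tendsto_norm_zero_cancel)
  qed auto
  then show "(\<integral>x. indicator {0<..} x *\<^sub>R exp (- a * complex_of_real x) \<partial>lborel) = 1 / a"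
    by (simp add: interval_lebesgue_integral_0_infty set_lebesgue_integral_def)
qed

lemma square_integrable_exp_ray:
  assumes "Re a > 0"
  shows "square_integrable (\<lambda>x. indicator {0<..} x *\<^sub>R exp (- a * complex_of_real x))"
proof -
  have "(\<lambda>x. (norm (indicator {0<..} x *\<^sub>R exp (- a * complex_of_real x)))\<^sup>2)
      = (\<lambda>x. indicator {0<..} x *\<^sub>R exp (- (x * (2 * Re a))))"
    by (auto simp: fun_eq_iff indicator_def power2_eq_square simp flip: exp_add)
  then show ?thesis
    unfolding square_integrable_def using integrable_I0i_exp_mscale[of "2 * Re a"] assms
    by (simp add: set_integrable_def)
qed


text \<open>Its Fourier transform is a multiple of the Cauchy kernel 1 / (x + q - i), whose
  conjugate is analytic in the upper half plane. Varying q multiplies the test function by a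
  character, which makes Fourier uniqueness applicable.\<close>

definition cauchy_test :: "real \<Rightarrow> real \<Rightarrow> complex" where
  "cauchy_test q x = indicator {0<..} x *\<^sub>R exp (- (1 + \<i> * of_real q) * complex_of_real x)"

lemma square_integrable_cauchy_test: "square_integrable (cauchy_test q)"
  unfolding cauchy_test_def[abs_def] by (rule square_integrable_exp_ray) simp

lemma fourier_cauchy_test:
  "fourier (L2_of (cauchy_test q)) =
    L2_of (\<lambda>x. of_real (1 / sqrt (2 * pi)) * (1 / (1 + \<i> * of_real q + \<i> * of_real x)))"
  "square_integrable (\<lambda>x. of_real (1 / sqrt (2 * pi)) * (1 / (1 + \<i> * of_real q + \<i> * of_real x)))"
proof -
  have i: "integrable lborel (cauchy_test q)"
    unfolding cauchy_test_def[abs_def] by (rule integral_exp_ray) simp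
  have "fourier_integral (cauchy_test q) x
      = of_real (1 / sqrt (2 * pi)) * (1 / (1 + \<i> * of_real q + \<i> * of_real x))" for x
  proof -
    have "cauchy_test q y * exp (- \<i> * complex_of_real (x * y))
        = indicator {0<..} y *\<^sub>R exp
          (- (1 + \<i> * of_real q + \<i> * of_real x) * complex_of_real y)" for y
      unfolding cauchy_test_def mult_scaleR_left exp_add[symmetric]
      by (intro arg_cong2[where f = scaleR] arg_cong[where f = exp] refl) (simp add: algebra_simps)
    then show ?thesis
      unfolding fourier_integral_def by (simp only:) (subst integral_exp_ray(2), simp_all)
  qed
  then have "fourier_integral (cauchy_test q)
      = (\<lambda>x. of_real (1 / sqrt (2 * pi)) * (1 / (1 + \<i> * of_real q + \<i> * of_real x)))"
    by (rule ext)
  with fourier_integral[OF square_integrable_cauchy_test i]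
  show "fourier (L2_of (cauchy_test q)) =
    L2_of (\<lambda>x. of_real (1 / sqrt (2 * pi)) * (1 / (1 + \<i> * of_real q + \<i> * of_real x)))"
    "square_integrable (\<lambda>x. of_real (1 / sqrt (2 * pi))
        * (1 / (1 + \<i> * of_real q + \<i> * of_real x)))"
    by simp_all
qed

lemma integrable_inverse_square_shift: "integrable lborel (\<lambda>x::real. inverse (1 + (x + q)\<^sup>2))"
proof -
  have "integrable lborel (\<lambda>x::real. inverse (1 + x\<^sup>2))"
    using integrable_inverse_1_plus_square by (simp add: set_integrable_def)
  from lborel_integrable_real_affine[OF this, of 1 q] show ?thesis by (simp add: add.commute)
qed

text \<open>Against the Cauchy kernel \<open>h\<close>, the line of integration can be moved to infinity, where
  the kernel vanishes in mean square.\<close>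

lemma hardy_line_orthogonal:
  assumes G: "G holomorphic_on {z. Im z > 0}"
    and sq: "\<And>y. y > 0 \<Longrightarrow> square_integrable (\<lambda>x. G (Complex x y))"
    and C: "\<And>y. y > 0 \<Longrightarrow> (\<integral>x. (norm (G (Complex x y)))\<^sup>2 \<partial>lborel) \<le> C"
    and y: "y > 0"
  shows "cinner (L2_of (\<lambda>x. G (Complex x y))) (fourier (L2_of (cauchy_test q))) = 0"
proof -
  \<comment> \<open>\<open>r A\<close> is the conjugated kernel at height A above its pole, and w a
    square-integrable majorant common to all A \<ge> 1.\<close>
  define r where "r A x = 1 / (of_real (x + q) + \<i> * of_real A)" for A x :: real
  define w where "w x = sqrt (inverse (1 + (x + q)\<^sup>2))" for x
  define h where "h z = G z / (z - \<i> * of_real y + of_real q + \<i>)" for z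
  have w2: "(w x)\<^sup>2 = inverse (1 + (x + q)\<^sup>2)" for x by (simp add: w_def)
  have iw: "integrable lborel (\<lambda>x. (w x)\<^sup>2)" unfolding w2 by (rule integrable_inverse_square_shift)
  have nz: "of_real (x + q) + \<i> * of_real A \<noteq> 0" if "A \<ge> 1" for x A :: real
    using that by (auto simp: complex_eq_iff)
  have r_le: "norm (r A x) \<le> w x" "norm (r A x) \<le> 1 / A" if A: "A \<ge> 1" for A x
  proof -
    have n: "norm (of_real (x + q) + \<i> * of_real A) = sqrt ((x + q)\<^sup>2 + A\<^sup>2)"
      by (simp add: cmod_def)
    have "1 \<le> A\<^sup>2" using A by (simp add: one_le_power)
    then have "sqrt (1 + (x + q)\<^sup>2) \<le> sqrt ((x + q)\<^sup>2 + A\<^sup>2)" by simp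
    moreover have "0 < sqrt (1 + (x + q)\<^sup>2)" by (simp add: add_pos_nonneg)
    ultimately show "norm (r A x) \<le> w x"
      unfolding r_def norm_divide n w_def real_sqrt_inverse
      by (simp add: inverse_eq_divide frac_le)
    have "A \<le> sqrt ((x + q)\<^sup>2 + A\<^sup>2)" by (rule real_le_rsqrt) simp
    then show "norm (r A x) \<le> 1 / A"
      unfolding r_def norm_divide n using A by (simp add: frac_le)
  qed
  have [measurable]: "r A \<in> borel_measurable borel" for A unfolding r_def by measurable
  have sr: "square_integrable (r A)" if "A \<ge> 1" for A
    unfolding square_integrable_def
  proof (intro conjI Bochner_Integration.integrable_bound[OF iw])
    show "AE x in lborel. norm ((norm (r A x))\<^sup>2) \<le> norm ((w x)\<^sup>2)"
      using r_le(1)[OF that] by (intro AE_I2) (simp add: power_mono)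
  qed measurable
  have hr: "h (Complex x Y) = G (Complex x Y) * r (Y - y + 1) x" for x Y
  proof -
    have "Complex x Y - \<i> * of_real y + of_real q + \<i> = of_real (x + q) + \<i> * of_real (Y - y + 1)"
      by (simp add: complex_eq_iff)
    then show ?thesis by (simp add: h_def r_def)
  qed
  \<comment> \<open>The pole of h lies at height y - 1 and G is given above height 0; h is
    holomorphic above both.\<close>
  define c where "c = max 0 (y - 1)"
  have eq: "(\<integral>x. h (Complex x y) \<partial>lborel) = (\<integral>x. h (Complex x Y) \<partial>lborel)" if Y: "y \<le> Y" for Y
  proof (rule horizontal_integral_eq[where c = c and B = "C + (\<integral>x. (w x)\<^sup>2 \<partial>lborel)"])
    have "z - \<i> * of_real y + of_real q + \<i> \<noteq> 0" if "Im z > c" for z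
      using that by (auto simp: c_def complex_eq_iff)
    then show "h holomorphic_on {z. Im z > c}"
      unfolding h_def
      by (intro holomorphic_intros holomorphic_on_subset[OF G]) (auto simp: c_def)
    fix Y assume Y: "y \<le> Y"
    have sG: "square_integrable (\<lambda>x. G (Complex x Y))" using sq Y y by simp
    show "integrable lborel (\<lambda>x. h (Complex x Y))"
      unfolding hr using Y by (intro square_integrable_mult_integrable sG sr) simp
    have "(\<integral>x. norm (h (Complex x Y)) \<partial>lborel)
        \<le> (\<integral>x. (norm (G (Complex x Y)))\<^sup>2 + (w x)\<^sup>2 \<partial>lborel)"
    proof (rule integral_mono)
      show "integrable lborel (\<lambda>x. norm (h (Complex x Y)))"
        using \<open>integrable lborel (\<lambda>x. h (Complex x Y))\<close> by simp
      show "integrable lborel (\<lambda>x. (norm (G (Complex x Y)))\<^sup>2 + (w x)\<^sup>2)"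
        using sG iw by (simp add: square_integrable_def)
      fix x
      have "norm (h (Complex x Y)) \<le> norm (G (Complex x Y)) * w x"
        unfolding hr norm_mult using Y by (intro mult_left_mono r_le) auto
      also have "\<dots> \<le> (norm (G (Complex x Y)))\<^sup>2 + (w x)\<^sup>2"
        using sum_squares_bound[of "norm (G (Complex x Y))" "w x"]
          zero_le_power2[of "norm (G (Complex x Y))"] zero_le_power2[of "w x"] by linarith
      finally show "norm (h (Complex x Y)) \<le> (norm (G (Complex x Y)))\<^sup>2 + (w x)\<^sup>2" .
    qed
    also have "\<dots> = (\<integral>x. (norm (G (Complex x Y)))\<^sup>2 \<partial>lborel) + (\<integral>x. (w x)\<^sup>2 \<partial>lborel)"
      using sG iw by (intro Bochner_Integration.integral_add) (auto simp: square_integrable_def)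
    also have "\<dots> \<le> C + (\<integral>x. (w x)\<^sup>2 \<partial>lborel)" using C[of Y] Y y by simp
    finally show "(\<integral>x. norm (h (Complex x Y)) \<partial>lborel) \<le> C + (\<integral>x. (w x)\<^sup>2 \<partial>lborel)" .
  qed (use y Y in \<open>auto simp: c_def\<close>)
  have bound: "norm (\<integral>x. h (Complex x y) \<partial>lborel)
      \<le> sqrt C * norm (L2_of (\<lambda>x. cnj (r (real n + 1) x)))" for n
  proof -
    let ?Y = "y + real n"
    have sG: "square_integrable (\<lambda>x. G (Complex x ?Y))" using sq y by simp
    have sc: "square_integrable (\<lambda>x. cnj (r (real n + 1) x))"
      using sr[of "real n + 1"] by (auto simp: square_integrable_def)
    have "(\<integral>x. h (Complex x y) \<partial>lborel) = (\<integral>x. h (Complex x ?Y) \<partial>lborel)" by (rule eq) simp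
    also have "\<dots> = cinner (L2_of (\<lambda>x. G (Complex x ?Y))) (L2_of (\<lambda>x. cnj (r (real n + 1) x)))"
      using sG sc by (simp add: cinner_L2_of hr)
    also have "norm \<dots> \<le> norm (L2_of (\<lambda>x. G (Complex x ?Y)))
        * norm (L2_of (\<lambda>x. cnj (r (real n + 1) x)))"
      by (rule norm_cinner_le)
    also have "\<dots> \<le> sqrt C * norm (L2_of (\<lambda>x. cnj (r (real n + 1) x)))"
      using C[of ?Y] y by (intro mult_right_mono real_le_rsqrt) (auto simp: norm_L2_of sG)
    finally show ?thesis .
  qed
  have "(\<lambda>n. L2_of (\<lambda>x. cnj (r (real n + 1) x))) \<longlonglongrightarrow> L2_of (\<lambda>x. 0)"
  proof (rule L2_tendsto_dominated(3)[OF _ _ iw])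
    show "AE x in lborel. norm (cnj (r (real n + 1) x)) \<le> w x" for n using r_le(1) by simp
    have "(\<lambda>n. cnj (r (real n + 1) x)) \<longlonglongrightarrow> 0" for x
    proof (rule Lim_null_comparison)
      show "\<forall>\<^sub>F n in sequentially. norm (cnj (r (real n + 1) x)) \<le> 1 / (real n + 1)"
        using r_le(2) by simp
      show "(\<lambda>n. 1 / (real n + 1)) \<longlonglongrightarrow> 0"
        using LIMSEQ_Suc[OF lim_1_over_n[where 'a = real]] by (simp add: add.commute)
    qed
    then show "AE x in lborel. (\<lambda>n. cnj (r (real n + 1) x)) \<longlonglongrightarrow> 0" by simp
  qed measurable
  then have "(\<lambda>n. sqrt C * norm (L2_of (\<lambda>x. cnj (r (real n + 1) x)))) \<longlonglongrightarrow> sqrt C * norm (0 :: L2)"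
    unfolding zero_L2_def[symmetric] by (intro tendsto_intros)
  then have "norm (\<integral>x. h (Complex x y) \<partial>lborel) \<le> 0"
    using bound by (intro LIMSEQ_le_const[where X = "\<lambda>n. sqrt C
        * norm (L2_of (\<lambda>x. cnj (r (real n + 1) x)))"]) auto
  then have 0: "(\<integral>x. h (Complex x y) \<partial>lborel) = 0" by simp
  have "G (Complex x y)
      * cnj (of_real (1 / sqrt (2 * pi)) * (1 / (1 + \<i> * of_real q + \<i> * of_real x)))
      = \<i> * of_real (1 / sqrt (2 * pi)) * h (Complex x y)" for x
  proof -
    have "cnj (1 / (1 + \<i> * of_real q + \<i> * of_real x)) = \<i> * r 1 x"
    proof -
      have "of_real (x + q) + \<i> * of_real 1 = \<i> * (1 - \<i> * of_real q - \<i> * of_real x)"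
        by (simp add: algebra_simps)
      then have "\<i> * r 1 x = 1 / (1 - \<i> * of_real q - \<i> * of_real x)" by (simp add: r_def)
      then show ?thesis by (simp add: algebra_simps)
    qed
    then show ?thesis unfolding complex_cnj_mult by (simp only: hr) simp
  qed
  then show ?thesis
    unfolding fourier_cauchy_test(1)
    using sq[OF y] fourier_cauchy_test(2)[of q] 0
      by (simp only: cinner_L2_of integral_mult_right_zero) simp
qed

lemma hardy_space_orthogonal:
  assumes "f \<in> hardy_space"
  shows "cinner f (fourier (L2_of (cauchy_test q))) = 0"
proof -
  obtain G C where G: "G holomorphic_on {z. Im z > 0}"
    "\<forall>y>0. square_integrable (\<lambda>x. G (Complex x y))"
    "\<forall>y>0. (\<integral>x. (norm (G (Complex x y)))\<^sup>2 \<partial>lborel) \<le> C"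
    and lim: "((\<lambda>y. L2_of (\<lambda>x. G (Complex x y))) \<longlongrightarrow> f) (at_right 0)"
    using assms by (auto simp: hardy_space_def)
  let ?c = "\<lambda>y. cinner (L2_of (\<lambda>x. G (Complex x y))) (fourier (L2_of (cauchy_test q)))"
  have "(?c \<longlongrightarrow> cinner f (fourier (L2_of (cauchy_test q)))) (at_right 0)"
    by (rule tendsto_cinner[OF lim tendsto_const])
  moreover have "\<forall>\<^sub>F y in at_right 0. ?c y = 0"
    using eventually_at_right_less[of "0 :: real"]
  proof eventually_elim
    case (elim y)
    show ?case by (rule hardy_line_orthogonal[OF G(1) _ _ elim]) (use G in auto)
  qed
  then have "(?c \<longlongrightarrow> 0) (at_right 0)" by (rule tendsto_eventually)
  ultimately show ?thesis using tendsto_unique trivial_limit_at_right_real by blast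
qed

lemma mom_proj_apply: "mom_proj t f = adj fourier (pos_proj t (fourier f))"
  by (simp add: mom_proj_def Ad_apply adj_adj unitary_fourier)

text \<open>First half of Paley-Wiener. With u the Fourier transform of f, orthogonality to all
  Cauchy kernels says that u times the reflected exponential has zero Fourier transform. That
  exponential is nonzero exactly on the negative axis, so u vanishes there.\<close>

lemma hardy_space_subset:
  assumes "f \<in> hardy_space"
  shows "mom_proj 0 f = f"
proof -
  obtain u where u: "square_integrable u" "fourier f = L2_of u" by (rule L2_cases)
  have [measurable]: "u \<in> borel_measurable borel" using u by (simp add: square_integrable_def)
  have sc: "square_integrable (\<lambda>x. cauchy_test q (- x))" for q
    using square_integrable_affine[of "-1" "cauchy_test q" 0] square_integrable_cauchy_test by simp
  have 0: "(\<integral>x. u x * cnj (cauchy_test q (- x)) \<partial>lborel) = 0" for q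
  proof -
    have "fourier (L2_of (cauchy_test q)) = adj fourier (L2_of (\<lambda>x. cauchy_test q (- x)))"
      using affine_op_L2_of[of "-1" "cauchy_test q" 0] square_integrable_cauchy_test
        reflection_reflection[of "L2_of (cauchy_test q)"]
      by (simp add: adj_fourier)
    then have "cinner f (fourier (L2_of (cauchy_test q)))
        = cinner (L2_of u) (L2_of (\<lambda>x. cauchy_test q (- x)))"
      by (simp add: u(2)[symmetric] cinner_adj[OF unitary_fourier])
    then show ?thesis
      using hardy_space_orthogonal[OF assms, of q] u sc by (simp add: cinner_L2_of)
  qed
  have "AE x in lborel. u x * cnj (cauchy_test 0 (- x)) = 0"
  proof (rule fourier_uniqueness)
    show "integrable lborel (\<lambda>x. u x * cnj (cauchy_test 0 (- x)))"
      using u sc by (intro integrable_cinner)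
    fix t
    have "cnj (cauchy_test 0 (- x)) * iexp (t * x) = cnj (cauchy_test (- t) (- x))" for x
      unfolding cauchy_test_def complex_cnj_scaleR exp_cnj mult_scaleR_left exp_add[symmetric]
      by (intro arg_cong2[where f = scaleR] arg_cong[where f = exp] refl) (simp add: algebra_simps)
    then show "(\<integral>x. u x * cnj (cauchy_test 0 (- x)) * iexp (t * x) \<partial>lborel) = 0"
      using 0[of "- t"] by (simp add: mult.assoc)
  qed
  then have "AE x in lborel. ray 0 x * u x = u x"
    by eventually_elim (auto simp: ray_def cauchy_test_def split: if_splits)
  then have "pos_proj 0 (L2_of u) = L2_of u"
    using u by (simp add: pos_proj_def mult_op_L2_of L2_of_eq_iff square_integrable_bounded_borel)
  then show ?thesis
    by (simp add: mom_proj_apply u(2)[symmetric] unitary_adj_left unitary_fourier)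
qed


text \<open>Differentiation under the integral sign. On the ball of radius \<delta> = Im z / 2 every
  point has height above \<delta>, which bounds the difference quotients of the exponential
  uniformly by a square-integrable function of \<xi>; its product with u is an integrable
  majorant.\<close>

lemma laplace_transform_holomorphic:
  assumes u: "square_integrable u"
  shows "(\<lambda>z. \<integral>\<xi>. u \<xi> * (indicator {0<..} \<xi> *\<^sub>R exp (\<i> * z * complex_of_real \<xi>)) \<partial>lborel)
    holomorphic_on {z. Im z > 0}"
proof -
  let ?e = "\<lambda>z \<xi>. exp (\<i> * z * complex_of_real \<xi>)"
  let ?L = "\<lambda>z. \<integral>\<xi>. u \<xi> * (indicator {0<..} \<xi> *\<^sub>R ?e z \<xi>) \<partial>lborel"
  have [measurable]: "u \<in> borel_measurable borel" using u by (simp add: square_integrable_def)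
  have int: "integrable lborel (\<lambda>\<xi>. u \<xi> * (indicator {0<..} \<xi> *\<^sub>R ?e z \<xi>))" if "Im z > 0" for z
    using square_integrable_mult_integrable[OF u square_integrable_exp_ray[of "- \<i> * z"]] that
      by simp
  have "\<exists>D. (?L has_field_derivative D) (at z)" if z: "Im z > 0" for z
  proof -
    define \<delta> where "\<delta> = Im z / 2"
    have \<delta>: "\<delta> > 0" using z by (simp add: \<delta>_def)
    have Im_ball: "Im w > \<delta>" if "w \<in> ball z \<delta>" for w
    proof -
      have "\<bar>Im (z - w)\<bar> < \<delta>"
        using that abs_Im_le_cmod[of "z - w"] by (simp add: dist_norm)
      then have "Im z - Im w < \<delta>" by simp
      then show ?thesis by (simp add: \<delta>_def)
    qed
    let ?D = "\<integral>\<xi>. u \<xi> * (indicator {0<..} \<xi> *\<^sub>R (\<i> * of_real \<xi> * ?e z \<xi>)) \<partial>lborel"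
    have "((\<lambda>w. (?L w - ?L z) / (w - z)) \<longlongrightarrow> ?D) (at z within ball z \<delta>)"
      unfolding tendsto_at_iff_sequentially o_def
    proof (intro allI impI)
      fix X :: "nat \<Rightarrow> complex"
      assume X: "\<forall>i. X i \<in> ball z \<delta> - {z}" "X \<longlonglongrightarrow> z"
      define q where "q i \<xi> = (?e (X i) \<xi> - ?e z \<xi>) / (X i - z)" for i \<xi>
      have "(?L (X i) - ?L z) / (X i - z) = (\<integral>\<xi>. u \<xi> * (indicator {0<..} \<xi> *\<^sub>R q i \<xi>) \<partial>lborel)"
        for i
      proof -
        have "Im (X i) > 0" using Im_ball[of "X i"] X \<delta> by force
        then have "?L (X i) - ?L z = (\<integral>\<xi>. u \<xi> * (indicator {0<..} \<xi> *\<^sub>R ?e (X i) \<xi>)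
            - u \<xi> * (indicator {0<..} \<xi> *\<^sub>R ?e z \<xi>) \<partial>lborel)"
          using z by (intro Bochner_Integration.integral_diff[symmetric] int)
        then have "(?L (X i) - ?L z) / (X i - z) = (\<integral>\<xi>. (u \<xi> * (indicator {0<..} \<xi> *\<^sub>R ?e (X i) \<xi>)
            - u \<xi> * (indicator {0<..} \<xi> *\<^sub>R ?e z \<xi>)) / (X i - z) \<partial>lborel)"
          by simp
        also have "\<dots> = (\<integral>\<xi>. u \<xi> * (indicator {0<..} \<xi> *\<^sub>R q i \<xi>) \<partial>lborel)"
          by (intro Bochner_Integration.integral_cong)
            (auto simp: q_def indicator_def right_diff_distrib)
        finally show ?thesis .
      qed
      moreover have "(\<lambda>i. \<integral>\<xi>. u \<xi> * (indicator {0<..} \<xi> *\<^sub>R q i \<xi>) \<partial>lborel) \<longlonglongrightarrow> ?D"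
      proof (rule integral_dominated_convergence[where
            w = "\<lambda>\<xi>. norm (u \<xi> * (indicator {0<..} \<xi> *\<^sub>R exp (- of_real (\<delta> / 2)
                * complex_of_real \<xi>))) * (2 / \<delta>)"])
        show "integrable lborel (\<lambda>\<xi>. norm (u \<xi>
            * (indicator {0<..} \<xi> *\<^sub>R exp (- of_real (\<delta> / 2) * complex_of_real \<xi>))) * (2 / \<delta>))"
          using \<delta> by (intro integrable_mult_left integrable_norm square_integrable_mult_integrable u
            square_integrable_exp_ray) simp
        show "(\<lambda>\<xi>. u \<xi> * (indicator {0<..} \<xi> *\<^sub>R q i \<xi>)) \<in> borel_measurable lborel" for i
          unfolding q_def by measurable
        show "(\<lambda>\<xi>. u \<xi> * (indicator {0<..} \<xi> *\<^sub>R (\<i> * of_real \<xi> * ?e z \<xi>)))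
            \<in> borel_measurable lborel"
          by measurable
        have der: "((\<lambda>w. ?e w \<xi>) has_field_derivative \<i> * of_real \<xi> * ?e w \<xi>) (at w within S)"
          for w \<xi> S
          by (auto intro!: derivative_eq_intros)
        have "(\<lambda>i. q i \<xi>) \<longlonglongrightarrow> \<i> * of_real \<xi> * ?e z \<xi>" for \<xi>
        proof -
          have "((\<lambda>w. (?e w \<xi> - ?e z \<xi>) / (w - z)) \<longlongrightarrow> \<i> * of_real \<xi> * ?e z \<xi>) (at z within ball z \<delta>)"
            using der[of \<xi> z "ball z \<delta>"] by (simp add: has_field_derivative_iff)
          then show ?thesis
            unfolding tendsto_at_iff_sequentially q_def o_def using X by blast
        qed
        then show "AE \<xi> in lborel. (\<lambda>i. u \<xi> * (indicator {0<..} \<xi> *\<^sub>R q i \<xi>))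
            \<longlonglongrightarrow> u \<xi> * (indicator {0<..} \<xi> *\<^sub>R (\<i> * of_real \<xi> * ?e z \<xi>))"
          by (intro AE_I2 tendsto_intros)
        fix i
        have "norm (q i \<xi>) \<le> exp (- (\<delta> / 2 * \<xi>)) * (2 / \<delta>)" if \<xi>: "\<xi> > 0" for \<xi>
        proof -
          have "norm (?e (X i) \<xi> - ?e z \<xi>) \<le> (\<xi> * exp (- (\<delta> * \<xi>))) * norm (X i - z)"
          proof (rule field_differentiable_bound[of "ball z \<delta>" "\<lambda>w. ?e w \<xi>" "\<lambda>w. \<i> * of_real \<xi>
              * ?e w \<xi>"])
            fix w assume "w \<in> ball z \<delta>"
            then have "\<delta> * \<xi> \<le> Im w * \<xi>" using Im_ball[of w] \<xi> by simp
            then show "norm (\<i> * of_real \<xi> * ?e w \<xi>) \<le> \<xi> * exp (- (\<delta> * \<xi>))"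
              using \<xi> by (simp add: norm_mult)
          qed (use X \<delta> der in auto)
          moreover have "norm (X i - z) > 0" using X by auto
          ultimately have "norm (q i \<xi>) \<le> \<xi> * exp (- (\<delta> * \<xi>))"
            by (simp add: q_def norm_divide divide_le_eq)
          \<comment> \<open>Half of the decay is spent on absorbing the factor \<xi>; the other half
            keeps the majorant square integrable.\<close>
          also have "\<dots> = exp (- (\<delta> / 2 * \<xi>)) * (\<xi> * exp (- (\<delta> / 2 * \<xi>)))"
            by (simp add: exp_add[symmetric] algebra_simps)
          also have "\<xi> * exp (- (\<delta> / 2 * \<xi>)) \<le> 2 / \<delta>"
          proof -
            have "\<delta> / 2 * \<xi> \<le> exp (\<delta> / 2 * \<xi>)" using exp_ge_add_one_self[of "\<delta> / 2 * \<xi>"] by linarith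
            then show ?thesis using \<delta> by (simp add: exp_minus field_simps)
          qed
          finally show ?thesis by (simp add: mult_left_mono)
        qed
        then have "norm (u \<xi>) * norm (q i \<xi>) \<le> norm (u \<xi>) * exp (- (\<delta> / 2 * \<xi>)) * (2 / \<delta>)"
          if "\<xi> > 0" for \<xi> using that unfolding mult.assoc[of "norm (u \<xi>)"]
            by (intro mult_left_mono) auto
        then show "AE \<xi> in lborel. norm (u \<xi> * (indicator {0<..} \<xi> *\<^sub>R q i \<xi>))
            \<le> norm (u \<xi> * (indicator {0<..} \<xi> *\<^sub>R exp (- of_real (\<delta> / 2) * complex_of_real \<xi>))) *
              (2 / \<delta>)"
          by (intro AE_I2) (auto simp: norm_mult indicator_def)
      qed
      ultimately show "(\<lambda>i. (?L (X i) - ?L z) / (X i - z)) \<longlonglongrightarrow> ?D" by simp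
    qed
    then have "(?L has_field_derivative ?D) (at z within ball z \<delta>)"
      by (simp add: has_field_derivative_iff)
    then have "(?L has_field_derivative ?D) (at z)"
      using \<delta> by (simp add: at_within_open[OF _ open_ball])
    then show ?thesis by blast
  qed
  then show ?thesis
    by (auto simp: holomorphic_on_def field_differentiable_def intro: field_differentiable_at_within
        dest: has_field_derivative_at_within)
qed

text \<open>Second half of Paley-Wiener. The line at height y carries the inverse Fourier transform
  of u damped by exp (- y \<xi>) on the positive axis: isometry gives the uniform bound, dominated
  convergence as y tends to 0 the boundary value.\<close>

lemma hardy_space_superset:
  assumes "mom_proj 0 f = f"
  shows "f \<in> hardy_space"
proof -
  obtain u where u: "square_integrable u" "fourier f = L2_of u" by (rule L2_cases)
  have [measurable]: "u \<in> borel_measurable borel" using u by (simp add: square_integrable_def)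
  define uy where "uy y \<xi> = u \<xi> * (indicator {0<..} \<xi> *\<^sub>R exp (- of_real y * complex_of_real \<xi>))"
    for y \<xi> :: real
  have uym [measurable]: "uy y \<in> borel_measurable borel" for y unfolding uy_def by measurable
  have nuy: "norm (uy y \<xi>) \<le> norm (u \<xi>)" if "y \<ge> 0" for y \<xi>
    using that by (auto simp: uy_def norm_mult indicator_def intro: mult_left_le)
  have su: "square_integrable (uy y)" if "y \<ge> 0" for y
    unfolding square_integrable_def
  proof
    show "integrable lborel (\<lambda>x. (norm (uy y x))\<^sup>2)"
    proof (rule Bochner_Integration.integrable_bound)
      show "integrable lborel (\<lambda>x. (norm (u x))\<^sup>2)" using u by (simp add: square_integrable_def)
      show "AE x in lborel. norm ((norm (uy y x))\<^sup>2) \<le> norm ((norm (u x))\<^sup>2)"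
        using nuy[OF that] by (intro AE_I2) (simp add: power_mono)
    qed measurable
  qed measurable
  have iu: "integrable lborel (uy y)" if "y > 0" for y
    unfolding uy_def[abs_def] using that
    by (intro square_integrable_mult_integrable u square_integrable_exp_ray) simp
  have f_eq: "f = adj fourier (L2_of (uy 0))"
  proof -
    have "fourier f = pos_proj 0 (fourier f)"
      using assms unitary_adj_right[OF unitary_fourier, of "pos_proj 0 (fourier f)"]
      by (simp add: mom_proj_apply)
    also have "\<dots> = L2_of (\<lambda>x. ray 0 x * u x)"
      using u by (simp add: pos_proj_def mult_op_L2_of)
    \<comment> \<open>\<open>ray 0\<close> contains the point 0 and the indicator in
      \<open>uy\<close> does not; a point is a null set.\<close>
    also have "\<dots> = L2_of (uy 0)"
    proof (rule L2_of_eqI(1))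
      show "AE x in lborel. ray 0 x * u x = uy 0 x"
        using AE_lborel_singleton[of 0]
        by eventually_elim (auto simp: ray_def uy_def indicator_def)
    qed (use u in \<open>auto intro: square_integrable_bounded_borel\<close>)
    finally show ?thesis using unitary_adj_left[OF unitary_fourier, of f] by simp
  qed
  define g where "g z = of_real (1 / sqrt (2 * pi)) *
      (\<integral>\<xi>. u \<xi> * (indicator {0<..} \<xi> *\<^sub>R exp (\<i> * z * complex_of_real \<xi>)) \<partial>lborel)" for z
  have hol: "g holomorphic_on {z. Im z > 0}"
    unfolding g_def by (intro holomorphic_intros laplace_transform_holomorphic u)
  have sur: "square_integrable (\<lambda>x. uy y (- x))" if "y \<ge> 0" for y
    using square_integrable_affine[of "-1" "uy y" 0] su[OF that] by simp
  \<comment> \<open>The adjoint of the Fourier transform is the transform of the reflected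
    function.\<close>
  have g_eq: "(\<lambda>x. g (Complex x y)) = fourier_integral (\<lambda>x. uy y (- x))" for y
  proof
    fix x
    have "(\<integral>\<xi>. uy y (- \<xi>) * exp (- \<i> * complex_of_real (x * \<xi>)) \<partial>lborel)
        = (\<integral>\<xi>. uy y \<xi> * iexp (x * \<xi>) \<partial>lborel)"
      using lborel_integral_real_affine[of "-1" "\<lambda>\<xi>. uy y \<xi> * iexp (x * \<xi>)" 0] by simp
    moreover have "uy y \<xi> * iexp (x * \<xi>)
        = u \<xi> * (indicator {0<..} \<xi> *\<^sub>R exp (\<i> * Complex x y * complex_of_real \<xi>))" for \<xi>
      unfolding uy_def mult.assoc mult_scaleR_left exp_add[symmetric]
      by (intro arg_cong2[where f = "(*)"] arg_cong2[where f = scaleR] arg_cong[where f = exp] refl)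
        (simp add: complex_eq_iff)
    ultimately show "g (Complex x y) = fourier_integral (\<lambda>x. uy y (- x)) x"
      unfolding g_def fourier_integral_def by simp
  qed
  have g: "square_integrable (\<lambda>x. g (Complex x y))"
    "L2_of (\<lambda>x. g (Complex x y)) = adj fourier (L2_of (uy y))"
    if "y > 0" for y
  proof -
    have "integrable lborel (\<lambda>x. uy y (- x))"
      using lborel_integrable_real_affine[OF iu[OF that], of "-1" 0] by simp
    from fourier_integral[OF sur this] that
    show "square_integrable (\<lambda>x. g (Complex x y))"
      "L2_of (\<lambda>x. g (Complex x y)) = adj fourier (L2_of (uy y))"
      using affine_op_L2_of[of "-1" "uy y" 0] su[of y] by (auto simp: g_eq adj_fourier)
  qed
  have bnd: "(\<integral>x. (norm (g (Complex x y)))\<^sup>2 \<partial>lborel) \<le> (norm (L2_of u))\<^sup>2" if "y > 0" for y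
  proof -
    have "(\<integral>x. (norm (g (Complex x y)))\<^sup>2 \<partial>lborel) = (norm (L2_of (uy y)))\<^sup>2"
      using g[OF that] unitary_norm[OF unitary_adj[OF unitary_fourier]] by (simp flip: norm_L2_of)
    also have "\<dots> \<le> (norm (L2_of u))\<^sup>2"
      using su[of y] u that nuy[of y] unfolding norm_L2_of[OF u(1)]
      by (subst norm_L2_of) (auto simp: square_integrable_def intro!: integral_mono power_mono)
    finally show ?thesis .
  qed
  have lim: "((\<lambda>y. L2_of (\<lambda>x. g (Complex x y))) \<longlongrightarrow> f) (at_right 0)"
    unfolding tendsto_at_iff_sequentially o_def
  proof (intro allI impI)
    fix X :: "nat \<Rightarrow> real" assume X: "\<forall>i. X i \<in> {0<..} - {0}" "X \<longlonglongrightarrow> 0"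
    have "(\<lambda>i. L2_of (uy (X i))) \<longlonglongrightarrow> L2_of (uy 0)"
    proof (rule L2_tendsto_dominated(3)[where w = "\<lambda>x. norm (u x)"])
      show "integrable lborel (\<lambda>x. (norm (u x))\<^sup>2)" using u by (simp add: square_integrable_def)
      show "AE x in lborel. norm (uy (X i) x) \<le> norm (u x)" for i
        using X nuy[of "X i"] by (intro AE_I2) (auto simp: less_imp_le)
      show "AE x in lborel. (\<lambda>i. uy (X i) x) \<longlonglongrightarrow> uy 0 x"
        unfolding uy_def by (intro AE_I2 tendsto_intros X(2))
    qed measurable
    then have "(\<lambda>i. adj fourier (L2_of (uy (X i)))) \<longlonglongrightarrow> adj fourier (L2_of (uy 0))"
      by (rule blinfun.tendsto[OF tendsto_const])
    then show "(\<lambda>i. L2_of (\<lambda>x. g (Complex x (X i)))) \<longlonglongrightarrow> f"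
      using X by (simp add: g(2) f_eq)
  qed
  show ?thesis
    unfolding hardy_space_def using hol g(1) bnd lim by blast
qed

lemma hardy_space_eq: "hardy_space = {f. mom_proj 0 f = f}"
  using hardy_space_subset hardy_space_superset by blast

section \<open>Half-plane projections\<close>

definition orth_proj :: "(L2 \<Rightarrow>\<^sub>L L2) \<Rightarrow> bool" where
  "orth_proj P \<longleftrightarrow> (\<forall>f. P (P f) = P f) \<and> (\<forall>f g. cinner (P f) g = cinner f (P g))"

lemma orth_proj_Ad:
  assumes "unitary U" "orth_proj P"
  shows "orth_proj (Ad U P)"
  using assms(2) cinner_adj[OF unitary_adj[OF assms(1)]]
  unfolding orth_proj_def
  by (simp add: Ad_apply unitary_adj_left[OF assms(1)] cinner_adj[OF assms(1)] adj_adj[OF assms(1)])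

lemma orth_proj_pos_proj: "orth_proj (pos_proj t)"
proof -
  have "(\<lambda>x. ray t x * ray t x) = ray t" "(\<lambda>x. cnj (ray t x)) = ray t"
    by (auto simp: ray_def fun_eq_iff)
  then show ?thesis
    by (simp add: orth_proj_def pos_proj_def mult_op_mult cinner_mult_op)
qed

lemma orth_proj_mom_proj: "orth_proj (mom_proj t)"
  unfolding mom_proj_def by (intro orth_proj_Ad unitary_adj unitary_fourier orth_proj_pos_proj)

lemma proj_eqI:
  fixes P :: "L2 \<Rightarrow>\<^sub>L L2"
  assumes P: "\<And>f. P f \<in> K" "\<And>f g. g \<in> K \<Longrightarrow> cinner (f - P f) g = 0"
  shows "proj K = P"
  unfolding Defs.proj_def
proof (rule the_equality)
  fix P' :: "L2 \<Rightarrow>\<^sub>L L2"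
  assume P': "\<forall>f. P' f \<in> K \<and> (\<forall>g\<in>K. cinner (f - P' f) g = 0)"
  show "P' = P"
  proof (rule blinfun_eqI)
    fix f
    have d: "cinner (P' f - P f) g = 0" if "g \<in> K" for g
    proof -
      have "cinner (f - P' f) g = 0" using P' that by blast
      with P(2)[OF that, of f] show ?thesis by (simp add: cinner_diff_left)
    qed
    have "P' f \<in> K" using P' by blast
    then have "cinner (P' f - P f) (P' f - P f) = 0"
      unfolding cinner_diff_right[of "P' f - P f"] using d[OF P(1)[of f]] d[of "P' f"] by simp
    then show "P' f = P f" by (simp add: cinner_self_norm)
  qed
qed (use P in blast)

lemma proj_image_unitary:
  assumes U: "unitary U" and P: "orth_proj P"
  shows "proj (U ` {f. P f = f}) = Ad U P"
proof (rule proj_eqI)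
  fix f g
  show "Ad U P f \<in> U ` {f. P f = f}" using P by (auto simp: Ad_apply orth_proj_def)
  assume "g \<in> U ` {f. P f = f}"
  then obtain h where h: "g = U h" "P h = h" by auto
  have "cinner (f - Ad U P f) g = cinner (adj U f - P (adj U f)) h"
    unfolding h Ad_apply using cinner_adj[OF unitary_adj[OF U]] unitary_cinner[OF U]
    by (simp add: cinner_diff_left adj_adj[OF U])
  also have "\<dots> = cinner (adj U f) (P h) - cinner (P (adj U f)) h"
    by (simp add: cinner_diff_left h)
  also have "\<dots> = 0" using P by (simp add: orth_proj_def)
  finally show "cinner (f - Ad U P f) g = 0" .
qed

text \<open>The exponential factors as a chirp times a modulation, and the modulation only shifts
  the momentum nest. The factor -2 compensates the sign and the 1/2 in \<open>chirp\<close>.\<close>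

lemma FP_manifold_eq: "FP_manifold = {Ad (chirp s) (mom_proj t) | s t. True}"
proof -
  have "proj (mult_op (\<lambda>x. iexp (l1 * x + l2 * x\<^sup>2)) ` hardy_space)
      = Ad (chirp (- 2 * l2)) (mom_proj l1)" for l1 l2
  proof -
    let ?M = "mult_op (\<lambda>x. iexp (l1 * x + l2 * x\<^sup>2))"
    have u: "unitary ?M" by (rule unitary_exp_op) measurable
    have b: "bounded_borel (\<lambda>x. iexp (- (- 2 * l2 * x\<^sup>2 / 2)))"
      "bounded_borel (\<lambda>x. iexp (l1 * x))"
      by (rule bounded_borel_exp, measurable)+
    have "iexp (- (- 2 * l2 * x\<^sup>2 / 2)) * iexp (l1 * x)
        = iexp (l1 * x + l2 * x\<^sup>2)" for x
      unfolding exp_add[symmetric] by (simp add: algebra_simps)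
    then have "?M = chirp (- 2 * l2) o\<^sub>L modulation l1"
      unfolding chirp_eq modulation_def
      by (intro blinfun_eqI) (simp only: blinfun_apply_blinfun_compose mult_op_mult[OF b])
    then have "Ad ?M (mom_proj 0) = Ad (chirp (- 2 * l2)) (mom_proj l1)"
      by (simp add: Ad_compose unitary_chirp unitary_modulation Ad_modulation_mom_proj)
    then show ?thesis
      unfolding hardy_space_eq by (simp only: proj_image_unitary[OF u orth_proj_mom_proj])
  qed
  moreover have "Ad (chirp s) (mom_proj t) = Ad (chirp (- 2 * (- s / 2))) (mom_proj t)" for s t
    by simp
  ultimately show ?thesis unfolding FP_manifold_def by (metis (no_types, lifting))
qed

text \<open>\<open>linear_symbol V a b r\<close> says that \<open>Ad V\<close> maps the Weyl operators in position direction to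
  those in direction \<open>(a, b)\<close>; then \<open>Ad V (pos_proj 0)\<close> is the spectral projection
    for the half-plane
  \<open>a * x - b * \<xi> + r \<ge> 0\<close> of the phase plane.\<close>

definition linear_symbol :: "(L2 \<Rightarrow>\<^sub>L L2) \<Rightarrow> real \<Rightarrow> real \<Rightarrow> real \<Rightarrow> bool" where
  "linear_symbol V a b r \<longleftrightarrow> unitary V \<and> (a \<noteq> 0 \<or> b \<noteq> 0) \<and>
    (\<forall>l u. V (modulation l u) = scaleC (iexp (l * r)) (weyl (l * a) (l * b) (V u)))"

text \<open>Described through unitaries rather than through lines: stability under a generator then
  amounts to composing symbols, and no image has to be identified.\<close>

definition half_planes :: "(L2 \<Rightarrow>\<^sub>L L2) set" where
  "half_planes = {Ad V (pos_proj 0) | V. \<exists>a b r. linear_symbol V a b r}"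

lemma linear_symbol_unitary: "linear_symbol V a b r \<Longrightarrow> unitary V"
  by (simp add: linear_symbol_def)

lemma linear_symbol_id: "linear_symbol id_blinfun 1 0 0"
  by (simp add: linear_symbol_def unitary_id modulation_eq_weyl)

lemma linear_symbol_fourier: "linear_symbol V a b r \<Longrightarrow> linear_symbol (fourier o\<^sub>L V) (- b) a r"
  by (auto simp: linear_symbol_def unitary_compose unitary_fourier fourier_weyl
      unitary_clinear[OF unitary_fourier])

lemma adj_fourier_weyl: "adj fourier (weyl l m u) = weyl m (- l) (adj fourier u)"
  by (rule unitary_inj[OF unitary_fourier])
    (simp add: unitary_adj_right[OF unitary_fourier] fourier_weyl)

lemma linear_symbol_adj_fourier:
  "linear_symbol V a b r \<Longrightarrow> linear_symbol (adj fourier o\<^sub>L V) b (- a) r"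
  by (auto simp: linear_symbol_def unitary_compose unitary_adj unitary_fourier adj_fourier_weyl
      unitary_clinear[OF unitary_adj[OF unitary_fourier]])

lemma linear_symbol_chirp:
  assumes "linear_symbol V a b r"
  shows "linear_symbol (chirp s o\<^sub>L V) (a - s * b) b r"
proof -
  have "l * (a - s * b) = l * a - s * (l * b)" for l by (simp add: algebra_simps)
  then show ?thesis
    using assms
    by (auto simp: linear_symbol_def unitary_compose unitary_chirp chirp_weyl
        unitary_clinear[OF unitary_chirp])
qed

lemma linear_symbol_modulation:
  assumes "linear_symbol V a b r"
  shows "linear_symbol (modulation c o\<^sub>L V) a b (r + c * b)"
proof -
  have "iexp (l * (r + c * b))
      = iexp (l * r) * iexp (c * (l * b))" for l
    unfolding exp_add[symmetric] by (simp add: algebra_simps)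
  then show ?thesis
    using assms
    by (auto simp: linear_symbol_def unitary_compose unitary_modulation modulation_weyl
        unitary_clinear[OF unitary_modulation] simp del: of_real_mult of_real_add)
qed

lemma linear_symbol_phase:
  assumes "linear_symbol V a b r"
  shows "linear_symbol (phase \<psi> o\<^sub>L V) a b r"
  using assms
  by (auto simp: linear_symbol_def unitary_compose unitary_phase phase_apply
      unitary_clinear[OF unitary_weyl] mult.commute)

lemma linear_symbol_translation:
  assumes "linear_symbol V a b r"
  shows "linear_symbol (V o\<^sub>L weyl 0 t) a b (r - t)"
proof -
  have V: "unitary V" using assms by (rule linear_symbol_unitary)
  have "weyl 0 t (modulation l u) = scaleC (iexp (- (l * t))) (modulation l (weyl 0 t u))" for l u
  proof -
    have "iexp (- (l * t)) * iexp (l * t) = 1"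
      unfolding exp_add[symmetric] by simp
    then show ?thesis unfolding modulation_weyl scaleC_scaleC by simp
  qed
  moreover have "iexp (- (l * t)) * iexp (l * r)
      = iexp (l * (r - t))" for l
    unfolding exp_add[symmetric] by (simp add: algebra_simps)
  ultimately show ?thesis
    using assms
    by (auto simp: linear_symbol_def unitary_compose unitary_weyl unitary_clinear[OF V]
        simp del: of_real_mult of_real_diff of_real_minus)
qed

lemma linear_symbol_reflect:
  assumes "linear_symbol V a b r"
  shows "linear_symbol (V o\<^sub>L (fourier o\<^sub>L fourier)) (- a) (- b) (- r)"
proof -
  have "fourier (fourier (modulation l u)) = modulation (- l) (fourier (fourier u))" for l u
    by (simp add: modulation_eq_weyl fourier_weyl)
  then show ?thesis
    using assms by (auto simp: linear_symbol_def unitary_compose unitary_fourier)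
qed

lemma pos_proj_complement: "mult_op (\<lambda>x. 1 - ray t x) = id_blinfun - pos_proj t"
proof (rule blinfun_eqI)
  fix u
  have b: "bounded_borel (\<lambda>x. 1 - ray t x)"
    using bounded_borel_add[OF bounded_borel_const[of 1]
      bounded_borel_mult[OF bounded_borel_const[of "-1"] bounded_borel_ray[of t]]]
    by simp
  have "mult_op (\<lambda>x. 1 - ray t x) u + mult_op (ray t) u = mult_op (\<lambda>_. 1) u"
    using mult_op_add[OF b bounded_borel_ray[of t], of u] by simp
  then show "mult_op (\<lambda>x. 1 - ray t x) u = (id_blinfun - pos_proj t) u"
    by (simp add: blinfun.diff_left pos_proj_def mult_op_const algebra_simps)
qed

text \<open>T turns the position x into k x + r, so the ray becomes the set k x + r \<ge> 0. For
  negative k this is a left ray, equal to the complement of a right ray up to its end point, a null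
  set.\<close>

lemma Ad_affine_pos_proj:
  assumes T: "unitary T" and k: "k \<noteq> 0"
    and eq: "\<And>l u. T (modulation l u) = scaleC (iexp (l * r)) (modulation (l * k) (T u))"
  shows "Ad T (pos_proj 0)
      = (if k > 0 then pos_proj (- r / k) else id_blinfun - pos_proj (- r / k))"
proof -
  have "scaleC (iexp (l * r)) (modulation (l * k) u)
      = mult_op (\<lambda>x. iexp (l * (k * x + r))) u" for l u
  proof -
    have b: "bounded_borel (\<lambda>x. iexp (l * k * x))"
      by (rule bounded_borel_exp) measurable
    have "iexp (l * r) * iexp (l * k * x)
        = iexp (l * (k * x + r))" for x
      unfolding exp_add[symmetric] by (simp add: algebra_simps)
    then show ?thesis
      unfolding modulation_def mult_op_const[symmetric]
        by (simp only: mult_op_mult[OF bounded_borel_const b])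
  qed
  then have "T (pos_proj 0 u) = mult_op (\<lambda>x. ray 0 (k * x + r)) (T u)" for u
    unfolding pos_proj_def
      by (intro intertwine_mult_op[OF T k]) (simp_all only: eq bounded_borel_ray)
  then have "Ad T (pos_proj 0) = mult_op (\<lambda>x. ray 0 (k * x + r))"
    using T by (simp add: Ad_eq_iff)
  also have "\<dots> = (if k > 0 then pos_proj (- r / k) else id_blinfun - pos_proj (- r / k))"
  proof (cases "k > 0")
    case True
    then have "(\<lambda>x. ray 0 (k * x + r)) = ray (- r / k)"
      by (auto simp: ray_def fun_eq_iff field_simps)
    then show ?thesis using True by (simp add: pos_proj_def)
  next
    case False
    then have k0: "k < 0" using k by simp
    have "mult_op (\<lambda>x. ray 0 (k * x + r)) = mult_op (\<lambda>x. 1 - ray (- r / k) x)"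
    proof (rule mult_op_cong_AE)
      show "bounded_borel (\<lambda>x. ray 0 (k * x + r))"
        by (rule bounded_borel_comp[OF bounded_borel_ray]) measurable
      show "bounded_borel (\<lambda>x. 1 - ray (- r / k) x)"
        using bounded_borel_add[OF bounded_borel_const[of 1]
          bounded_borel_mult[OF bounded_borel_const[of "-1"] bounded_borel_ray]]
        by simp
      show "AE x in lborel. ray 0 (k * x + r) = 1 - ray (- r / k) x"
        using AE_lborel_singleton[of "- r / k"]
      proof eventually_elim
        case (elim x)
        have "0 \<le> k * x + r \<longleftrightarrow> x \<le> - r / k"
          by (subst neg_le_divide_eq[OF k0]) (smt (verit) mult.commute)
        then show ?case using elim by (auto simp: ray_def)
      qed
    qed
    then show ?thesis using False by (simp add: pos_proj_complement)
  qed
  finally show ?thesis .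
qed

lemma Ad_linear_symbol_0:
  assumes V: "linear_symbol V a 0 r"
  shows "\<exists>t. Ad V (pos_proj 0) = pos_proj t \<or> Ad V (pos_proj 0) = id_blinfun - pos_proj t"
proof -
  have "Ad V (pos_proj 0) = (if a > 0 then pos_proj (- r / a) else id_blinfun - pos_proj (- r / a))"
    by (rule Ad_affine_pos_proj) (use V in \<open>auto simp: linear_symbol_def modulation_eq_weyl\<close>)
  then show ?thesis by metis
qed

text \<open>The explicit unitary W also carries modulations to Weyl operators of direction (a, b),
  with parameter - l b in place of l. Hence \<open>adj W\<close> after V only changes position
  affinely, and \<open>Ad_affine_pos_proj\<close> applies.\<close>

lemma Ad_linear_symbol_nonzero:
  assumes V: "linear_symbol V a b r" and b: "b \<noteq> 0"
  shows "\<exists>t. Ad V (pos_proj 0) = Ad (chirp (- a / b)) (mom_proj t) \<or>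
    Ad V (pos_proj 0) = id_blinfun - Ad (chirp (- a / b)) (mom_proj t)"
proof -
  define W where "W = chirp (- a / b) o\<^sub>L adj fourier"
  have uV: "unitary V" using V by (rule linear_symbol_unitary)
  have uW: "unitary W" unfolding W_def
    by (intro unitary_compose unitary_chirp unitary_adj unitary_fourier)
  have WM: "W (modulation (- l * b) u) = weyl (l * a) (l * b) (W u)" for l u
    using b by (simp add: W_def modulation_eq_weyl adj_fourier_weyl chirp_weyl mult.commute)
  have WM': "adj W (weyl (l * a) (l * b) u) = modulation (- l * b) (adj W u)" for l u
    by (rule unitary_inj[OF uW]) (simp only: unitary_adj_right[OF uW] WM)
  define T where "T = adj W o\<^sub>L V"
  have uT: "unitary T" unfolding T_def by (intro unitary_compose unitary_adj uW uV)
  have "T (modulation l u) = scaleC (iexp (l * r)) (modulation (l * - b) (T u))" for l u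
    using V WM' unfolding T_def linear_symbol_def
    by (simp add: unitary_clinear[OF unitary_adj[OF uW]])
  then have "Ad T (pos_proj 0)
      = (if - b > 0 then pos_proj (- r / - b) else id_blinfun - pos_proj (- r / - b))"
    using b by (intro Ad_affine_pos_proj uT) auto
  then obtain t where t: "Ad T (pos_proj 0) = pos_proj t \<or> Ad T (pos_proj 0)
      = id_blinfun - pos_proj t"
    by (cases "- b > 0") auto
  have "V = W o\<^sub>L T" unfolding T_def by (rule blinfun_eqI) (simp add: unitary_adj_right[OF uW])
  then have "Ad V (pos_proj 0) = Ad W (Ad T (pos_proj 0))" by (simp add: Ad_compose uW uT)
  moreover have "Ad W (pos_proj t) = Ad (chirp (- a / b)) (mom_proj t)"
    unfolding W_def mom_proj_def by (simp add: Ad_compose unitary_chirp unitary_adj unitary_fourier)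
  ultimately show ?thesis using t by (auto simp: Ad_diff Ad_id uW)
qed

section \<open>Stability of half-planes under the generators, and their classification\<close>

lemma half_planesI: "linear_symbol V a b r \<Longrightarrow> Ad V (pos_proj 0) \<in> half_planes"
  unfolding half_planes_def by blast

lemma half_planes_compose:
  assumes P: "P \<in> half_planes" and U: "unitary U"
    and lin: "\<And>V a b r. linear_symbol V a b r \<Longrightarrow> \<exists>a b r. linear_symbol (U o\<^sub>L V) a b r"
  shows "Ad U P \<in> half_planes"
proof -
  obtain V a b r where V: "linear_symbol V a b r" "P = Ad V (pos_proj 0)"
    using P unfolding half_planes_def by blast
  have "Ad U P = Ad (U o\<^sub>L V) (pos_proj 0)"
    using V by (simp add: Ad_compose U linear_symbol_unitary)
  then show ?thesis using lin[OF V(1)] half_planesI by metis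
qed

lemma half_planes_fourier: "P \<in> half_planes \<Longrightarrow> Ad fourier P \<in> half_planes"
  by (rule half_planes_compose) (auto intro: unitary_fourier linear_symbol_fourier)

lemma half_planes_adj_fourier: "P \<in> half_planes \<Longrightarrow> Ad (adj fourier) P \<in> half_planes"
  by (rule half_planes_compose) (auto intro: unitary_fourier unitary_adj linear_symbol_adj_fourier)

lemma half_planes_chirp: "P \<in> half_planes \<Longrightarrow> Ad (chirp s) P \<in> half_planes"
  by (rule half_planes_compose) (auto intro: unitary_chirp linear_symbol_chirp)

lemma half_planes_modulation: "P \<in> half_planes \<Longrightarrow> Ad (modulation s) P \<in> half_planes"
  by (rule half_planes_compose) (auto intro: unitary_modulation linear_symbol_modulation)

lemma half_planes_phase: "P \<in> half_planes \<Longrightarrow> Ad (phase s) P \<in> half_planes"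
  by (rule half_planes_compose) (auto intro: unitary_phase linear_symbol_phase)

lemma Ad_fourier_fourier_pos_proj: "Ad (fourier o\<^sub>L fourier) (pos_proj 0) = id_blinfun - pos_proj 0"
proof -
  have "Ad (fourier o\<^sub>L fourier) (pos_proj 0)
      = (if (-1 :: real) > 0 then pos_proj (- 0 / -1) else id_blinfun - pos_proj (- 0 / -1))"
    by (rule Ad_affine_pos_proj)
      (simp_all add: unitary_compose unitary_fourier modulation_eq_weyl fourier_weyl)
  then show ?thesis by simp
qed

text \<open>The square of the Fourier transform reflects the line; inserting it before V exchanges
  the two sides of the boundary.\<close>

lemma half_planes_complement: "P \<in> half_planes \<Longrightarrow> id_blinfun - P \<in> half_planes"
proof -
  assume "P \<in> half_planes"
  then obtain V a b r where V: "linear_symbol V a b r" "P = Ad V (pos_proj 0)"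
    unfolding half_planes_def by blast
  then have "id_blinfun - P = Ad (V o\<^sub>L (fourier o\<^sub>L fourier)) (pos_proj 0)"
    by (simp add: Ad_compose[OF _ unitary_compose] linear_symbol_unitary unitary_fourier
        Ad_fourier_fourier_pos_proj Ad_diff Ad_id)
  then show ?thesis using linear_symbol_reflect[OF V(1)] half_planesI by metis
qed

lemma half_planes_pos_proj: "pos_proj t \<in> half_planes"
proof -
  have "pos_proj t = Ad (id_blinfun o\<^sub>L weyl 0 t) (pos_proj 0)"
    by (simp add: Ad_compose unitary_id unitary_weyl Ad_id_op Ad_weyl_pos_proj)
  then show ?thesis using linear_symbol_translation[OF linear_symbol_id] half_planesI by metis
qed

lemma half_planes_mom_proj: "mom_proj t \<in> half_planes"
  unfolding mom_proj_def by (intro half_planes_adj_fourier half_planes_pos_proj)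

text \<open>The second case consists of the elements of \<open>FP_manifold\<close> and their
  complements; the first, with b = 0, is what the closure has to add besides 0 and the
  identity.\<close>

lemma half_planes_cases:
  assumes "P \<in> half_planes"
  obtains (vertical) t where "P = pos_proj t \<or> P = id_blinfun - pos_proj t"
  | (slanted) s t where "P = Ad (chirp s) (mom_proj t) \<or> P = id_blinfun - Ad (chirp s) (mom_proj t)"
proof -
  obtain V a b r where V: "linear_symbol V a b r" "P = Ad V (pos_proj 0)"
    using assms unfolding half_planes_def by blast
  show thesis
  proof (cases "b = 0")
    case True
    then show thesis using Ad_linear_symbol_0 V vertical by metis
  next
    case False
    then show thesis using Ad_linear_symbol_nonzero V slanted by metis
  qed
qed

section \<open>The strong closure\<close>

text \<open>The topology is pulled back from the product topology on functions, in which sequences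
  converge pointwise.\<close>

lemma strong_closureI:
  fixes T :: "'a :: real_normed_vector \<Rightarrow>\<^sub>L 'b :: real_normed_vector"
  assumes "\<And>n. P n \<in> S" "\<And>f. (\<lambda>n. blinfun_apply (P n) f) \<longlonglongrightarrow> T f"
  shows "T \<in> strong_operator_topology closure_of S"
  unfolding in_closure_of
proof (intro conjI allI impI)
  show "T \<in> topspace strong_operator_topology" by (simp add: strong_operator_topology_topspace)
  fix U assume U: "T \<in> U \<and> openin strong_operator_topology U"
  then obtain W where W: "open W" "U = blinfun_apply -` W"
    unfolding strong_operator_topology_def openin_pullback_topology by auto
  have "((\<lambda>n. blinfun_apply (P n)) \<longlonglongrightarrow> blinfun_apply T)"
    unfolding limitin_canonical_iff[symmetric] euclidean_product_topology[symmetric]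
      limitin_componentwise
    using assms(2) by (simp add: extensional_def)
  then have "\<forall>\<^sub>F n in sequentially. blinfun_apply (P n) \<in> W"
    using W U by (auto simp: tendsto_def)
  then obtain n where "blinfun_apply (P n) \<in> W"
    by (auto simp: eventually_sequentially)
  then show "\<exists>y. y \<in> S \<and> y \<in> U" using assms(1) W by auto
qed

lemma Hausdorff_strong_operator_topology:
  "Hausdorff_space (strong_operator_topology ::
    ('a :: real_normed_vector \<Rightarrow>\<^sub>L 'b :: real_normed_vector) topology)"
  unfolding Hausdorff_space_def
proof (intro allI impI)
  fix S T :: "'a \<Rightarrow>\<^sub>L 'b"
  assume "S \<in> topspace strong_operator_topology \<and> T \<in> topspace strong_operator_topology \<and> S \<noteq> T"
  then obtain f where "S f \<noteq> T f" using blinfun_eqI by metis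
  then obtain U V where UV: "open U" "open V" "S f \<in> U" "T f \<in> V" "U \<inter> V = {}"
    using hausdorff by metis
  let ?p = "\<lambda>W. {A \<in> topspace strong_operator_topology. blinfun_apply A f \<in> W}"
  have "openin strong_operator_topology (?p W)" if "open W" for W
    using openin_continuous_map_preimage[OF strong_operator_topology_continuous_evaluation] that
      by auto
  then show "\<exists>U V. openin strong_operator_topology U \<and> openin strong_operator_topology V \<and> S \<in> U \<and> T
      \<in> V \<and> disjnt U V"
    using UV by (intro exI[of _ "?p U"] exI[of _ "?p V"])
      (auto simp: strong_operator_topology_topspace disjnt_def)
qed

text \<open>The common norm bound controls T n (u n - u'), so that strong limits pass through
  products of operators.\<close>

lemma tendsto_contraction_apply:
  fixes T :: "nat \<Rightarrow> L2 \<Rightarrow>\<^sub>L L2" and T' :: "L2 \<Rightarrow>\<^sub>L L2"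
  assumes T: "\<And>n u. norm (T n u) \<le> norm u" "\<And>u. (\<lambda>n. T n u) \<longlonglongrightarrow> T' u" and u: "u \<longlonglongrightarrow> u'"
  shows "(\<lambda>n. T n (u n)) \<longlonglongrightarrow> T' u'"
proof -
  have "(\<lambda>n. T n (u n - u')) \<longlonglongrightarrow> 0"
  proof (rule Lim_null_comparison)
    show "\<forall>\<^sub>F n in sequentially. norm (T n (u n - u')) \<le> norm (u n - u')" using T(1) by simp
    show "(\<lambda>n. norm (u n - u')) \<longlonglongrightarrow> 0" using u by (simp add: tendsto_norm_zero_iff LIM_zero)
  qed
  from tendsto_add[OF this T(2)[of u']] show ?thesis by (simp add: blinfun.diff_right)
qed

lemma chirp_tendsto:
  assumes "s \<longlonglongrightarrow> s'"
  shows "(\<lambda>n. chirp (s n) u) \<longlonglongrightarrow> chirp s' u"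
  unfolding chirp_eq
proof (rule mult_op_tendsto[where B = 1])
  show "bounded_borel (\<lambda>x. iexp (- (s' * x\<^sup>2 / 2)))"
    by (rule bounded_borel_exp) measurable
  show "AE x in lborel. (\<lambda>n. iexp (- (s n * x\<^sup>2 / 2))) \<longlonglongrightarrow> iexp (- (s' * x\<^sup>2 / 2))"
    by (intro AE_I2 tendsto_intros assms) auto
qed auto

text \<open>The order isomorphism \<open>x \<mapsto> x / (1 + \<bar>x\<bar>)\<close> onto \<open>{-1<..<1}\<close> compactifies the parameter of a nest.\<close>

definition squash :: "real \<Rightarrow> real" where "squash x = x / (1 + \<bar>x\<bar>)"

lemma squash_bounds: "- 1 < squash x" "squash x < 1"
proof -
  have "0 < 1 + \<bar>x\<bar>" by linarith
  then show "- 1 < squash x" "squash x < 1"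
    using abs_ge_self[of x] abs_ge_minus_self[of x]
    by (auto simp: squash_def pos_less_divide_eq pos_divide_less_eq)
qed

lemma squash_less_iff: "squash x < squash y \<longleftrightarrow> x < y"
proof -
  have "squash x < squash y" if "x < y" for x y
  proof (cases "x \<ge> 0 \<or> y \<le> 0")
    case True
    then show ?thesis using that by (auto simp: squash_def field_simps abs_if)
  next
    case False
    then have "squash x < 0" "0 < squash y" by (auto simp: squash_def divide_less_0_iff)
    then show ?thesis by simp
  qed
  then show ?thesis by (metis less_asym linorder_neqE_linordered_idom)
qed

lemma squash_surj: "- 1 < r \<Longrightarrow> r < 1 \<Longrightarrow> \<exists>x. squash x = r"
proof (cases "r \<ge> 0")
  case True
  assume "r < 1"
  then show ?thesis using True by (intro exI[of _ "r / (1 - r)"]) (simp add: squash_def field_simps)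
next
  case False
  assume "- 1 < r"
  then show ?thesis using False
    by (intro exI[of _ "r / (1 + r)"]) (simp add: squash_def abs_if divide_less_0_iff field_simps)
qed

text \<open>Continues the nest to its two ends: the parameters -1 and 1 give the identity and
  0.\<close>

definition squash_proj :: "real \<Rightarrow> (L2 \<Rightarrow>\<^sub>L L2)" where
  "squash_proj r = mult_op (\<lambda>x. ray r (squash x))"

lemma squash_measurable [measurable]: "squash \<in> borel_measurable borel"
  unfolding squash_def by measurable

lemma bounded_borel_squash: "bounded_borel (\<lambda>x. ray r (squash x))"
  by (rule bounded_borel_comp[OF bounded_borel_ray]) measurable

lemma squash_proj_squash: "squash_proj (squash t) = pos_proj t"
proof -
  have "(\<lambda>x. ray (squash t) (squash x)) = ray t"
    using squash_less_iff by (auto simp: ray_def fun_eq_iff) (metis not_le)+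
  then show ?thesis by (simp add: squash_proj_def pos_proj_def)
qed

lemma squash_proj_1: "squash_proj 1 = 0"
proof (rule blinfun_eqI)
  fix u
  have "(\<lambda>x. ray 1 (squash x)) = (\<lambda>_. 0)"
    using squash_bounds by (auto simp: ray_def fun_eq_iff) (metis not_le)
  then show "squash_proj 1 u = (0 :: L2 \<Rightarrow>\<^sub>L L2) u" by (simp add: squash_proj_def mult_op_const)
qed

lemma squash_proj_minus_1: "squash_proj (- 1) = id_blinfun"
proof (rule blinfun_eqI)
  fix u
  have "(\<lambda>x. ray (- 1) (squash x)) = (\<lambda>_. 1)"
    using squash_bounds by (auto simp: ray_def fun_eq_iff) (metis less_imp_le)
  then show "squash_proj (- 1) u = id_blinfun u" by (simp add: squash_proj_def mult_op_const)
qed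

lemma norm_squash_proj_le: "norm (squash_proj r u) \<le> norm u"
proof -
  obtain f where f: "square_integrable f" "u = L2_of f" by (rule L2_cases)
  have s: "square_integrable (\<lambda>x. ray r (squash x) * f x)"
    using f bounded_borel_squash by (intro square_integrable_bounded_borel)
  have "(norm (squash_proj r u))\<^sup>2 = (\<integral>x. (norm (ray r (squash x) * f x))\<^sup>2 \<partial>lborel)"
    using f s bounded_borel_squash by (simp add: squash_proj_def mult_op_L2_of norm_L2_of)
  also have "\<dots> \<le> (\<integral>x. (norm (f x))\<^sup>2 \<partial>lborel)"
    using f s by (intro integral_mono) (auto simp: square_integrable_def ray_def)
  also have "\<dots> = (norm u)\<^sup>2" using f by (simp add: norm_L2_of)
  finally show ?thesis by (rule power2_le_imp_le) simp
qed

lemma squash_proj_tendsto: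
  assumes "r \<longlonglongrightarrow> r'"
  shows "(\<lambda>n. squash_proj (r n) u) \<longlonglongrightarrow> squash_proj r' u"
  unfolding squash_proj_def
proof (rule mult_op_tendsto[where B = 1])
  show "(\<lambda>x. ray (r n) (squash x)) \<in> borel_measurable borel" for n
    using bounded_borel_squash by (rule bounded_borel_measurable)
  show "norm (ray (r n) (squash x)) \<le> 1" for n x by (simp add: ray_def)
  \<comment> \<open>Convergence can fail only where \<open>squash x\<close> equals r'. By
    injectivity there is at most one such point; if there is none, \<open>SOME\<close> names an
    arbitrary one, which does no harm.\<close>
  have "{x. squash x = r'} \<subseteq> {SOME x. squash x = r'}"
    by (auto intro!: some_equality[symmetric])
      (metis less_irrefl linorder_neqE_linordered_idom squash_less_iff)
  then have "AE x in lborel. squash x \<noteq> r'"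
    using AE_lborel_singleton[of "SOME x. squash x = r'"] by (auto elim!: eventually_mono)
  then show "AE x in lborel. (\<lambda>n. ray (r n) (squash x)) \<longlonglongrightarrow> ray r' (squash x)"
  proof eventually_elim
    case (elim x)
    consider "r' < squash x" | "squash x < r'" using elim by linarith
    then have "\<forall>\<^sub>F n in sequentially. ray (r n) (squash x) = ray r' (squash x)"
    proof cases
      case 1
      from order_tendstoD(2)[OF assms this] show ?thesis
        by eventually_elim (use 1 in \<open>simp add: ray_def\<close>)
    next
      case 2
      from order_tendstoD(1)[OF assms this] show ?thesis
        by eventually_elim (use 2 in \<open>simp add: ray_def\<close>)
    qed
    then show ?case by (rule tendsto_eventually)
  qed
qed (rule bounded_borel_squash)

definition chart :: "real \<times> real \<Rightarrow> (L2 \<Rightarrow>\<^sub>L L2)" where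
  "chart p = Ad (chirp (fst p)) (Ad (adj fourier) (squash_proj (snd p)))"

lemma chart_apply: "chart p f
    = chirp (fst p) (adj fourier (squash_proj (snd p) (fourier (chirp (- fst p) f))))"
  by (simp add: chart_def Ad_apply adj_chirp adj_adj unitary_fourier)

lemma continuous_on_chart: "continuous_on UNIV (\<lambda>p. chart p f)"
  unfolding continuous_on_sequentially o_def
proof (intro ballI allI impI)
  fix x :: "nat \<Rightarrow> real \<times> real" and p assume "(\<forall>n. x n \<in> UNIV) \<and> x \<longlonglongrightarrow> p"
  then have x: "(\<lambda>n. fst (x n)) \<longlonglongrightarrow> fst p" "(\<lambda>n. snd (x n)) \<longlonglongrightarrow> snd p"
    by (auto intro: tendsto_fst tendsto_snd)
  have "(\<lambda>n. chirp (- fst (x n)) f) \<longlonglongrightarrow> chirp (- fst p) f"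
    by (rule chirp_tendsto[OF tendsto_minus[OF x(1)]])
  note blinfun.tendsto[OF tendsto_const this, of fourier]
  note tendsto_contraction_apply[OF norm_squash_proj_le squash_proj_tendsto[OF x(2)] this]
  note blinfun.tendsto[OF tendsto_const this, of "adj fourier"]
  note tendsto_contraction_apply[OF _ chirp_tendsto[OF x(1)] this]
  then show "(\<lambda>n. chart (x n) f) \<longlonglongrightarrow> chart p f"
    unfolding chart_apply by (simp add: unitary_norm[OF unitary_chirp])
qed

section \<open>Charts covering all half-planes\<close>

definition half_plane_sphere :: "(L2 \<Rightarrow>\<^sub>L L2) set" where
  "half_plane_sphere = insert 0 (insert id_blinfun half_planes)"

lemma sphere_complement: "P \<in> half_plane_sphere \<Longrightarrow> id_blinfun - P \<in> half_plane_sphere"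
  by (auto simp: half_plane_sphere_def half_planes_complement)

lemma sphere_fourier: "P \<in> half_plane_sphere \<Longrightarrow> Ad fourier P \<in> half_plane_sphere"
  by (auto simp: half_plane_sphere_def half_planes_fourier Ad_id Ad_zero unitary_fourier)

lemma chart_in_sphere: "-1 \<le> snd p \<Longrightarrow> snd p \<le> 1 \<Longrightarrow> chart p \<in> half_plane_sphere"
proof -
  assume r: "-1 \<le> snd p" "snd p \<le> 1"
  consider "snd p = 1" | "snd p = -1" | t where "snd p = squash t"
    using r squash_surj[of "snd p"] by (metis less_eq_real_def)
  then show ?thesis
  proof cases
    case (3 t)
    then have "chart p = Ad (chirp (fst p)) (mom_proj t)"
      by (simp add: chart_def squash_proj_squash mom_proj_def)
    then show ?thesis by (simp add: half_plane_sphere_def half_planes_chirp half_planes_mom_proj)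
  qed (auto simp: chart_def squash_proj_1 squash_proj_minus_1 half_plane_sphere_def Ad_zero Ad_id
      unitary_chirp unitary_adj unitary_fourier)
qed

lemma chart_squash: "chart (s, squash t) = Ad (chirp s) (mom_proj t)"
  by (simp add: chart_def squash_proj_squash mom_proj_def)

text \<open>Slopes of modulus greater than 1 would leave the square. A quarter turn by the Fourier
  transform replaces s by - 1 / s, possibly exchanging the half-plane with its complement.\<close>

lemma slanted_in_charts:
  assumes "P = Ad (chirp s) (mom_proj t)"
  obtains p where "p \<in> {-1..1} \<times> {-1..1}"
    "P = chart p \<or> P = Ad fourier (chart p) \<or> P = id_blinfun - Ad fourier (chart p)"
proof (cases "\<bar>s\<bar> \<le> 1")
  case True
  then have "- 1 \<le> s" "s \<le> 1" by linarith+
  then show thesis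
    using that[of "(s, squash t)"] assms squash_bounds[of t] by (auto simp: chart_squash)
next
  case False
  then have s0: "s \<noteq> 0" by auto
  \<comment> \<open>Carries \<open>pos_proj 0\<close> to the rotated projection
    \<open>Ad (adj fourier) P\<close>; its symbol has direction (-1, - s), from which the slope - 1
    / s is read off.\<close>
  let ?V = "adj fourier o\<^sub>L (chirp s o\<^sub>L (adj fourier o\<^sub>L (id_blinfun o\<^sub>L weyl 0 t)))"
  have V: "linear_symbol ?V (- 1) (- s) (0 - t)"
    using linear_symbol_adj_fourier[OF linear_symbol_chirp[OF linear_symbol_adj_fourier[OF
        linear_symbol_translation[OF linear_symbol_id]]], of s t] by simp
  have AdV: "Ad ?V (pos_proj 0) = Ad (adj fourier) P"
    using assms
    by (simp add: Ad_compose unitary_compose unitary_adj unitary_fourier unitary_chirp unitary_id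
        unitary_weyl Ad_id_op Ad_weyl_pos_proj mom_proj_def)
  have e: "- (- 1) / - s = - 1 / s" by simp
  obtain t' where "Ad (adj fourier) P = Ad (chirp (- 1 / s)) (mom_proj t') \<or>
      Ad (adj fourier) P = id_blinfun - Ad (chirp (- 1 / s)) (mom_proj t')"
    using Ad_linear_symbol_nonzero[OF V] s0 unfolding e AdV neg_equal_0_iff_equal by blast
  then have "P = Ad fourier (chart (- 1 / s, squash t')) \<or> P
      = id_blinfun - Ad fourier (chart (- 1 / s, squash t'))"
    using Ad_adj_right[OF unitary_fourier, of P]
    by (auto simp: chart_squash Ad_diff Ad_id unitary_fourier)
  moreover have "\<bar>- 1 / s\<bar> \<le> 1" using False by simp
  then have "(- 1 / s, squash t') \<in> {-1..1} \<times> {-1..1}"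
    using squash_bounds[of t']
      unfolding abs_le_iff mem_Times_iff fst_conv snd_conv atLeastAtMost_iff
    by linarith
  ultimately show thesis using that by blast
qed

lemma sphere_eq_charts:
  "half_plane_sphere = (let S = {-1..1} \<times> {-1..1} in chart ` S \<union> (\<lambda>p. Ad fourier (chart p)) ` S \<union>
    (\<lambda>p. id_blinfun - chart p) ` S \<union> (\<lambda>p. id_blinfun - Ad fourier (chart p)) ` S)" (is "_ = ?R")
proof
  show "?R \<subseteq> half_plane_sphere"
    by (auto simp: Let_def intro!: sphere_complement sphere_fourier chart_in_sphere)
  show "half_plane_sphere \<subseteq> ?R"
  proof
    fix P assume "P \<in> half_plane_sphere"
    then consider "P = 0" | "P = id_blinfun" | "P \<in> half_planes"
      by (auto simp: half_plane_sphere_def)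
    then show "P \<in> ?R"
    proof cases
      case 1
      then have "P = chart (0, 1)"
        by (simp add: chart_def squash_proj_1 Ad_zero unitary_adj unitary_fourier unitary_chirp)
      then show ?thesis by (auto simp: Let_def)
    next
      case 2
      then have "P = chart (0, - 1)"
        by (simp add: chart_def squash_proj_minus_1 Ad_id unitary_adj unitary_fourier unitary_chirp)
      then show ?thesis by (auto simp: Let_def)
    next
      case 3
      then show ?thesis
      proof (cases rule: half_planes_cases)
        case (vertical t)
        have "chirp 0 = id_blinfun"
          by (rule blinfun_eqI) (simp add: chirp_eq mult_op_const)
        then have "pos_proj t = Ad fourier (chart (0, squash t))"
          by (simp add: chart_squash Ad_id_op Ad_fourier_mom_proj)
        then show ?thesis
          using vertical squash_bounds[of t]
            by (auto simp: Let_def intro!: image_eqI[of _ _ "(0, squash t)"])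
      next
        case (slanted s t)
        obtain p where p: "p \<in> {-1..1} \<times> {-1..1}"
          "Ad (chirp s) (mom_proj t) = chart p \<or> Ad (chirp s) (mom_proj t) = Ad fourier (chart p) \<or>
            Ad (chirp s) (mom_proj t) = id_blinfun - Ad fourier (chart p)"
          using slanted_in_charts[OF refl] by metis
        have d: "id_blinfun - (id_blinfun - T) = T" for T :: "L2 \<Rightarrow>\<^sub>L L2" by simp
        have "P = chart p \<or> P = Ad fourier (chart p) \<or> P = id_blinfun - chart p \<or>
            P = id_blinfun - Ad fourier (chart p)"
          using slanted p(2) by (auto simp: d)
        then show ?thesis unfolding Let_def using p(1) by blast
      qed
    qed
  qed
qed

lemma closedin_sphere: "closedin strong_operator_topology half_plane_sphere"
proof -
  have cpt: "compactin euclidean ({-1..1} \<times> {-1..1} :: (real \<times> real) set)"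
    by (simp add: compact_Times)
  have cl: "closedin strong_operator_topology (\<Phi> ` ({-1..1} \<times> {-1..1}))"
    if "\<And>f. continuous_on UNIV (\<lambda>p. blinfun_apply (\<Phi> p) f)" for \<Phi> :: "real \<times> real \<Rightarrow> (L2 \<Rightarrow>\<^sub>L L2)"
    using that
    by (intro compactin_imp_closedin[OF Hausdorff_strong_operator_topology] image_compactin[OF cpt])
      (auto simp: continuous_on_strong_operator_topo_iff_coordinatewise)
  have c: "continuous_on UNIV (\<lambda>p. Ad fourier (chart p) f)" for f
    unfolding Ad_apply by (intro blinfun.continuous_on continuous_on_const continuous_on_chart)
  show ?thesis
    unfolding sphere_eq_charts Let_def
    by (intro closedin_Un cl)
      (auto simp: blinfun.diff_left intro!: continuous_intros continuous_on_chart c)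
qed

theorem FP_sphere_eq: "FP_sphere = half_plane_sphere"
proof
  let ?M = "FP_manifold \<union> {id_blinfun - P | P. P \<in> FP_manifold}"
  have "?M \<subseteq> half_plane_sphere"
    by (auto simp: FP_manifold_eq half_plane_sphere_def half_planes_chirp half_planes_mom_proj
      half_planes_complement)
  then show "FP_sphere \<subseteq> half_plane_sphere"
    unfolding FP_sphere_def by (rule closure_of_minimal[OF _ closedin_sphere])
  have M: "?M \<subseteq> FP_sphere"
    unfolding FP_sphere_def
      by (rule closure_of_subset) (simp add: strong_operator_topology_topspace)
  have comp: "id_blinfun - P \<in> ?M" if "P \<in> ?M" for P
    using that
  proof
    assume "P \<in> {id_blinfun - P | P. P \<in> FP_manifold}"
    then obtain P' where P': "P = id_blinfun - P'" "P' \<in> FP_manifold" by blast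
    then have "id_blinfun - P = P'" by simp
    then show ?thesis using P'(2) by simp
  qed blast
  have lim: "T \<in> FP_sphere" "id_blinfun - T \<in> FP_sphere"
    if "\<And>n. P n \<in> ?M" "\<And>f. (\<lambda>n. blinfun_apply (P n) f) \<longlonglongrightarrow> T f" for P and T :: "L2 \<Rightarrow>\<^sub>L L2"
  proof -
    show "T \<in> FP_sphere" unfolding FP_sphere_def by (rule strong_closureI) (fact that)+
    show "id_blinfun - T \<in> FP_sphere"
      unfolding FP_sphere_def
    proof (rule strong_closureI)
      show "id_blinfun - P n \<in> ?M" for n by (rule comp[OF that(1)])
      show "(\<lambda>n. blinfun_apply (id_blinfun - P n) f) \<longlonglongrightarrow> (id_blinfun - T) f" for f
        unfolding blinfun.diff_left by (intro tendsto_diff tendsto_const that)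
    qed
  qed
  have slanted_mem: "Ad (chirp s) (mom_proj t) \<in> ?M" "id_blinfun - Ad (chirp s) (mom_proj t) \<in> ?M"
    for s t
    unfolding FP_manifold_eq by blast+
  have E: "pos_proj t \<in> FP_sphere \<and> id_blinfun - pos_proj t \<in> FP_sphere" for t
  proof -
    \<comment> \<open>A chirp conjugated by the Fourier transform: a shear of the phase plane that
      tilts vertical lines. For s = 1 / (n + 1) the tilted half-planes are slanted, and as U s tends
      strongly to the identity they approach the vertical one.\<close>
    define U where "U s = fourier o\<^sub>L (chirp s o\<^sub>L adj fourier)" for s
    have uU: "unitary (U s)" for s
      unfolding U_def by (intro unitary_compose unitary_fourier unitary_chirp unitary_adj)
    have aU: "adj (U s) = U (- s)" for s
      unfolding U_def
      by (simp add: adj_compose unitary_compose unitary_fourier unitary_chirp unitary_adj adj_chirp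
        adj_adj)
        (rule blinfun_eqI, simp)
    have mem: "Ad (U (1 / real (Suc n))) (pos_proj t) \<in> ?M" for n
    proof -
      let ?s = "1 / real (Suc n)"
      let ?V = "fourier o\<^sub>L (chirp ?s o\<^sub>L (adj fourier o\<^sub>L (id_blinfun o\<^sub>L weyl 0 t)))"
      have V: "linear_symbol ?V 1 ?s (0 - t)"
        using linear_symbol_fourier[OF linear_symbol_chirp[OF linear_symbol_adj_fourier[OF
            linear_symbol_translation[OF linear_symbol_id]]], of ?s t] by simp
      have AdV: "Ad ?V (pos_proj 0) = Ad (U ?s) (pos_proj t)"
        by (simp add: U_def Ad_compose unitary_compose unitary_adj unitary_fourier unitary_chirp
          unitary_id
            unitary_weyl Ad_id_op Ad_weyl_pos_proj)
      have "?s \<noteq> 0" by simp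
      from Ad_linear_symbol_nonzero[OF V this] show ?thesis
        unfolding AdV using slanted_mem by (elim exE disjE) simp_all
    qed
    have lim': "(\<lambda>n. Ad (U (1 / real (Suc n))) (pos_proj t) f) \<longlonglongrightarrow> pos_proj t f" for f
    proof -
      have lim0: "(\<lambda>n. U (s n) (u n)) \<longlonglongrightarrow> u'" if "s \<longlonglongrightarrow> 0" "u \<longlonglongrightarrow> u'"
        for s :: "nat \<Rightarrow> real" and u and u' :: L2
      proof -
        have "(\<lambda>n. adj fourier (u n)) \<longlonglongrightarrow> adj fourier u'"
          by (rule blinfun.tendsto[OF tendsto_const that(2)])
        from tendsto_contraction_apply[OF _ chirp_tendsto[OF that(1)] this]
        have "(\<lambda>n. chirp (s n) (adj fourier (u n))) \<longlonglongrightarrow> chirp 0 (adj fourier u')"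
          by (simp add: unitary_norm[OF unitary_chirp])
        from blinfun.tendsto[OF tendsto_const this, of fourier]
        have "(\<lambda>n. fourier (chirp (s n) (adj fourier (u n)))) \<longlonglongrightarrow> fourier (adj fourier u')"
          by (simp add: chirp_eq[of 0] mult_op_const)
        then show ?thesis by (simp add: U_def unitary_adj_right[OF unitary_fourier])
      qed
      have s: "(\<lambda>n. 1 / real (Suc n)) \<longlonglongrightarrow> 0" by (rule LIMSEQ_Suc[OF lim_1_over_n])
      have "(\<lambda>n. - (1 / real (Suc n))) \<longlonglongrightarrow> 0" using tendsto_minus[OF s] by simp
      note blinfun.tendsto[OF tendsto_const lim0[OF this tendsto_const], of "pos_proj t" f]
      from lim0[OF s this] show ?thesis unfolding Ad_apply aU .
    qed
    show ?thesis using lim[OF mem lim'] by blast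
  qed
  have closed: "T \<in> FP_sphere" if "\<And>n. P n \<in> FP_sphere" "\<And>f. (\<lambda>n. blinfun_apply (P n) f) \<longlonglongrightarrow> T f"
    for P and T :: "L2 \<Rightarrow>\<^sub>L L2"
    using strong_closureI[of P FP_sphere T] that unfolding FP_sphere_def by simp
  \<comment> \<open>The rays starting at n shrink to 0 and those starting at - n grow to the
    identity; in the compactified parameter this is convergence to 1 and to -1.\<close>
  have r: "(\<lambda>n. squash (real n)) \<longlonglongrightarrow> 1" "(\<lambda>n. squash (- real n)) \<longlonglongrightarrow> - 1"
    using LIMSEQ_n_over_Suc_n[where 'a = real] tendsto_minus[OF
      LIMSEQ_n_over_Suc_n[where 'a = real]]
    by (simp_all add: squash_def)
  have "0 \<in> FP_sphere"
  proof (rule closed)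
    show "pos_proj (real n) \<in> FP_sphere" for n using E by simp
    show "(\<lambda>n. pos_proj (real n) f) \<longlonglongrightarrow> (0 :: L2 \<Rightarrow>\<^sub>L L2) f" for f
      using squash_proj_tendsto[OF r(1), of f] by (simp only: squash_proj_squash squash_proj_1)
  qed
  moreover have "id_blinfun \<in> FP_sphere"
  proof (rule closed)
    show "pos_proj (- real n) \<in> FP_sphere" for n using E by simp
    show "(\<lambda>n. pos_proj (- real n) f) \<longlonglongrightarrow> id_blinfun f" for f
      using squash_proj_tendsto[OF r(2), of f]
        by (simp only: squash_proj_squash squash_proj_minus_1)
  qed
  moreover have "half_planes \<subseteq> FP_sphere"
  proof
    fix P assume "P \<in> half_planes"
    then show "P \<in> FP_sphere"
      by (cases rule: half_planes_cases)
        (use E subsetD[OF M slanted_mem(1)] subsetD[OF M slanted_mem(2)] in auto)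
  qed
  ultimately show "half_plane_sphere \<subseteq> FP_sphere" by (simp add: half_plane_sphere_def)
qed

section \<open>Order structure\<close>

text \<open>For orthogonal projections this is inclusion of ranges; as an equation between products
  it is stable under conjugation.\<close>

definition below :: "(L2 \<Rightarrow>\<^sub>L L2) \<Rightarrow> (L2 \<Rightarrow>\<^sub>L L2) \<Rightarrow> bool" where
  "below S T \<longleftrightarrow> (\<forall>f. T (S f) = S f)"

lemma below_Ad: "unitary U \<Longrightarrow> below (Ad U S) (Ad U T) \<longleftrightarrow> below S T"
proof -
  assume U: "unitary U"
  have *: "below (Ad V S) (Ad V T)" if "unitary V" "below S T" for V S T
    using that by (simp add: below_def Ad_apply unitary_adj_left)
  show ?thesis using *[OF U] *[OF unitary_adj[OF U], of "Ad U S" "Ad U T"]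
    by (auto simp: Ad_adj_left[OF U])
qed

text \<open>Taking adjoints turns T S = S into S T = S.\<close>

lemma below_complement: "below (id_blinfun - T) (id_blinfun - S)"
  if "below S T" "orth_proj S" "orth_proj T"
proof -
  have "S (T f) = S f" for f
    using that by (intro cinner_eqI) (simp add: below_def orth_proj_def)
  then show ?thesis by (simp add: below_def blinfun.diff_left blinfun.diff_right)
qed

lemma AE_lborel_ex:
  fixes a b :: real
  assumes "AE x in lborel. P x" "a < b"
  shows "\<exists>x. a < x \<and> x < b \<and> P x"
proof (rule ccontr)
  assume "\<not> ?thesis"
  then have "AE x in lborel. x \<notin> {a<..<b}"
    using assms(1) by (auto elim!: eventually_mono)
  then have "{a<..<b} \<in> null_sets lborel" by (subst AE_iff_null_sets) auto
  then have "emeasure lborel {a<..<b} = 0" by (rule null_setsD1)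
  then show False using assms(2) by simp
qed

lemma mult_op_eq_imp_AE:
  assumes "bounded_borel \<phi>" "bounded_borel \<psi>" "square_integrable h" "\<And>x. h x \<noteq> 0"
    "mult_op \<phi> (L2_of h) = mult_op \<psi> (L2_of h)"
  shows "AE x in lborel. \<phi> x = \<psi> x"
proof -
  have "AE x in lborel. \<phi> x * h x = \<psi> x * h x"
    using assms by (simp add: mult_op_L2_of L2_of_eq_iff square_integrable_bounded_borel)
  then show ?thesis by eventually_elim (use assms(4) in simp)
qed

lemma mult_op_commute:
  "bounded_borel \<phi> \<Longrightarrow> bounded_borel \<psi> \<Longrightarrow> mult_op \<phi> (mult_op \<psi> u) = mult_op \<psi> (mult_op \<phi> u)"
  by (simp add: mult_op_mult mult.commute)

lemma gauss_nonzero [simp]: "gauss b x \<noteq> 0"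
  by (simp add: gauss_def)

lemma below_pos_proj_iff: "below (pos_proj s) (pos_proj t) \<longleftrightarrow> t \<le> s"
proof
  assume "t \<le> s"
  then have "(\<lambda>x. ray t x * ray s x) = ray s" by (auto simp: ray_def fun_eq_iff)
  then show "below (pos_proj s) (pos_proj t)" by (simp add: below_def pos_proj_def mult_op_mult)
next
  assume "below (pos_proj s) (pos_proj t)"
  then have "mult_op (\<lambda>x. ray t x * ray s x) (L2_of (gauss 0)) = mult_op (ray s) (L2_of (gauss 0))"
    by (simp add: below_def pos_proj_def mult_op_mult)
  then have ae: "AE x in lborel. ray t x * ray s x = ray s x"
    by (intro mult_op_eq_imp_AE) (auto intro: bounded_borel_mult gauss_nonzero)
  show "t \<le> s"
  proof (rule ccontr)
    assume "\<not> t \<le> s"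
    then obtain x where "s < x" "x < t" "ray t x * ray s x = ray s x"
      using AE_lborel_ex[OF ae, of s t] by auto
    then show False by (simp add: ray_def)
  qed
qed

lemma below_mom_proj_iff: "below (mom_proj s) (mom_proj t) \<longleftrightarrow> t \<le> s"
  unfolding mom_proj_def by (simp add: below_Ad unitary_adj unitary_fourier below_pos_proj_iff)

lemma pos_proj_inject: "pos_proj s = pos_proj t \<longleftrightarrow> s = t"
  using below_pos_proj_iff by (metis antisym order_refl)

text \<open>Such a function is supported neither on a ray nor off it. This separates rays from every
  projection with nowhere vanishing functions in its range and kernel.\<close>

lemma pos_proj_not_nonvanishing:
  assumes h: "square_integrable h" "\<And>x. h x \<noteq> 0"
  shows "pos_proj t (L2_of h) \<noteq> L2_of h" "pos_proj t (L2_of h) \<noteq> 0"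
proof -
  show "pos_proj t (L2_of h) \<noteq> L2_of h"
  proof
    assume "pos_proj t (L2_of h) = L2_of h"
    then have "mult_op (ray t) (L2_of h) = mult_op (\<lambda>_. 1) (L2_of h)"
      by (simp add: pos_proj_def mult_op_const)
    then have "AE x in lborel. ray t x = 1" using h by (intro mult_op_eq_imp_AE) auto
    from AE_lborel_ex[OF this, of "t - 1" t] show False by (auto simp: ray_def)
  qed
  show "pos_proj t (L2_of h) \<noteq> 0"
  proof
    assume "pos_proj t (L2_of h) = 0"
    then have "mult_op (ray t) (L2_of h) = mult_op (\<lambda>_. 0) (L2_of h)"
      by (simp add: pos_proj_def mult_op_const)
    then have "AE x in lborel. ray t x = 0" using h by (intro mult_op_eq_imp_AE) auto
    from AE_lborel_ex[OF this, of t "t + 1"] show False by (auto simp: ray_def)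
  qed
qed

text \<open>Together with the invariance of 0 and the identity under conjugation, this lets
  automorphisms of the sphere act on the half-planes alone.\<close>

lemma half_planes_nontrivial:
  assumes "P \<in> half_planes"
  shows "P \<noteq> 0" "P \<noteq> id_blinfun"
proof -
  obtain V a b r where V: "linear_symbol V a b r" "P = Ad V (pos_proj 0)"
    using assms unfolding half_planes_def by blast
  have uV: "unitary V" using V(1) by (rule linear_symbol_unitary)
  have "pos_proj 0 \<noteq> 0" "pos_proj 0 \<noteq> id_blinfun"
    using pos_proj_not_nonvanishing[of "gauss 0" 0] gauss_nonzero by auto
  then show "P \<noteq> 0" "P \<noteq> id_blinfun"
    using Ad_inject[OF uV, of "pos_proj 0"] Ad_zero[OF uV] Ad_id[OF uV] V(2) by metis+
qed

text \<open>The functions \<open>1 / (1 - \<i> x)\<close> and \<open>1 / (1 + \<i> x)\<close> lie in the Hardy space and in its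
  complement, and neither vanishes anywhere on the line.\<close>

lemma mom_proj_nonvanishing:
  obtains h k where "square_integrable h" "\<And>x. h x \<noteq> 0" "mom_proj 0 (L2_of h) = L2_of h"
    "square_integrable k" "\<And>x. k x \<noteq> 0" "mom_proj 0 (L2_of k) = 0"
proof -
  let ?k = "\<lambda>x. complex_of_real (1 / sqrt (2 * pi)) * (1 / (1 + \<i> * of_real 0 + \<i> * of_real x))"
  let ?h = "\<lambda>x. ?k (- x)"
  let ?c = "L2_of (cauchy_test 0)"
  note k = fourier_cauchy_test[of 0]
  have nz: "?k x \<noteq> 0" for x
  proof -
    have "1 + \<i> * of_real 0 + \<i> * of_real x \<noteq> 0" by (simp add: complex_eq_iff)
    then show ?thesis by simp
  qed
  have sh: "square_integrable ?h" using square_integrable_affine[of "-1" ?k 0] k(2) by simp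
  have h: "L2_of ?h = adj fourier ?c"
    using affine_op_L2_of[of "-1" ?k 0] k by (simp add: adj_fourier fourier_reflection)
  have "(\<lambda>x. ray 0 x * cauchy_test 0 x) = cauchy_test 0"
    by (auto simp: ray_def cauchy_test_def fun_eq_iff indicator_def)
  then have c: "pos_proj 0 ?c = ?c"
    by (simp add: pos_proj_def mult_op_L2_of square_integrable_cauchy_test)
  then have 1: "mom_proj 0 (L2_of ?h) = L2_of ?h"
    unfolding h mom_proj_apply by (simp add: unitary_adj_right unitary_fourier)
  have "AE x in lborel. ray 0 x * cauchy_test 0 (- x) = 0"
    using AE_lborel_singleton[of 0]
      by eventually_elim (auto simp: ray_def cauchy_test_def indicator_def)
  moreover have s: "square_integrable (\<lambda>x. cauchy_test 0 (- x))"
    using square_integrable_affine[of "-1" "cauchy_test 0" 0] square_integrable_cauchy_test by simp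
  ultimately have "pos_proj 0 (L2_of (\<lambda>x. cauchy_test 0 (- x))) = 0"
    using square_integrable_zero
    by (simp add: pos_proj_def mult_op_L2_of zero_L2_def L2_of_eq_iff
      square_integrable_bounded_borel)
  moreover have "fourier (fourier ?c) = L2_of (\<lambda>x. cauchy_test 0 (- x))"
    using affine_op_L2_of[of "-1" "cauchy_test 0" 0] square_integrable_cauchy_test
    by (simp add: fourier_fourier)
  ultimately have "mom_proj 0 (L2_of ?k) = 0"
    unfolding k(1)[symmetric] mom_proj_apply by (simp add: blinfun.zero_right)
  with that[of ?h ?k] sh nz 1 k(2) show thesis by blast
qed

text \<open>A chirp and a modulation multiply by unimodular functions, so they transport the two
  functions of \<open>mom_proj_nonvanishing\<close> without creating zeros.\<close>

lemma slanted_nonvanishing: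
  obtains h k where "square_integrable h" "\<And>x. h x \<noteq> 0" "Ad (chirp s) (mom_proj t) (L2_of h)
      = L2_of h"
    "square_integrable k" "\<And>x. k x \<noteq> 0" "Ad (chirp s) (mom_proj t) (L2_of k) = 0"
proof -
  obtain h k where hk: "square_integrable h" "\<And>x. h x \<noteq> 0" "mom_proj 0 (L2_of h) = L2_of h"
    "square_integrable k" "\<And>x. k x \<noteq> 0" "mom_proj 0 (L2_of k) = 0"
    using mom_proj_nonvanishing by metis
  let ?e = "\<lambda>x. iexp (- (s * x\<^sup>2 / 2)) * iexp (t * x)"
  have b: "bounded_borel (\<lambda>x. iexp (- (s * x\<^sup>2 / 2)))"
    "bounded_borel (\<lambda>x. iexp (t * x))" "bounded_borel ?e"
    by (intro bounded_borel_mult bounded_borel_exp; measurable)+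
  define U where "U = chirp s o\<^sub>L modulation t"
  have uU: "unitary U" unfolding U_def by (intro unitary_compose unitary_chirp unitary_modulation)
  have U: "U (L2_of f) = L2_of (\<lambda>x. ?e x * f x)" if "square_integrable f" for f
  proof -
    have "U (L2_of f) = mult_op ?e (L2_of f)"
      unfolding U_def chirp_eq modulation_def blinfun_apply_blinfun_compose
        by (rule mult_op_mult[OF b(1,2)])
    then show ?thesis by (simp only: mult_op_L2_of[OF b(3) that])
  qed
  have A: "Ad (chirp s) (mom_proj t) = Ad U (mom_proj 0)"
    unfolding U_def by (simp add: Ad_compose unitary_chirp unitary_modulation
      Ad_modulation_mom_proj)
  have "Ad U (mom_proj 0) (U f) = U (mom_proj 0 f)" for f by (simp add: Ad_intertwines[OF uU])
  then have "Ad (chirp s) (mom_proj t) (L2_of (\<lambda>x. ?e x * h x)) = L2_of (\<lambda>x. ?e x * h x)"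
    "Ad (chirp s) (mom_proj t) (L2_of (\<lambda>x. ?e x * k x)) = 0"
    unfolding A U[OF hk(1), symmetric] U[OF hk(4), symmetric]
      by (simp_all add: hk blinfun.zero_right)
  moreover have "square_integrable (\<lambda>x. ?e x * h x)" "square_integrable (\<lambda>x. ?e x * k x)"
    by (rule square_integrable_bounded_borel[OF b(3)], fact hk)+
  ultimately show thesis
    using that[of "\<lambda>x. ?e x * h x" "\<lambda>x. ?e x * k x"] hk(2,5) by simp
qed

text \<open>A nowhere vanishing element of the range keeps the range out of a ray; a nowhere
  vanishing element of the kernel keeps a ray out of the range.\<close>

lemma slanted_comparable:
  assumes P: "orth_proj P" and hk: "square_integrable h" "\<And>x. h x \<noteq> 0" "P (L2_of h) = L2_of h"
    "square_integrable k" "\<And>x. k x \<noteq> 0" "P (L2_of k) = 0"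
  shows "\<not> below P (pos_proj t)" "\<not> below (pos_proj t) P"
proof -
  show "\<not> below P (pos_proj t)"
    using pos_proj_not_nonvanishing(1)[OF hk(1,2)] hk(3) unfolding below_def by metis
  show "\<not> below (pos_proj t) P"
  proof
    assume "below (pos_proj t) P"
    then have "pos_proj t (P f) = pos_proj t f" for f
      using P orth_proj_pos_proj[of t] by (intro cinner_eqI) (simp add: below_def orth_proj_def)
    from this[of "L2_of k"] show False
      using pos_proj_not_nonvanishing(2)[OF hk(4,5)] hk(6) by (simp add: blinfun.zero_right)
  qed
qed

text \<open>Slanted projections and their complements have nowhere vanishing functions in range and
  kernel. The complement of a ray contains a neighbourhood of - \<infinity> and misses one of
  \<infinity>, whereas \<open>pos_proj 0\<close> does the opposite.\<close>

lemma half_planes_comparable: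
  assumes P: "P \<in> half_planes" and cmp: "below P (pos_proj 0) \<or> below (pos_proj 0) P"
  shows "\<exists>t. P = pos_proj t"
  using P
proof (cases rule: half_planes_cases)
  case (vertical t)
  have False if PE: "P = id_blinfun - pos_proj t"
  proof -
    let ?g = "L2_of (gauss 0)"
    have b: "bounded_borel (\<lambda>x. 1 - ray t x)"
      using bounded_borel_add[OF bounded_borel_const[of 1]
        bounded_borel_mult[OF bounded_borel_const[of "-1"] bounded_borel_ray]]
      by simp
    have P': "P = mult_op (\<lambda>x. 1 - ray t x)" using PE by (simp add: pos_proj_complement)
    from cmp show False
    proof
      assume "below P (pos_proj 0)"
      then have "mult_op (\<lambda>x. ray 0 x * (1 - ray t x)) ?g = mult_op (\<lambda>x. 1 - ray t x) ?g"
        using b by (simp add: below_def P' pos_proj_def mult_op_mult)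
      then have ae: "AE x in lborel. ray 0 x * (1 - ray t x) = 1 - ray t x"
        using b by (intro mult_op_eq_imp_AE[of _ _ "gauss 0"])
          (auto intro: bounded_borel_mult gauss_nonzero)
      \<comment> \<open>To the left of both 0 and t a point belongs to the set of P but not to the
        ray at 0.\<close>
      have "min 0 t - 1 < min 0 t" by linarith
      from AE_lborel_ex[OF ae this]
      obtain x where "x < min 0 t" "ray 0 x * (1 - ray t x) = 1 - ray t x" by blast
      then show False by (simp add: ray_def)
    next
      assume "below (pos_proj 0) P"
      then have "mult_op (\<lambda>x. (1 - ray t x) * ray 0 x) ?g = mult_op (ray 0) ?g"
        using b by (simp add: below_def P' pos_proj_def mult_op_mult)
      then have ae: "AE x in lborel. (1 - ray t x) * ray 0 x = ray 0 x"
        using b by (intro mult_op_eq_imp_AE[of _ _ "gauss 0"])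
          (auto intro: bounded_borel_mult gauss_nonzero)
      \<comment> \<open>To the right of both 0 and t a point belongs to the ray at 0 but not to the
        set of P.\<close>
      have "max 0 t < max 0 t + 1" by linarith
      from AE_lborel_ex[OF ae this]
      obtain x where "max 0 t < x" "(1 - ray t x) * ray 0 x = ray 0 x" by blast
      then show False by (simp add: ray_def)
    qed
  qed
  then show ?thesis using vertical by blast
next
  case (slanted s t)
  let ?A = "Ad (chirp s) (mom_proj t)"
  obtain h k where hk: "square_integrable h" "\<And>x. h x \<noteq> 0" "?A (L2_of h) = L2_of h"
    "square_integrable k" "\<And>x. k x \<noteq> 0" "?A (L2_of k) = 0"
    by (rule slanted_nonvanishing[of s t]) (rule that)
  have A: "orth_proj ?A" by (intro orth_proj_Ad unitary_chirp orth_proj_mom_proj)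
  then have A': "orth_proj (id_blinfun - ?A)"
    by (auto simp: orth_proj_def blinfun.diff_left blinfun.diff_right cinner_diff_left
      cinner_diff_right)
  have c: "(id_blinfun - ?A) (L2_of k) = L2_of k" "(id_blinfun - ?A) (L2_of h) = 0"
    using hk by (simp_all add: blinfun.diff_left)
  have False
    using slanted cmp slanted_comparable[OF A hk, of 0]
      slanted_comparable[OF A' hk(4,5) c(1) hk(1,2) c(2), of 0] by blast
  then show ?thesis ..
qed

lemma mom_proj_0_not_vertical: "mom_proj 0 \<noteq> pos_proj t" "mom_proj 0 \<noteq> id_blinfun - pos_proj t"
proof -
  obtain h k where hk: "square_integrable h" "\<And>x. h x \<noteq> 0" "mom_proj 0 (L2_of h) = L2_of h"
    using mom_proj_nonvanishing by metis
  show "mom_proj 0 \<noteq> pos_proj t" using hk pos_proj_not_nonvanishing(1)[of h t] by metis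
  show "mom_proj 0 \<noteq> id_blinfun - pos_proj t"
  proof
    assume "mom_proj 0 = id_blinfun - pos_proj t"
    then have "L2_of h - pos_proj t (L2_of h) = L2_of h"
      using hk(3) by (simp add: blinfun.diff_left)
    then show False using pos_proj_not_nonvanishing(2)[OF hk(1,2)] by simp
  qed
qed

lemma half_planes_comparable_mom:
  assumes P: "P \<in> half_planes" and cmp: "below P (mom_proj 0) \<or> below (mom_proj 0) P"
  shows "\<exists>t. P = mom_proj t"
proof -
  have "below (Ad fourier P) (pos_proj 0) \<or> below (pos_proj 0) (Ad fourier P)"
    using cmp below_Ad[OF unitary_fourier] Ad_fourier_mom_proj by metis
  then obtain t where "Ad fourier P = pos_proj t"
    using half_planes_comparable[OF half_planes_fourier[OF P]] by blast
  then show ?thesis using mom_proj_eqI by blast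
qed

section \<open>The group generated by chirps, modulations, phases and the Fourier transform\<close>

lemma group_unitary_group: "group unitary_group"
proof (rule groupI)
  fix U assume "U \<in> carrier unitary_group"
  then have U: "unitary U" by (simp add: unitary_group_def)
  show "\<exists>V\<in>carrier unitary_group. V \<otimes>\<^bsub>unitary_group\<^esub> U = \<one>\<^bsub>unitary_group\<^esub>"
    using unitary_adj[OF U] unitary_adj_left[OF U]
    by (intro bexI[of _ "adj U"]) (auto simp: unitary_group_def intro!: blinfun_eqI)
qed (auto simp: unitary_group_def unitary_compose unitary_id intro!: blinfun_eqI)

lemma inv_unitary_group: "unitary U \<Longrightarrow> inv\<^bsub>unitary_group\<^esub> U = adj U"
proof -
  assume U: "unitary U"
  have "adj U o\<^sub>L U = id_blinfun" by (rule blinfun_eqI) (simp add: unitary_adj_left[OF U])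
  then show ?thesis
    using U unitary_adj[OF U]
    by (intro group.inv_equality[OF group_unitary_group]) (auto simp: unitary_group_def)
qed

definition FP_group :: "(L2 \<Rightarrow>\<^sub>L L2) set" where
  "FP_group = generate unitary_group
    (range chirp \<union> range modulation \<union> {fourier} \<union> range phase)"

lemma FP_generators_carrier:
  "range chirp \<union> range modulation \<union> {fourier} \<union> range phase \<subseteq> carrier unitary_group"
  by (auto simp: unitary_group_def unitary_chirp unitary_modulation unitary_fourier unitary_phase)

lemma FP_group_unitary: "U \<in> FP_group \<Longrightarrow> unitary U"
  using group.generate_incl[OF group_unitary_group FP_generators_carrier]
  by (auto simp: FP_group_def unitary_group_def)

lemma FP_group_compose: "U \<in> FP_group \<Longrightarrow> V \<in> FP_group \<Longrightarrow> U o\<^sub>L V \<in> FP_group"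
  using generate.eng[of U unitary_group _ V] by (simp add: FP_group_def unitary_group_def)

lemma FP_group_adj: "U \<in> FP_group \<Longrightarrow> adj U \<in> FP_group"
  using group.generate_m_inv_closed[OF group_unitary_group FP_generators_carrier, of U]
    inv_unitary_group[of U] FP_group_unitary[of U] by (simp add: FP_group_def)

lemma FP_group_generators:
  "chirp s \<in> FP_group" "modulation s \<in> FP_group" "phase s \<in> FP_group" "fourier \<in> FP_group"
  unfolding FP_group_def by (auto intro: generate.incl)

lemma FP_group_translation: "weyl 0 t \<in> FP_group"
proof -
  have "weyl 0 t = fourier o\<^sub>L (modulation t o\<^sub>L adj fourier)"
    by (rule blinfun_eqI)
      (simp add: modulation_eq_weyl fourier_weyl unitary_adj_right unitary_fourier)
  then show ?thesis by (simp add: FP_group_compose FP_group_adj FP_group_generators)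
qed

text \<open>A translation reaches every ray, a further quarter turn and a chirp reach the slanted
  half-planes, and a reflection performed first reaches the complements.\<close>

lemma half_planes_transitive:
  assumes "P \<in> half_planes"
  shows "\<exists>V\<in>FP_group. P = Ad V (pos_proj 0)"
proof -
  have E: "pos_proj t = Ad (weyl 0 t) (pos_proj 0)" for t by (simp add: Ad_weyl_pos_proj)
  have Q: "Ad (chirp s) (mom_proj t) = Ad (chirp s o\<^sub>L (adj fourier o\<^sub>L weyl 0 t)) (pos_proj 0)"
    for s t
    by (simp add: mom_proj_def E[of t] Ad_compose unitary_compose unitary_chirp unitary_adj
        unitary_fourier unitary_weyl)
  have C: "\<exists>V\<in>FP_group. id_blinfun - Ad W (pos_proj 0) = Ad V (pos_proj 0)" if "W \<in> FP_group" for W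
  proof (rule bexI)
    show "W o\<^sub>L (fourier o\<^sub>L fourier) \<in> FP_group"
      by (intro FP_group_compose FP_group_generators that)
    show "id_blinfun - Ad W (pos_proj 0) = Ad (W o\<^sub>L (fourier o\<^sub>L fourier)) (pos_proj 0)"
      by (simp add: Ad_compose[OF _ unitary_compose] FP_group_unitary[OF that] unitary_fourier
          Ad_fourier_fourier_pos_proj Ad_diff Ad_id)
  qed
  have W: "weyl 0 t \<in> FP_group" "chirp s o\<^sub>L (adj fourier o\<^sub>L weyl 0 t) \<in> FP_group" for s t
    by (intro FP_group_compose FP_group_adj FP_group_translation FP_group_generators)+
  from assms show ?thesis
    by (cases rule: half_planes_cases) (use E Q C W in metis)+
qed

section \<open>The generated group acts by automorphisms\<close>

abbreviation FP_aut :: "(L2 \<Rightarrow>\<^sub>L L2) set" where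
  "FP_aut \<equiv> unitary_automorphism_group half_plane_sphere"

lemma FP_autI:
  assumes U: "unitary U" and "\<And>P. P \<in> half_planes \<Longrightarrow> Ad U P \<in> half_planes"
    "\<And>P. P \<in> half_planes \<Longrightarrow> Ad (adj U) P \<in> half_planes"
  shows "U \<in> FP_aut"
proof -
  have 1: "Ad U P \<in> half_plane_sphere" "Ad (adj U) P \<in> half_plane_sphere" if "P \<in> half_plane_sphere"
    for P
    using assms that by (auto simp: half_plane_sphere_def Ad_id Ad_zero unitary_adj)
  have "P \<in> Ad U ` half_plane_sphere" if "P \<in> half_plane_sphere" for P
    using 1(2)[OF that] Ad_adj_right[OF U, of P] by (metis imageI)
  then show ?thesis using 1(1) U by (auto simp: unitary_automorphism_group_def)
qed

lemma FP_aut_compose: "U \<in> FP_aut \<Longrightarrow> V \<in> FP_aut \<Longrightarrow> U o\<^sub>L V \<in> FP_aut"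
proof -
  assume U: "U \<in> FP_aut" and V: "V \<in> FP_aut"
  have "Ad (U o\<^sub>L V) ` half_plane_sphere = Ad U ` (Ad V ` half_plane_sphere)"
    unfolding image_image using U V by (simp add: unitary_automorphism_group_def Ad_compose)
  then show ?thesis using U V by (simp add: unitary_automorphism_group_def unitary_compose)
qed

lemma FP_aut_unitary: "U \<in> FP_aut \<Longrightarrow> unitary U"
  by (simp add: unitary_automorphism_group_def)

lemma FP_aut_adj: "U \<in> FP_aut \<Longrightarrow> adj U \<in> FP_aut"
proof -
  assume U: "U \<in> FP_aut"
  then have u: "unitary U" by (rule FP_aut_unitary)
  have "Ad (adj U) ` half_plane_sphere = Ad (adj U) ` (Ad U ` half_plane_sphere)"
    using U by (simp add: unitary_automorphism_group_def)
  also have "\<dots> = half_plane_sphere" by (simp add: image_image Ad_adj_left[OF u])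
  finally show ?thesis using u by (simp add: unitary_automorphism_group_def unitary_adj)
qed

lemma FP_aut_half_planes:
  assumes U: "U \<in> FP_aut" and P: "P \<in> half_planes"
  shows "Ad U P \<in> half_planes"
proof -
  have u: "unitary U" using U by (rule FP_aut_unitary)
  have "Ad U P \<in> half_plane_sphere"
    using U P by (auto simp: unitary_automorphism_group_def half_plane_sphere_def)
  moreover have "Ad U P \<noteq> 0" "Ad U P \<noteq> id_blinfun"
    using half_planes_nontrivial[OF P] Ad_inject[OF u, of P] Ad_zero[OF u] Ad_id[OF u] by metis+
  ultimately show ?thesis by (simp add: half_plane_sphere_def)
qed

lemma FP_group_subset_aut: "FP_group \<subseteq> FP_aut"
proof
  have gen: "U \<in> FP_aut" if "U \<in> range chirp \<union> range modulation \<union> {fourier} \<union> range phase" for U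
    using that
    by (auto intro!: FP_autI simp: unitary_chirp unitary_modulation unitary_fourier unitary_phase
        adj_chirp adj_modulation adj_phase half_planes_chirp half_planes_modulation
          half_planes_fourier
        half_planes_adj_fourier half_planes_phase)
  fix U assume "U \<in> FP_group"
  then show "U \<in> FP_aut"
    unfolding FP_group_def
  proof induction
    case one
    show ?case by (auto intro!: FP_autI simp: unitary_group_def unitary_id adj_id Ad_id_op)
  next
    case (incl h)
    then show ?case by (rule gen)
  next
    case (inv h)
    then show ?case using gen[OF inv] by (simp add: inv_unitary_group FP_aut_unitary FP_aut_adj)
  next
    case (eng h1 h2)
    then show ?case by (simp add: unitary_group_def FP_aut_compose)
  qed
qed

text \<open>The factorisation of the diagonal matrix diag(a, 1/a) of SL(2, R) into shears and
  quarter turns, transferred to chirps and Fourier transforms. On the Fourier side V scales position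
  by a positive factor, so the ray at 0, and with it \<open>mom_proj 0\<close>, is fixed.\<close>

lemma FP_group_dilation:
  assumes a: "a > 0"
  obtains V where "V \<in> FP_group" "\<And>l u. V (modulation l u) = modulation (a * l) (V u)"
    "Ad V (mom_proj 0) = mom_proj 0"
proof -
  define V where "V = chirp a
      o\<^sub>L (fourier o\<^sub>L (chirp (1 / a) o\<^sub>L (adj fourier o\<^sub>L (chirp a o\<^sub>L adj fourier))))"
  have V: "V \<in> FP_group" unfolding V_def
    by (intro FP_group_compose FP_group_adj FP_group_generators)
  then have uV: "unitary V" by (rule FP_group_unitary)
  have VW: "V (weyl l m u) = weyl (a * l) (m / a) (V u)" for l m u
    using a by (simp add: V_def adj_fourier_weyl chirp_weyl fourier_weyl field_simps)
  define T where "T = fourier o\<^sub>L (V o\<^sub>L adj fourier)"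
  have uT: "unitary T" unfolding T_def by (intro unitary_compose unitary_fourier uV unitary_adj)
  have "Ad T (pos_proj 0)
      = (if 1 / a > 0 then pos_proj (- 0 / (1 / a)) else id_blinfun - pos_proj (- 0 / (1 / a)))"
    by (rule Ad_affine_pos_proj[OF uT])
      (use a in \<open>simp_all add: T_def modulation_eq_weyl adj_fourier_weyl VW fourier_weyl\<close>)
  then have "Ad T (pos_proj 0) = pos_proj 0" using a by simp
  moreover have "Ad T (pos_proj 0) = Ad fourier (Ad V (mom_proj 0))"
    unfolding T_def mom_proj_def
      by (simp add: Ad_compose unitary_compose unitary_fourier uV unitary_adj)
  ultimately have "Ad V (mom_proj 0) = mom_proj 0" by (intro mom_proj_eqI) simp
  moreover have "V (modulation l u) = modulation (a * l) (V u)" for l u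
    using VW[of l 0] by (simp add: modulation_eq_weyl)
  ultimately show thesis using that V by blast
qed

section \<open>Automorphisms\<close>

text \<open>By continuity the exponential is constant everywhere, since a nonempty open set is not
  null. Distinct values of \<gamma> x - \<beta> x then differ by at least 2 pi, and a continuous
  function on the connected line with such values is constant.\<close>

lemma linear_if_exp_AE_const:
  fixes \<gamma> :: "real \<Rightarrow> real"
  assumes cont: "continuous_on UNIV \<gamma>" and 0: "\<gamma> 0 = 0"
    and ae: "AE x in lborel. iexp (\<gamma> x - \<beta> * x) = c"
  shows "\<gamma> x = \<beta> * x"
proof -
  define k where "k x = \<gamma> x - \<beta> * x" for x
  have kc: "continuous_on UNIV k" unfolding k_def by (intro continuous_intros cont)
  have all: "iexp (k x) = c" for x
  proof (rule ccontr)
    assume ne: "iexp (k x) \<noteq> c"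
    have "open {x. iexp (k x) \<noteq> c}"
      by (intro open_Collect_neq continuous_intros kc)
    then obtain e where e: "e > 0" "\<And>y. dist y x < e \<Longrightarrow> iexp (k y) \<noteq> c"
      using ne unfolding open_dist by auto
    obtain y where "x < y" "y < x + e" "iexp (\<gamma> y - \<beta> * y) = c"
      using AE_lborel_ex[OF ae, of x "x + e"] e by auto
    then show False using e(2)[of y] by (simp add: k_def dist_real_def)
  qed
  have "k constant_on UNIV"
  proof (rule continuous_discrete_range_constant[OF connected_UNIV kc])
    fix x :: real
    have "2 * pi \<le> norm (k y - k x)" if "k y \<noteq> k x" for y
    proof -
      have "iexp (k y) = iexp (k x)" by (simp only: all)
      then obtain n :: int where n:
        "\<i> * complex_of_real (k y)
            = \<i> * complex_of_real (k x) + complex_of_real (of_int (2 * n) * pi) * \<i>"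
        unfolding exp_eq by blast
      then have "Im (\<i> * complex_of_real (k y))
          = Im (\<i> * complex_of_real (k x) + complex_of_real (of_int (2 * n) * pi) * \<i>)"
        by simp
      then have kn: "k y - k x = 2 * pi * of_int n" by simp
      with that have "n \<noteq> 0" by auto
      then have "1 \<le> \<bar>of_int n :: real\<bar>" by linarith
      then have "2 * pi * 1 \<le> 2 * pi * \<bar>of_int n :: real\<bar>" by (intro mult_left_mono) auto
      then show ?thesis by (simp add: kn abs_mult)
    qed
    then show "\<exists>e>0. \<forall>y. y \<in> UNIV \<and> k y \<noteq> k x \<longrightarrow> e \<le> norm (k y - k x)"
      using pi_gt_zero by (intro exI[of _ "2 * pi"]) auto
  qed
  then have "k x = k 0" by (auto simp: constant_on_def)
  then show ?thesis using 0 by (simp add: k_def)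
qed

text \<open>Among half-planes, those comparable with \<open>pos_proj 0\<close> are exactly the rays,
  so U and its inverse permute the rays. Preservation of order makes the induced map of the line an
  increasing bijection, hence continuous.\<close>

lemma FP_aut_position:
  assumes U: "U \<in> FP_aut" and U0: "Ad U (pos_proj 0) = pos_proj 0"
  obtains \<gamma> where "strict_mono \<gamma>" "continuous_on UNIV \<gamma>" "\<gamma> 0 = 0"
    "\<And>t. Ad U (pos_proj (\<gamma> t)) = pos_proj t"
    "\<And>l u. U (modulation l u) = mult_op (\<lambda>x. iexp (l * \<gamma> x)) (U u)"
proof -
  have u: "unitary U" using U by (rule FP_aut_unitary)
  have ex: "\<exists>s. Ad V (pos_proj t) = pos_proj s"
    if V: "V \<in> FP_aut" "Ad V (pos_proj 0) = pos_proj 0" for V t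
  proof -
    have v: "unitary V" using V(1) by (rule FP_aut_unitary)
    have "below (pos_proj t) (pos_proj 0) \<or> below (pos_proj 0) (pos_proj t)"
      by (auto simp: below_pos_proj_iff)
    then have "below (Ad V (pos_proj t)) (pos_proj 0) \<or> below (pos_proj 0) (Ad V (pos_proj t))"
      using below_Ad[OF v] V(2) by metis
    then show ?thesis
      by (intro half_planes_comparable FP_aut_half_planes V half_planes_pos_proj)
  qed
  have U0': "Ad (adj U) (pos_proj 0) = pos_proj 0" using Ad_adj_left[OF u, of "pos_proj 0"] U0
    by simp
  \<comment> \<open>\<gamma> records the action of the inverse of U: the symbol of the ray at
    \<alpha> t is the symbol of the ray at t composed with \<gamma>, because \<alpha> t \<le> x is
    equivalent to t \<le> \<gamma> x.\<close>
  obtain \<gamma> where \<gamma>: "\<And>t. Ad (adj U) (pos_proj t) = pos_proj (\<gamma> t)"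
    using ex[OF FP_aut_adj[OF U] U0'] by metis
  obtain \<alpha> where \<alpha>: "\<And>t. Ad U (pos_proj t) = pos_proj (\<alpha> t)"
    using ex[OF U U0] by metis
  have \<gamma>\<alpha>: "\<gamma> (\<alpha> t) = t" for t
    using Ad_adj_left[OF u, of "pos_proj t"] by (simp add: \<alpha> \<gamma> pos_proj_inject)
  have \<alpha>\<gamma>: "\<alpha> (\<gamma> t) = t" for t
    using Ad_adj_right[OF u, of "pos_proj t"] by (simp add: \<alpha> \<gamma> pos_proj_inject)
  have \<gamma>_le: "\<gamma> s \<le> \<gamma> t \<longleftrightarrow> s \<le> t" for s t
    using below_Ad[OF unitary_adj[OF u], of "pos_proj t" "pos_proj s"]
      by (simp add: \<gamma> below_pos_proj_iff)
  have mono: "strict_mono \<gamma>"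
    using \<gamma>_le by (auto simp: strict_mono_def less_le_not_le)
  have cont: "continuous_on UNIV \<gamma>"
  proof (rule continuous_onI_mono)
    have "surj \<gamma>" using \<gamma>\<alpha> by (rule surjI)
    then show "open (\<gamma> ` UNIV)" by simp
  qed (simp add: \<gamma>_le)
  have \<gamma>0: "\<gamma> 0 = 0" using \<gamma>[of 0] U0' by (simp add: pos_proj_inject)
  have inv: "Ad U (pos_proj (\<gamma> t)) = pos_proj t" for t by (simp add: \<alpha> \<alpha>\<gamma>)
  have "U (pos_proj t v) = mult_op (\<lambda>x. ray t (\<gamma> x)) (U v)" for t v
  proof -
    have "\<alpha> t \<le> x \<longleftrightarrow> t \<le> \<gamma> x" for x using \<gamma>_le[of "\<alpha> t" x] by (simp add: \<gamma>\<alpha>)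
    then have "(\<lambda>x. ray t (\<gamma> x)) = ray (\<alpha> t)" by (simp add: ray_def fun_eq_iff)
    moreover have "U (pos_proj t v) = pos_proj (\<alpha> t) (U v)" using \<alpha>[of t] u by (simp add: Ad_eq_iff)
    ultimately show ?thesis by (simp add: pos_proj_def)
  qed
  from intertwine_modulation_if_intertwine_pos_proj[OF u borel_measurable_continuous_onI[OF cont]
    this]
  show thesis using that mono cont \<gamma>0 inv by blast
qed

lemma FP_aut_normalized:
  assumes U: "U \<in> FP_aut" and U0: "Ad U (pos_proj 0) = pos_proj 0"
    and Q: "Ad U (mom_proj 0) = mom_proj 0 \<or> Ad U (mom_proj 0) = id_blinfun - mom_proj 0"
  shows "U \<in> FP_group"
proof -
  have u: "unitary U" using U by (rule FP_aut_unitary)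
  obtain \<gamma> where \<gamma>: "strict_mono \<gamma>" "continuous_on UNIV \<gamma>" "\<gamma> 0 = 0"
    and mod: "\<And>l u. U (modulation l u) = mult_op (\<lambda>x. iexp (l * \<gamma> x)) (U u)"
    using FP_aut_position[OF U U0] by metis
  have \<gamma>m [measurable]: "\<gamma> \<in> borel_measurable borel" using \<gamma>(2)
    by (rule borel_measurable_continuous_onI)
  \<comment> \<open>The conjugate under U of modulation by 1. This single modulation already
    determines \<gamma>, because its exponent is \<gamma> itself.\<close>
  define N where "N = mult_op (\<lambda>x. iexp (\<gamma> x))"
  have uN: "unitary N" unfolding N_def by (rule unitary_exp_op(1)[OF \<gamma>m])
  have "U (modulation 1 f) = N (U f)" for f by (simp add: mod N_def)
  then have UM: "Ad U (Ad (modulation 1) T) = Ad N (Ad U T)" for T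
    by (intro Ad_cong_commute u uN unitary_modulation)
  have Q1: "mom_proj 1 = Ad (modulation 1) (mom_proj 0)" by (simp add: Ad_modulation_mom_proj)
  have "\<exists>\<beta>. Ad N (mom_proj 0) = mom_proj \<beta> \<and> (Ad U (mom_proj 0) = mom_proj 0 \<or> \<beta> \<le> 0)"
    using Q
  proof
    assume UQ: "Ad U (mom_proj 0) = mom_proj 0"
    have "below (mom_proj 1) (mom_proj 0)" by (simp add: below_mom_proj_iff)
    then have "below (Ad U (mom_proj 1)) (mom_proj 0)" using below_Ad[OF u] UQ by metis
    then obtain \<beta> where "Ad U (mom_proj 1) = mom_proj \<beta>"
      using half_planes_comparable_mom FP_aut_half_planes[OF U half_planes_mom_proj] by blast
    then show ?thesis using UM[of "mom_proj 0"] UQ by (auto simp: Q1)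
  next
    assume UQ: "Ad U (mom_proj 0) = id_blinfun - mom_proj 0"
    have UQ': "Ad U (id_blinfun - mom_proj 0) = mom_proj 0" by (simp add: Ad_diff u Ad_id UQ)
    \<comment> \<open>Complements reverse the nest: \<open>mom_proj 0\<close> lands below the new
      projection, which gives \<beta> \<le> 0.\<close>
    have "below (id_blinfun - mom_proj 0) (id_blinfun - mom_proj 1)"
      by (intro below_complement orth_proj_mom_proj) (simp add: below_mom_proj_iff)
    then have b: "below (mom_proj 0) (Ad U (id_blinfun - mom_proj 1))" using below_Ad[OF u] UQ'
      by metis
    then obtain \<beta> where \<beta>: "Ad U (id_blinfun - mom_proj 1) = mom_proj \<beta>"
      using half_planes_comparable_mom FP_aut_half_planes[OF U
        half_planes_complement[OF half_planes_mom_proj]] by blast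
    have "\<beta> \<le> 0" using b by (simp add: \<beta> below_mom_proj_iff)
    moreover have "Ad (modulation 1) (id_blinfun - mom_proj 0) = id_blinfun - mom_proj 1"
      by (simp add: Ad_diff unitary_modulation Ad_id Q1)
    then have "Ad N (mom_proj 0) = mom_proj \<beta>" using UM[of "id_blinfun - mom_proj 0"] UQ' \<beta> by simp
    ultimately show ?thesis by blast
  qed
  then obtain \<beta> where N: "Ad N (mom_proj 0) = mom_proj \<beta>"
    and sgn: "Ad U (mom_proj 0) = mom_proj 0 \<or> \<beta> \<le> 0" by blast
  define D where "D = mult_op (\<lambda>x. iexp (\<gamma> x - \<beta> * x))"
  have bb: "bounded_borel (\<lambda>x. iexp (\<gamma> x))"
    "bounded_borel (\<lambda>x. iexp (- \<beta> * x))"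
    "bounded_borel (\<lambda>x. iexp (\<gamma> x - \<beta> * x))"
    "bounded_borel (\<lambda>x. iexp (l * x))" for l
    by (rule bounded_borel_exp, measurable)+
  have uD: "unitary D" unfolding D_def by (rule unitary_exp_op) measurable
  have "iexp (- \<beta> * x) * iexp (\<gamma> x)
      = iexp (\<gamma> x - \<beta> * x)" for x
    unfolding exp_add[symmetric] by (simp add: algebra_simps)
  then have "D = modulation (- \<beta>) o\<^sub>L N"
    unfolding D_def N_def modulation_def
    by (intro blinfun_eqI) (simp only: blinfun_apply_blinfun_compose mult_op_mult[OF bb(2,1)])
  then have "Ad D (mom_proj 0) = mom_proj 0"
    by (simp add: Ad_compose unitary_modulation uN N Ad_modulation_mom_proj)
  moreover have "D (modulation l v) = modulation l (D v)" for l v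
    unfolding D_def modulation_def by (rule mult_op_commute[OF bb(3,4)])
  ultimately obtain \<psi> where "D = phase \<psi>" using scalar_if_commutes_mom_proj[OF uD] by blast
  then have "D (L2_of (gauss 0)) = mult_op (\<lambda>_. iexp \<psi>) (L2_of (gauss 0))"
    by (simp add: phase_eq_mult_op)
  then have "AE x in lborel. iexp (\<gamma> x - \<beta> * x) = iexp \<psi>"
    unfolding D_def by (intro mult_op_eq_imp_AE[OF bb(3)]) (auto intro: gauss_nonzero)
  from linear_if_exp_AE_const[OF \<gamma>(2,3) this] have lin: "\<gamma> x = \<beta> * x" for x .
  have \<beta>: "\<beta> > 0" using strict_monoD[OF \<gamma>(1), of 0 1] by (simp add: lin)
  then have UQ: "Ad U (mom_proj 0) = mom_proj 0" using sgn by simp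
  obtain V where V: "V \<in> FP_group" "\<And>l u. V (modulation l u) = modulation (\<beta> * l) (V u)"
    "Ad V (mom_proj 0) = mom_proj 0"
    using FP_group_dilation[OF \<beta>] by metis
  have uV: "unitary V" using V(1) by (rule FP_group_unitary)
  define R where "R = adj V o\<^sub>L U"
  have uR: "unitary R" unfolding R_def by (intro unitary_compose unitary_adj uV u)
  have UM': "U (modulation l v) = modulation (\<beta> * l) (U v)" for l v
  proof -
    have "l * \<gamma> x = \<beta> * l * x" for x by (simp add: lin)
    then show ?thesis by (subst mod) (simp only: modulation_def)
  qed
  have "R (modulation l v) = modulation l (R v)" for l v
    by (rule unitary_inj[OF uV]) (simp add: R_def V(2) unitary_adj_right[OF uV] UM')
  moreover have "Ad R (mom_proj 0) = mom_proj 0"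
    using Ad_adj_left[OF uV, of "mom_proj 0"]
      by (simp add: R_def Ad_compose unitary_adj uV u UQ V(3))
  ultimately obtain \<psi> where "R = phase \<psi>" using scalar_if_commutes_mom_proj[OF uR] by blast
  then have "U = V o\<^sub>L phase \<psi>"
  proof (intro blinfun_eqI)
    fix f
    have "V (adj V (U f)) = V (phase \<psi> f)"
      using \<open>R = phase \<psi>\<close> by (simp add: R_def flip: blinfun_apply_blinfun_compose)
    then show "U f = (V o\<^sub>L phase \<psi>) f" by (simp add: unitary_adj_right[OF uV])
  qed
  then show ?thesis using V(1) by (simp add: FP_group_compose FP_group_generators)
qed

text \<open>The two normalisations are compatible because chirps and modulations fix the position
  ray at 0: once U has been corrected to fix it, a factor W built from these can straighten the
  image of \<open>mom_proj 0\<close> without undoing the first correction.\<close>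

lemma FP_aut_subset_group:
  assumes U: "U \<in> FP_aut"
  shows "U \<in> FP_group"
proof -
  have cancel: "W \<in> FP_group" if "V \<in> FP_group" "adj V o\<^sub>L W \<in> FP_group" for V W
  proof -
    have "W = V o\<^sub>L (adj V o\<^sub>L W)"
      by (rule blinfun_eqI) (simp add: unitary_adj_right[OF FP_group_unitary[OF that(1)]])
    then show ?thesis using FP_group_compose[OF that] by metis
  qed
  obtain V where V: "V \<in> FP_group" "Ad U (pos_proj 0) = Ad V (pos_proj 0)"
    using half_planes_transitive[OF FP_aut_half_planes[OF U half_planes_pos_proj]] by metis
  define U1 where "U1 = adj V o\<^sub>L U"
  have uV: "unitary V" and uU: "unitary U" using V FP_group_unitary U FP_aut_unitary by auto
  have U1: "U1 \<in> FP_aut"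
    unfolding U1_def using V(1) FP_group_subset_aut by (intro FP_aut_compose FP_aut_adj U) auto
  have U10: "Ad U1 (pos_proj 0) = pos_proj 0"
    unfolding U1_def using V(2) by (simp add: Ad_compose unitary_adj uV uU Ad_adj_left)
  have u1: "unitary U1" using U1 by (rule FP_aut_unitary)
  obtain \<gamma> where \<gamma>: "\<And>t. Ad U1 (pos_proj (\<gamma> t)) = pos_proj t"
    using FP_aut_position[OF U1 U10] by metis
  have \<gamma>': "Ad U1 (id_blinfun - pos_proj (\<gamma> t)) = id_blinfun - pos_proj t" for t
    by (simp add: Ad_diff u1 Ad_id \<gamma>)
  have "Ad U1 (mom_proj 0) \<in> half_planes" by (rule FP_aut_half_planes[OF U1 half_planes_mom_proj])
  then obtain s t where st: "Ad U1 (mom_proj 0) = Ad (chirp s) (mom_proj t) \<or>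
      Ad U1 (mom_proj 0) = id_blinfun - Ad (chirp s) (mom_proj t)"
  proof (cases rule: half_planes_cases)
    \<comment> \<open>Every ray is already the image of a ray under U1, so a vertical image would
      make \<open>mom_proj 0\<close> itself vertical by injectivity.\<close>
    case (vertical t)
    then have "Ad U1 (mom_proj 0) = Ad U1 (pos_proj (\<gamma> t)) \<or> Ad U1 (mom_proj 0)
        = Ad U1 (id_blinfun - pos_proj (\<gamma> t))"
      by (simp add: \<gamma> \<gamma>')
    then show ?thesis using mom_proj_0_not_vertical by (simp add: Ad_inject[OF u1])
  qed (rule that)
  define W where "W = chirp s o\<^sub>L modulation t"
  have W: "W \<in> FP_group" unfolding W_def by (intro FP_group_compose FP_group_generators)
  have uW: "unitary W" using W by (rule FP_group_unitary)
  have WQ: "Ad W (mom_proj 0) = Ad (chirp s) (mom_proj t)"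
    unfolding W_def by (simp add: Ad_compose unitary_chirp unitary_modulation
      Ad_modulation_mom_proj)
  have "Ad (modulation t) (pos_proj 0) = pos_proj 0"
    by (simp add: modulation_eq_weyl Ad_weyl_pos_proj)
  then have WE: "Ad W (pos_proj 0) = pos_proj 0"
    unfolding W_def by (simp add: Ad_compose unitary_chirp unitary_modulation Ad_chirp_pos_proj)
  have "adj W o\<^sub>L U1 \<in> FP_group"
  proof (rule FP_aut_normalized)
    show "adj W o\<^sub>L U1 \<in> FP_aut"
      using W FP_group_subset_aut by (intro FP_aut_compose FP_aut_adj U1) auto
    show "Ad (adj W o\<^sub>L U1) (pos_proj 0) = pos_proj 0"
      using Ad_adj_left[OF uW, of "pos_proj 0"] by (simp add: Ad_compose unitary_adj uW u1 U10 WE)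
    have "Ad (adj W) (Ad (chirp s) (mom_proj t)) = mom_proj 0"
      using Ad_adj_left[OF uW, of "mom_proj 0"] by (simp add: WQ)
    then show "Ad (adj W o\<^sub>L U1) (mom_proj 0) = mom_proj 0 \<or> Ad (adj W o\<^sub>L U1) (mom_proj 0)
        = id_blinfun - mom_proj 0"
      using st by (auto simp: Ad_compose unitary_adj uW u1 Ad_diff Ad_id)
  qed
  then have "U1 \<in> FP_group" by (rule cancel[OF W])
  then show ?thesis unfolding U1_def by (rule cancel[OF V(1)])
qed

theorem theorem5p2:
  shows "unitary_automorphism_group FP_sphere =
    generate unitary_group
      (range chirp \<union> range modulation \<union> {fourier} \<union> range phase)"
  unfolding FP_sphere_eq FP_group_def[symmetric]
  using FP_aut_subset_group FP_group_subset_aut by blast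

end
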